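(* Let $n>3$. In the extended symmetric $SL_n$ quiver, let $a_1,\dots,a_{2n-2}$ be the variables along the zig-zag path of the matrix element $G_{i,i+1}=\langle a_1a_2\cdots a_{2n-2}\rangle$, let $b_1,\dots,b_{2n-4}$ be the variables of the vertices adjacent to the path, and let $a_t$ be the variable of the extra vertex. Put $$\eta_{2n-2}=1,\quad \eta_{2n-3}=1+a_{2n-2},\quad \eta_{2n-4}=1+a_{2n-2}+a_{2n-2}a_{2n-3},\ \dots,\quad \eta_1=1+a_{2n-2}+a_{2n-2}a_{2n-3}+\dots+a_{2n-2}a_{2n-3}\cdots a_3a_2 .$$ Then the transformation $$a'_k=a_k\frac{\eta_{k+1}}{\eta_{k-1}}\ (k=2,\dots,2n-3),\qquad a'_1=\frac{\eta_2}{a_{2n-2}a_{2n-3}\cdots a_2},\qquad a'_{2n-2}=\frac{a_1a_2\cdots a_{2n-3}a_{2n-2}^2}{\eta_1\eta_{2n-3}},$$ $$b'_j=b_j\frac{\eta_j}{\eta_{j+2}}\ (j=1,\dots,2n-4),\qquad \Bigl(a'_t=a_t\frac{\eta_1\eta_{2n-3}}{\eta_2\,a_1a_{2n-2}}\Bigr),$$ with all other variables unchanged, corresponds to the braid-group transformation with the matrix element $G_{i,i+1}=\langle a_1a_2\cdots a_{2n-2}\rangle$.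
   Context: Telescopic sums: $\langle x_1\cdots x_m\rangle:=(x_1\cdots x_m)^{1/2}\bigl(1+\frac1{x_1}+\frac1{x_1x_2}+\dots+\frac1{x_1\cdots x_m}\bigr)$. Symmetric $SL_n$ quiver: vertices (and variables) $s_{i,j}$, $1\le i\le n-1$, $1\le j\le n$, with the second index extended by the Möbius rule $s_{i,j+n}=s_{n-i,j}$; for $i+j$ even there are arrows $s_{i\pm1,j}\to s_{i,j}$ (when $1\le i\pm1\le n-1$) and $s_{i,j}\to s_{i,j\pm1}$. The extended quiver has one more vertex $a_t$, joined to all vertices of the outer boundary $\{s_{1,j},s_{n-1,j}\}$ so that every vertex $s_{i,j}$ has two incoming and two outgoing arrows. Poisson bracket: $\{x,y\}=\varepsilon_{xy}xy$, with $\varepsilon_{xy}$ the number of arrows $x\to y$ minus the number of arrows $y\to x$. Matrix elements: with $q=2l+c$ ($c$ a fixed odd integer; $c=3$ for $n=4$), $G_{l,l+1}$, $1\le l\le n-1$, is the telescopic sum along the zig-zag path of $2n-2$ vertices $s_{1,q},s_{1,q-1},s_{2,q-1},s_{2,q-2},\dots,s_{n-1,q-n+2},s_{n-1,q-n+1}$, and $\widetilde G_{l,l+1}$ is the telescopic sum along $s_{1,q},s_{1,q+1},s_{2,q+1},s_{2,q+2},\dots,s_{n-1,q+n-2},s_{n-1,q+n-1}$. The remaining $G_{k,l}$ are generated by $G_{k,l}=\frac12G_{k,m}G_{m,l}+\{G_{k,m},G_{m,l}\}$, $k<m<l$ (similarly for $\widetilde G_{k,l}$). The numbers $(-1)^{k+l}G_{k,l}$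 and $(-1)^{k+l}\widetilde G_{k,l}$, $k<l$, are the entries of the unipotent upper-triangular source and target matrices $\mathbb A$ and $\widetilde{\mathbb A}=B\mathbb AB^{\mathrm T}$ of the symplectic groupoid of unipotent upper-triangular forms. Along the path of $G_{i,i+1}$ the arrows are $a_k\to a_{k+1}$ and $a_1\to a_{2n-2}$; $b_j$ is the vertex off the path with $b_j\to a_j$ and $a_{j+2}\to b_j$; and $a_t\to a_1$, $a_2\to a_t$, $a_t\to a_{2n-3}$, $a_{2n-2}\to a_t$. The displayed transformation is the result of the chain of mutations $\mu_{a_2}\mu_{a_3}\cdots\mu_{a_{2n-3}}\mu_{a_{2n-2}}\mu_{a_{2n-3}}\cdots\mu_{a_3}\mu_{a_2}$, which returns the same quiver. Braid-group transformation with the matrix element $G_{i,i+1}$: $\mathbb A\mapsto B_i\mathbb AB_i^{\mathrm T}$, where $B_i$ is the identity matrix with the $2\times2$ diagonal block in rows and columns $i,i+1$ replaced by $\begin{pmatrix}G_{i,i+1}&1\\-1&0\end{pmatrix}$, while $\widetilde{\mathbb A}$ is unchanged; for example, $G_{i-1,i}\mapsto G_{i-1,i}G_{i,i+1}-G_{i-1,i+1}$. *)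

theory Defs
  imports "HOL-Analysis.Derivative" "Jordan_Normal_Form.Matrix"
begin

section \<open>The extended symmetric quiver\<close>

text \<open>\<open>S i j\<close> is used with \<open>1 \<le> i \<le> n - 1\<close> and \<open>1 \<le> j \<le> n\<close>; \<open>Extra\<close> is the vertex of the
  variable \<open>a\<^sub>t\<close>.\<close>

datatype vertex = S int int | Extra

definition quiver_vertices :: "nat \<Rightarrow> vertex set" where
  "quiver_vertices n = insert Extra ((\<lambda>(i, j). S i j) ` ({1..int n - 1} \<times> {1..int n}))"

text \<open>The vertex \<open>s\<^sub>i\<^sub>,\<^sub>j\<close> for arbitrary integer \<open>j\<close>, by the Moebius rule
  \<open>s\<^sub>i\<^sub>,\<^sub>j\<^sub>+\<^sub>n = s\<^sub>n\<^sub>-\<^sub>i\<^sub>,\<^sub>j\<close>.\<close>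

definition sv :: "nat \<Rightarrow> int \<Rightarrow> int \<Rightarrow> vertex" where
  "sv n i j = S (if even ((j - 1) div int n) then i else int n - i) ((j - 1) mod int n + 1)"

lemma sv_moebius: "n > 0 \<Longrightarrow> sv n i (j + int n) = sv n (int n - i) j"
proof -
  assume "n > 0"
  have "(j + int n - 1) div int n = (j - 1) div int n + 1"
    using \<open>n > 0\<close> div_add_self2[of "int n" "j - 1"] by (simp add: algebra_simps)
  moreover have "(j + int n - 1) mod int n = (j - 1) mod int n"
    using mod_add_self2[of "j - 1" "int n"] by (simp add: algebra_simps)
  ultimately show ?thesis
    by (simp add: sv_def)
qed

text \<open>For \<open>n > 2\<close> no two vertices are joined by more than one arrow, so a relation suffices.
  At the boundary vertices \<open>s\<^sub>1\<^sub>,\<^sub>j\<close>, \<open>s\<^sub>n\<^sub>-\<^sub>1\<^sub>,\<^sub>j\<close> the other arrows are one in and two out for \<open>i + j\<close>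
  even, two in and one out for \<open>i + j\<close> odd; this dictates the arrows at \<open>Extra\<close>.\<close>

inductive arrow :: "nat \<Rightarrow> vertex \<Rightarrow> vertex \<Rightarrow> bool" for n where
  down: "1 \<le> i \<Longrightarrow> i + 1 \<le> int n - 1 \<Longrightarrow> even (i + j) \<Longrightarrow> arrow n (sv n (i + 1) j) (sv n i j)"
| up: "1 \<le> i - 1 \<Longrightarrow> i \<le> int n - 1 \<Longrightarrow> even (i + j) \<Longrightarrow> arrow n (sv n (i - 1) j) (sv n i j)"
| right: "1 \<le> i \<Longrightarrow> i \<le> int n - 1 \<Longrightarrow> even (i + j) \<Longrightarrow> arrow n (sv n i j) (sv n i (j + 1))"
| left: "1 \<le> i \<Longrightarrow> i \<le> int n - 1 \<Longrightarrow> even (i + j) \<Longrightarrow> arrow n (sv n i j) (sv n i (j - 1))"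
| from_extra: "i \<in> {1, int n - 1} \<Longrightarrow> even (i + j) \<Longrightarrow> arrow n Extra (sv n i j)"
| to_extra: "i \<in> {1, int n - 1} \<Longrightarrow> odd (i + j) \<Longrightarrow> arrow n (sv n i j) Extra"

definition eps :: "nat \<Rightarrow> vertex \<Rightarrow> vertex \<Rightarrow> real" where
  "eps n u v = of_bool (arrow n u v) - of_bool (arrow n v u)"

section \<open>Functions of the quiver variables and their Poisson bracket\<close>

type_synonym state = "vertex \<Rightarrow> real"

definition pderiv_at :: "vertex \<Rightarrow> (state \<Rightarrow> real) \<Rightarrow> state \<Rightarrow> real" where
  "pderiv_at v f x = deriv (\<lambda>t. f (x(v := t))) (x v)"

text \<open>The biderivation extending \<open>{u, v} = \<epsilon>\<^sub>u\<^sub>v u v\<close> on the variables.\<close>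

definition poisson :: "nat \<Rightarrow> (state \<Rightarrow> real) \<Rightarrow> (state \<Rightarrow> real) \<Rightarrow> state \<Rightarrow> real" where
  "poisson n f g x = (\<Sum>u\<in>quiver_vertices n. \<Sum>v\<in>quiver_vertices n.
     eps n u v * x u * x v * pderiv_at u f x * pderiv_at v g x)"

definition telescopic :: "real list \<Rightarrow> real" where
  "telescopic xs = sqrt (prod_list xs) * (\<Sum>k\<le>length xs. 1 / prod_list (take k xs))"

section \<open>Matrix elements\<close>

text \<open>The \<open>k\<close>-th vertex, \<open>1 \<le> k \<le> 2n - 2\<close>, of the zig-zag path
  \<open>s\<^sub>1\<^sub>,\<^sub>q, s\<^sub>1\<^sub>,\<^sub>q\<^sub>-\<^sub>1, s\<^sub>2\<^sub>,\<^sub>q\<^sub>-\<^sub>1, s\<^sub>2\<^sub>,\<^sub>q\<^sub>-\<^sub>2, \<dots>\<close>, and of the path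
  \<open>s\<^sub>1\<^sub>,\<^sub>q, s\<^sub>1\<^sub>,\<^sub>q\<^sub>+\<^sub>1, s\<^sub>2\<^sub>,\<^sub>q\<^sub>+\<^sub>1, s\<^sub>2\<^sub>,\<^sub>q\<^sub>+\<^sub>2, \<dots>\<close> for the target matrix.\<close>

definition path :: "nat \<Rightarrow> int \<Rightarrow> nat \<Rightarrow> vertex" where
  "path n q k = sv n (int ((k + 1) div 2)) (q - int (k div 2))"

definition path_target :: "nat \<Rightarrow> int \<Rightarrow> nat \<Rightarrow> vertex" where
  "path_target n q k = sv n (int ((k + 1) div 2)) (q + int (k div 2))"

definition elem_source :: "nat \<Rightarrow> int \<Rightarrow> nat \<Rightarrow> state \<Rightarrow> real" where
  "elem_source n c l x = telescopic (map (\<lambda>k. x (path n (2 * int l + c) k)) [1..<2 * n - 1])"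

definition elem_target :: "nat \<Rightarrow> int \<Rightarrow> nat \<Rightarrow> state \<Rightarrow> real" where
  "elem_target n c l x =
     telescopic (map (\<lambda>k. x (path_target n (2 * int l + c) k)) [1..<2 * n - 1])"

text \<open>\<open>generated n \<sigma> E k l f\<close>: starting from \<open>G\<^sub>l\<^sub>,\<^sub>l\<^sub>+\<^sub>1 = E l\<close>, the function \<open>f\<close> is obtained as
  \<open>G\<^sub>k\<^sub>,\<^sub>l\<close> by the rule \<open>G\<^sub>k\<^sub>,\<^sub>l = (1/2) G\<^sub>k\<^sub>,\<^sub>m G\<^sub>m\<^sub>,\<^sub>l + \<sigma> {G\<^sub>k\<^sub>,\<^sub>m, G\<^sub>m\<^sub>,\<^sub>l}\<close>, for any choice of the
  intermediate indices \<open>m\<close>. The displayed rule has \<open>\<sigma> = 1\<close>; since the target map of a symplectic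
  groupoid is anti-Poisson, for the target matrix \<open>\<sigma> = -1\<close> is allowed as well.\<close>

inductive generated ::
    "nat \<Rightarrow> real \<Rightarrow> (nat \<Rightarrow> state \<Rightarrow> real) \<Rightarrow> nat \<Rightarrow> nat \<Rightarrow> (state \<Rightarrow> real) \<Rightarrow> bool"
  for n \<sigma> E where
  elementary: "generated n \<sigma> E l (l + 1) (E l)"
| bracket: "k < m \<Longrightarrow> m < l \<Longrightarrow> generated n \<sigma> E k m f \<Longrightarrow> generated n \<sigma> E m l g \<Longrightarrow>
    generated n \<sigma> E k l (\<lambda>x. 1 / 2 * f x * g x + \<sigma> * poisson n f g x)"

text \<open>Rows and columns of matrices are numbered from 0, those of \<open>G\<close> from 1.\<close>

definition unipotent_form :: "nat \<Rightarrow> (nat \<Rightarrow> nat \<Rightarrow> state \<Rightarrow> real) \<Rightarrow> state \<Rightarrow> real mat" where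
  "unipotent_form n G x = mat n n (\<lambda>(r, s).
     if r = s then 1
     else if r < s then (-1) ^ ((r + 1) + (s + 1)) * G (r + 1) (s + 1) x
     else 0)"

definition braid_matrix :: "nat \<Rightarrow> nat \<Rightarrow> real \<Rightarrow> real mat" where
  "braid_matrix n i g = mat n n (\<lambda>(r, s).
     if (r + 1, s + 1) = (i, i) then g
     else if (r + 1, s + 1) = (i, i + 1) then 1
     else if (r + 1, s + 1) = (i + 1, i) then -1
     else if (r + 1, s + 1) = (i + 1, i + 1) then 0
     else if r = s then 1 else 0)"

section \<open>The transformation of the quiver variables\<close>

text \<open>The \<open>j\<close>-th vertex \<open>b\<^sub>j\<close> adjacent to the path, \<open>1 \<le> j \<le> 2n - 4\<close>; the lemmas below show
  that it has the required arrows.\<close>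

definition adj :: "nat \<Rightarrow> int \<Rightarrow> nat \<Rightarrow> vertex" where
  "adj n q j = (if odd j then sv n (int (j div 2) + 2) (q - int (j div 2))
                else sv n (int (j div 2)) (q - int (j div 2) - 1))"

lemma arrow_adj_path:
  assumes "odd q" "j \<in> {1..2 * n - 4}"
  shows "arrow n (adj n q j) (path n q j)"
proof (cases "odd j")
  case True
  then obtain m where m: "j = 2 * m + 1" by (auto elim: oddE)
  then have "arrow n (sv n ((int m + 1) + 1) (q - int m)) (sv n (int m + 1) (q - int m))"
    using assms by (intro arrow.down) auto
  then show ?thesis using m by (simp add: adj_def path_def algebra_simps)
next
  case False
  then obtain m where m: "j = 2 * m" by (auto elim: evenE)
  then have "arrow n (sv n (int m) (q - int m - 1)) (sv n (int m) (q - int m - 1 + 1))"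
    using assms by (intro arrow.right) auto
  then show ?thesis using m by (simp add: adj_def path_def algebra_simps)
qed

lemma arrow_path_adj:
  assumes "odd q" "j \<in> {1..2 * n - 4}"
  shows "arrow n (path n q (j + 2)) (adj n q j)"
proof (cases "odd j")
  case True
  then obtain m where m: "j = 2 * m + 1" by (auto elim: oddE)
  then have "arrow n (sv n (int m + 2) (q - int m - 1)) (sv n (int m + 2) (q - int m - 1 + 1))"
    using assms by (intro arrow.right) auto
  then show ?thesis using m by (simp add: adj_def path_def algebra_simps)
next
  case False
  then obtain m where m: "j = 2 * m" by (auto elim: evenE)
  then have "arrow n (sv n (int m + 1) (q - int m - 1)) (sv n (int m + 1 - 1) (q - int m - 1))"
    using assms arrow.down[of "int m" n "q - int m - 1"] by auto
  then show ?thesis using m by (simp add: adj_def path_def algebra_simps)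
qed

text \<open>\<open>\<eta>\<^sub>k = 1 + a\<^sub>N + a\<^sub>N a\<^sub>N\<^sub>-\<^sub>1 + \<dots> + a\<^sub>N \<dots> a\<^sub>k\<^sub>+\<^sub>1\<close> with \<open>N = 2n - 2\<close>; the term \<open>r = N + 1\<close> is the
  empty product.\<close>

definition eta :: "nat \<Rightarrow> (nat \<Rightarrow> real) \<Rightarrow> nat \<Rightarrow> real" where
  "eta n a k = (\<Sum>r = k + 1..2 * n - 1. \<Prod>p = r..2 * n - 2. a p)"

definition braid_transformation :: "nat \<Rightarrow> int \<Rightarrow> state \<Rightarrow> state \<Rightarrow> bool" where
  "braid_transformation n q x x' \<longleftrightarrow>
    (let N = 2 * n - 2; a = (\<lambda>k. x (path n q k)); \<eta> = eta n a in
      (\<forall>k\<in>{2..N - 1}. x' (path n q k) = a k * \<eta> (k + 1) / \<eta> (k - 1)) \<and>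
      x' (path n q 1) = \<eta> 2 / (\<Prod>k = 2..N. a k) \<and>
      x' (path n q N) = (\<Prod>k = 1..N - 1. a k) * (a N)\<^sup>2 / (\<eta> 1 * \<eta> (N - 1)) \<and>
      (\<forall>j\<in>{1..2 * n - 4}. x' (adj n q j) = x (adj n q j) * \<eta> j / \<eta> (j + 2)) \<and>
      x' Extra = x Extra * (\<eta> 1 * \<eta> (N - 1)) / (\<eta> 2 * a 1 * a N) \<and>
      (\<forall>v\<in>quiver_vertices n - path n q ` {1..N} - adj n q ` {1..2 * n - 4} - {Extra}.
         x' v = x v))"

text \<open>The vertices named in the transformation are pairwise distinct, so that it is well defined.\<close>

lemma sv_eqD:
  assumes "sv n i j = sv n i' j'" "\<bar>j - j'\<bar> < int n"
  shows "i = i' \<and> j = j'"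
proof -
  have m: "(j - 1) mod int n = (j' - 1) mod int n"
    using assms(1) by (simp add: sv_def)
  then have "int n dvd j - j'"
    using mod_eq_dvd_iff[of "j - 1" "int n" "j' - 1"] by simp
  with assms(2) have "j = j'"
    using dvd_imp_le_int[of "j - j'" "int n"] by fastforce
  with assms(1) show ?thesis by (auto simp: sv_def split: if_splits)
qed

lemma path_inj: "inj_on (path n q) {1..2 * n - 2}"
proof (rule inj_onI)
  fix k l assume *: "k \<in> {1..2 * n - 2}" "l \<in> {1..2 * n - 2}" "path n q k = path n q l"
  then have "int ((k + 1) div 2) = int ((l + 1) div 2) \<and> q - int (k div 2) = q - int (l div 2)"
    unfolding path_def by (intro sv_eqD[of n]) auto
  then show "k = l" by presburger
qed

lemma adj_inj: "inj_on (adj n q) {1..2 * n - 4}"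
proof (rule inj_onI)
  fix k l assume *: "k \<in> {1..2 * n - 4}" "l \<in> {1..2 * n - 4}" "adj n q k = adj n q l"
  have 1: "adj n q k = sv n (int (k div 2) + (if odd k then 2 else 0))
      (q - int (k div 2) - (if odd k then 0 else 1))" for k
    by (simp add: adj_def)
  have "int (k div 2) + (if odd k then 2 else 0) = int (l div 2) + (if odd l then 2 else 0) \<and>
      q - int (k div 2) - (if odd k then 0 else 1) = q - int (l div 2) - (if odd l then 0 else 1)"
    using * unfolding 1 by (intro sv_eqD[of n]) auto
  then show "k = l" by (auto split: if_splits; presburger)
qed

lemma path_neq_adj:
  assumes "k \<in> {1..2 * n - 2}" "l \<in> {1..2 * n - 4}"
  shows "path n q k \<noteq> adj n q l"
proof
  assume *: "path n q k = adj n q l"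
  have 1: "adj n q l = sv n (int (l div 2) + (if odd l then 2 else 0))
      (q - int (l div 2) - (if odd l then 0 else 1))"
    by (simp add: adj_def)
  have "int ((k + 1) div 2) = int (l div 2) + (if odd l then 2 else 0) \<and>
      q - int (k div 2) = q - int (l div 2) - (if odd l then 0 else 1)"
    using assms * unfolding 1 path_def by (intro sv_eqD[of n]) auto
  then show False by (auto split: if_splits; presburger)
qed

lemma braid_transformation_exists:
  assumes "n > 3"
  shows "\<exists>x'. braid_transformation n q x x'"
proof -
  define N where "N = 2 * n - 2"
  define a where "a = (\<lambda>k. x (path n q k))"
  define \<eta> where "\<eta> = eta n a"
  define A where "A k = (if k = 1 then \<eta> 2 / (\<Prod>k = 2..N. a k)
    else if k = N then (\<Prod>k = 1..N - 1. a k) * (a N)\<^sup>2 / (\<eta> 1 * \<eta> (N - 1))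
    else a k * \<eta> (k + 1) / \<eta> (k - 1))" for k
  define x' where "x' v =
    (if v \<in> path n q ` {1..N} then A (the_inv_into {1..N} (path n q) v)
     else if v \<in> adj n q ` {1..2 * n - 4} then
       (let j = the_inv_into {1..2 * n - 4} (adj n q) v in x v * \<eta> j / \<eta> (j + 2))
     else if v = Extra then x Extra * (\<eta> 1 * \<eta> (N - 1)) / (\<eta> 2 * a 1 * a N) else x v)" for v
  have p: "x' (path n q k) = A k" if "k \<in> {1..N}" for k
    using that the_inv_into_f_f[OF path_inj[of n q], of k] by (simp add: x'_def N_def)
  have b: "x' (adj n q j) = x (adj n q j) * \<eta> j / \<eta> (j + 2)" if "j \<in> {1..2 * n - 4}" for j
  proof -
    have "adj n q j \<notin> path n q ` {1..N}"
      using that path_neq_adj[of _ n j q] unfolding N_def by (metis imageE)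
    then show ?thesis
      using that the_inv_into_f_f[OF adj_inj[of n q], of j] by (simp add: x'_def Let_def)
  qed
  have "Extra \<notin> path n q ` {1..N}" "Extra \<notin> adj n q ` {1..2 * n - 4}"
    by (auto simp: path_def adj_def sv_def split: if_splits)
  then have e: "x' Extra = x Extra * (\<eta> 1 * \<eta> (N - 1)) / (\<eta> 2 * a 1 * a N)"
    by (simp add: x'_def)
  have "braid_transformation n q x x'"
    unfolding braid_transformation_def Let_def
      N_def[symmetric] a_def[symmetric] \<eta>_def[symmetric]
  proof (intro conjI ballI)
    fix v assume "v \<in> quiver_vertices n - path n q ` {1..N} - adj n q ` {1..2 * n - 4} - {Extra}"
    then show "x' v = x v" by (simp add: x'_def)
  qed (use assms e b p in \<open>auto simp: A_def N_def a_def\<close>)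
  then show ?thesis by blast
qed

end

theory Submission
  imports Defs "HOL-Library.Poly_Mapping" "HOL-Library.Function_Algebras"
begin

text \<open>Both matrices grow out of their superdiagonals by the single operation
  \<open>1/2 a b + {a, b}\<close>. A substitution that preserves the Poisson bracket is therefore
  known on all entries as soon as it is known on the elementary telescopic sums. This leaves an
  algebraic, a Poisson and a computational task.

  Algebra. The elementary source sums commute at distance at least two, and neighbours
  \<open>P\<close>, \<open>G\<close> satisfy \<open>{{P, G}, G} = 1/4 P G G - P\<close> together
  with its mirror image (\<open>nelson_regge_source\<close>). The reason is that brackets of
  monomials are multiples of their products: two paths share exactly two vertices, and the brackets
  of the monomials sum up accordingly (\<open>pb_far\<close>, \<open>adjacent_brackets\<close>).
  With the Jacobi identity these relations imply that the generated entries do not depend on the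
  intermediate indices (\<open>F_split\<close>), and that the entries of \<open>B A B^T\<close>
  arise from their own superdiagonal by the same operation (\<open>braided_entries\<close>).

  Poisson property. Put \<open>p_r = a_r ... a_N\<close> with \<open>N = 2n - 2\<close>, so that
  \<open>\<eta>_k\<close> is the sum of the \<open>p_r\<close> with \<open>r > k\<close>, including
  the empty product. The transformation sends \<open>p_r\<close> to
  \<open>p_1 p_r / (\<eta>_1 \<eta>_r \<eta>_(r-1))\<close> for \<open>r > 1\<close> and
  \<open>p_1\<close> to \<open>p_1 / \<eta>_1^2\<close>, and these have the same logarithmic
  brackets as before (\<open>Om_tl'\<close>). The products \<open>b_j a_(j+1)\<close> are unchanged
  and commute with the whole path, and so do the variables off the path and its neighbours. Hence
  the substitution is a Poisson map (\<open>log_gradient_phi\<close>, \<open>poisson_phi\<close>).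

  Computation. The sum \<open>G_(i,i+1)\<close> equals \<open>\<eta>_0 / sqrt p_1\<close>, and both
  quantities are divided by \<open>\<eta>_1\<close>. A source path that is not a neighbour meets the
  altered vertices in four consecutive places, where the telescopic sum is insensitive to the change
  (\<open>tel_quad\<close>). The two neighbouring source sums become
  \<open>P G - G_(i-1,i+1)\<close> and \<open>G_(i,i+2)\<close> (\<open>tel_source_prev\<close>,
  \<open>tel_source_next\<close>). Every elementary target sum is invariant, by
  \<open>tel_quad\<close> or by an induction along the path (\<open>tel_target_same\<close>,
  \<open>tel_target_next\<close>).

  To make the bracket algebraic, the matrix elements are represented by Laurent polynomials with
  real exponents, evaluated at positive states; there the bracket defined by derivatives coincides
  with the formal one (\<open>poisson_ev\<close>).\<close>

section \<open>Poisson rings and the bracket of two neighbouring telescopic sums\<close>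

locale poisson_ring =
  fixes br :: "'a::comm_ring_1 \<Rightarrow> 'a \<Rightarrow> 'a" and h :: 'a
  assumes half: "h + h = 1"
    and br_add_left: "br (a + b) c = br a c + br b c"
    and br_swap: "br a b = - br b a"
    and br_mult_left: "br (a * b) c = a * br b c + br a c * b"
    and jacobi: "br (br a b) c = br a (br b c) - br b (br a c)"
begin

lemma br_add_right: "br a (b + c) = br a b + br a c"
  using br_add_left[of b c a] br_swap[of a] by simp

lemma br_mult_right: "br a (b * c) = b * br a c + br a b * c"
  using br_mult_left[of b c a] br_swap[of a] by (simp add: algebra_simps)

lemma br_0_left [simp]: "br 0 a = 0"
  using br_add_left[of 0 0 a] by simp

lemma br_0_right [simp]: "br a 0 = 0"
  using br_swap[of a 0] by simp

lemma br_minus_left: "br (- a) b = - br a b"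
  using br_add_left[of a "- a" b] by (simp add: eq_neg_iff_add_eq_0 add.commute)

lemma br_minus_right: "br a (- b) = - br a b"
  using br_minus_left[of b a] br_swap[of a] by simp

lemma br_diff_left: "br (a - b) c = br a c - br b c"
  using br_add_left[of a "- b" c] by (simp add: br_minus_left)

lemma br_diff_right: "br a (b - c) = br a b - br a c"
  using br_add_right[of a b "- c"] by (simp add: br_minus_right)

lemma br_sum_left: "br (sum f K) c = (\<Sum>k\<in>K. br (f k) c)"
  by (induction K rule: infinite_finite_induct) (auto simp: br_add_left)

lemma br_sum_right: "br c (sum f K) = (\<Sum>k\<in>K. br c (f k))"
  by (induction K rule: infinite_finite_induct) (auto simp: br_add_right)

lemma half_mult: "h * a + h * a = a"
  by (metis half distrib_right mult_1)

lemma br_1_left [simp]: "br 1 a = 0"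
  using br_mult_left[of 1 1 a] by simp

lemma br_half_left [simp]: "br h a = 0"
  by (metis br_1_left br_add_left half half_mult mult.commute distrib_left mult_zero_right)

lemma br_half_right [simp]: "br a h = 0"
  using br_swap[of a h] by simp

lemma br_self [simp]: "br a a = 0"
proof -
  have "br a a + br a a = 0" using br_swap[of a a] by (simp add: eq_neg_iff_add_eq_0)
  then show ?thesis by (metis half_mult distrib_left mult_zero_right)
qed

lemmas br_simps = br_add_left br_add_right br_mult_left br_mult_right br_minus_left br_minus_right
  br_diff_left br_diff_right

text \<open>Reversing the bracket lets two sums exchange roles, so one computation yields both
  Serre-type relations; see \<open>pb_near_mirror\<close>.\<close>

lemma opposite: "poisson_ring (\<lambda>a b. br b a) h"
proof
  show "br c (a + b) = br c a + br c b" for a b c by (rule br_add_right)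
  show "br b a = - br a b" for a b by (rule br_swap)
  show "br c (a * b) = a * br c b + br c a * b" for a b c by (rule br_mult_right)
  show "br c (br b a) = br (br c b) a - br (br c a) b" for a b c
    using jacobi[of c b a] br_swap[of "br c a" b] by simp
qed (rule half)

text \<open>For \<open>j < N - 2\<close> the brackets of \<open>Y j\<close> cut \<open>G\<close>
  into a lower part \<open>L\<close> and an upper part \<open>H\<close> with
  \<open>{Y, G} = h Y (L - H)\<close>. Only the pair \<open>A 0\<close>, \<open>A N\<close> deviates
  from \<open>{A j, A k} = A j * A k\<close>, so \<open>{L, H} = L H - 1\<close>, and the second
  relation holds term by term. The last three \<open>Y\<close> satisfy it only jointly: the ratios
  \<open>Y1\<close> and \<open>Y2\<close>, which express that the two paths share two vertices, make
  their deviations cancel.\<close>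

lemma adjacent_brackets:
  fixes A Y :: "nat \<Rightarrow> 'a"
  assumes N: "even N" "4 \<le> N"
    and AA: "\<And>j k. j < k \<Longrightarrow> k \<le> N \<Longrightarrow> \<not> (j = 0 \<and> k = N) \<Longrightarrow> br (A j) (A k) = A j * A k"
    and ends: "br (A 0) (A N) = 0" "A 0 * A N = 1"
    and Y1: "Y (N - 1) = Y (N - 2) * A 1 * A N" and Y2: "Y N = Y (N - 2) * A 2 * A N"
    and low: "\<And>j k. j < N - 2 \<Longrightarrow> k \<le> N \<Longrightarrow>
      br (Y j) (A k) = (if k \<le> 2 * ((j + 1) div 2) + 1 then h else - h) * Y j * A k"
    and top2: "\<And>k. k \<le> N \<Longrightarrow> br (Y (N - 2)) (A k)
      = ((if k = N then - h else h) + of_bool (k \<in> {1, 2})) * Y (N - 2) * A k"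
    and top1: "\<And>k. k \<le> N \<Longrightarrow> br (Y (N - 1)) (A k)
      = ((if k \<le> 1 then - h else h) + of_bool (k \<in> {1, 2})) * Y (N - 1) * A k"
    and top0: "\<And>k. k \<le> N \<Longrightarrow> br (Y N) (A k) = (if k \<le> 1 then - h else h) * Y N * A k"
  defines "G \<equiv> \<Sum>k\<le>N. A k" and "P \<equiv> \<Sum>k\<le>N. Y k"
  shows "h * P * G - br P G
      = (\<Sum>j<N - 2. Y j * (\<Sum>k = 2 * ((j + 1) div 2) + 2..N. A k)) + Y (N - 2) * A N"
    and "br (br P G) G = h * h * P * G * G - P"
proof -
  have LH: "br (\<Sum>k\<le>\<kappa>. A k) (\<Sum>k = Suc \<kappa>..N. A k) = (\<Sum>k\<le>\<kappa>. A k) * (\<Sum>k = Suc \<kappa>..N. A k) - 1"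
    if "\<kappa> < N" for \<kappa>
  proof -
    \<comment> \<open>The exceptional pair has bracket 0 where the rule would give
      \<open>A 0 * A N = 1\<close>; this is the only loss, and it occurs once for every cut.\<close>
    have "br (A j) (A k) = A j * A k - of_bool (j = 0) * of_bool (k = N)"
      if "j \<le> \<kappa>" "k \<in> {Suc \<kappa>..N}" for j k
      using AA[of j k] ends that \<open>\<kappa> < N\<close> by (cases "j = 0 \<and> k = N") auto
    then have "br (\<Sum>k\<le>\<kappa>. A k) (\<Sum>k = Suc \<kappa>..N. A k)
        = (\<Sum>j\<le>\<kappa>. \<Sum>k = Suc \<kappa>..N. A j * A k - of_bool (j = 0) * of_bool (k = N))"
      by (simp add: br_sum_left br_sum_right) (rule sum.swap)
    also have "\<dots> = (\<Sum>k\<le>\<kappa>. A k) * (\<Sum>k = Suc \<kappa>..N. A k)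
        - (\<Sum>j\<le>\<kappa>. of_bool (j = 0)) * (\<Sum>k = Suc \<kappa>..N. of_bool (k = N))"
      by (simp only: sum_subtractf sum_product)
    also have "(\<Sum>j\<le>\<kappa>. of_bool (j = 0) :: 'a) = 1" by (simp add: of_bool_def)
    also have "(\<Sum>k = Suc \<kappa>..N. of_bool (k = N) :: 'a) = 1"
      using that by (simp add: of_bool_def)
    finally show ?thesis by simp
  qed
  have G_split: "G = (\<Sum>k\<le>\<kappa>. A k) + (\<Sum>k = Suc \<kappa>..N. A k)" if "\<kappa> < N" for \<kappa>
  proof -
    have "{..N} = {..\<kappa>} \<union> {Suc \<kappa>..N}" using that by auto
    then show ?thesis unfolding G_def by (simp add: sum.union_disjoint)
  qed
  have signed: "(\<Sum>k\<le>N. (if k \<le> \<kappa> then a else b) * y * A k)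
      = a * y * (\<Sum>k\<le>\<kappa>. A k) + b * y * (\<Sum>k = Suc \<kappa>..N. A k)" if "\<kappa> < N" for \<kappa> a b y
  proof -
    have "{..N} = {..\<kappa>} \<union> {Suc \<kappa>..N}" using that by auto
    then show ?thesis by (simp add: sum.union_disjoint sum_distrib_left)
  qed
  have corr: "(\<Sum>k\<le>N. of_bool (k \<in> {1, 2}) * y * A k) = y * (A 1 + A 2)" for y
  proof -
    have "(\<Sum>k\<le>N. of_bool (k \<in> {1, 2}) * y * A k) = (\<Sum>k\<in>{1, 2}. y * A k)"
      using N by (intro sum.mono_neutral_cong_right) auto
    then show ?thesis by (simp add: algebra_simps)
  qed
  have brG: "br y G = (\<Sum>k\<le>N. br y (A k))" for y
    unfolding G_def by (rule br_sum_right)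
  have generic: "h * Y j * G - br (Y j) G = Y j * (\<Sum>k = 2 * ((j + 1) div 2) + 2..N. A k)"
      "br (br (Y j) G) G = h * h * Y j * G * G - Y j" if j: "j < N - 2" for j
  proof -
    define \<kappa> where "\<kappa> = 2 * ((j + 1) div 2) + 1"
    have \<kappa>: "\<kappa> < N" using N j unfolding \<kappa>_def by presburger
    define L where "L = (\<Sum>k\<le>\<kappa>. A k)"
    define H where "H = (\<Sum>k = Suc \<kappa>..N. A k)"
    have G: "G = L + H" using G_split[OF \<kappa>] by (simp add: L_def H_def)
    have LH': "br L H = L * H - 1" using LH[OF \<kappa>] by (simp add: L_def H_def)
    have HL: "br H L = 1 - L * H" using LH' br_swap[of H L] by simp
    have YG: "br (Y j) G = h * Y j * L - h * Y j * H"
    proof -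
      have "br (Y j) G = (\<Sum>k\<le>N. (if k \<le> \<kappa> then h else - h) * Y j * A k)"
        unfolding brG \<kappa>_def using low[OF j] by (intro sum.cong) auto
      then show ?thesis unfolding signed[OF \<kappa>] by (simp add: L_def H_def)
    qed
    have "h * Y j * G - br (Y j) G = Y j * H"
      unfolding YG unfolding G using arg_cong[OF half, of "\<lambda>t. t * (Y j * H)"] by (simp add: algebra_simps)
    then show "h * Y j * G - br (Y j) G = Y j * (\<Sum>k = 2 * ((j + 1) div 2) + 2..N. A k)"
      by (simp add: H_def \<kappa>_def)
    have "br (br (Y j) G) G = br (h * Y j * L - h * Y j * H) G"
      by (simp only: YG)
    also have "\<dots> = h * br (Y j) G * (L - H) + h * Y j * br (L - H) G"
      by (simp add: br_simps algebra_simps)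
    also have "br (L - H) G = br L H - br H L"
      unfolding G by (simp add: br_simps)
    \<comment> \<open>As \<open>{L, H} - {H, L} = 2 (L H - 1)\<close> and \<open>4 h h = 1\<close>,
      the second summand turns the square of \<open>L - H\<close> into that of \<open>L + H\<close>
      and leaves \<open>- Y j\<close>.\<close>
    also have "h * br (Y j) G * (L - H) + h * Y j * (br L H - br H L) = h * h * Y j * G * G - Y j"
      using half_mult[of "Y j"] half_mult[of "Y j * L * H"] half_mult[of "h * Y j * L * H"]
      unfolding YG LH' HL unfolding G by (simp add: algebra_simps)
    finally show "br (br (Y j) G) G = h * h * Y j * G * G - Y j" .
  qed
  define y where "y = Y (N - 2)"
  define Z where "Z = Y (N - 2) + Y (N - 1) + Y N"
  have Y1': "Y (N - 1) = y * A 1 * A N" and Y2': "Y N = y * A 2 * A N"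
    using Y1 Y2 by (simp_all add: y_def)
  have yG: "br y G = h * y * G - y * A N + y * (A 1 + A 2)"
  proof -
    have "br y G = (\<Sum>k\<le>N. (if k \<le> N - 1 then h else - h) * y * A k + of_bool (k \<in> {1, 2}) * y * A k)"
      unfolding brG y_def using top2 N by (intro sum.cong) (auto simp: algebra_simps)
    also have "\<dots> = h * y * (\<Sum>k\<le>N - 1. A k) + - h * y * (\<Sum>k = Suc (N - 1)..N. A k) + y * (A 1 + A 2)"
      using N unfolding sum.distrib corr by (subst signed) auto
    also have "(\<Sum>k\<le>N - 1. A k) = G - A N"
      using G_split[of "N - 1"] N by simp
    also have "(\<Sum>k = Suc (N - 1)..N. A k) = A N" using N by simp
    finally show ?thesis
      using arg_cong[OF half, of "\<lambda>t. t * (y * A N)"] by (simp add: algebra_simps)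
  qed
  have top: "(\<Sum>k\<le>N. (if k \<le> 1 then - h else h) * z * A k) = h * z * G - z * (A 0 + A 1)" for z
  proof -
    have "(\<Sum>k\<le>N. (if k \<le> 1 then - h else h) * z * A k)
        = - h * z * (\<Sum>k\<le>1. A k) + h * z * (\<Sum>k = Suc 1..N. A k)"
      using N by (intro signed) auto
    also have "(\<Sum>k = Suc 1..N. A k) = G - (\<Sum>k\<le>1. A k)"
      using G_split[of 1] N by simp
    finally show ?thesis
      using half_mult[of "z * A 0"] half_mult[of "z * A (Suc 0)"] by (simp add: algebra_simps)
  qed
  have y1G: "br (Y (N - 1)) G = h * Y (N - 1) * G - Y (N - 1) * (A 0 + A 1) + Y (N - 1) * (A 1 + A 2)"
  proof -
    have "br (Y (N - 1)) G = (\<Sum>k\<le>N. (if k \<le> 1 then - h else h) * Y (N - 1) * A k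
        + of_bool (k \<in> {1, 2}) * Y (N - 1) * A k)"
      unfolding brG using top1 by (intro sum.cong) (auto simp: algebra_simps)
    then show ?thesis unfolding sum.distrib corr top .
  qed
  have y0G: "br (Y N) G = h * Y N * G - Y N * (A 0 + A 1)"
    unfolding brG top[symmetric] using top0 by (intro sum.cong) auto
  have ends': "A N * A 0 = 1" using ends by (simp add: mult.commute)
  have ZG: "br Z G = h * Z * G - y * A N"
  proof -
    have "br Z G = br y G + br (Y (N - 1)) G + br (Y N) G"
      unfolding Z_def by (simp add: br_simps flip: y_def)
    \<comment> \<open>The deviations of the three monomials add up to a multiple of
      \<open>1 - A N * A 0\<close>, which is zero.\<close>
    also have "\<dots> = h * Z * G - y * A N + (1 - A N * A 0) * y * (A 1 + A 2)"
      unfolding yG y1G y0G Z_def unfolding y_def[symmetric] Y1' Y2' by (simp add: algebra_simps)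
    finally show ?thesis by (simp add: ends')
  qed
  have ANG: "br (A N) G = 1 - (G - A N) * A N"
  proof -
    have "br (\<Sum>k\<le>N - 1. A k) (A N) = (\<Sum>k\<le>N - 1. A k) * A N - 1"
      using LH[of "N - 1"] N by simp
    moreover have "G = (\<Sum>k\<le>N - 1. A k) + A N"
      using G_split[of "N - 1"] N by simp
    ultimately show ?thesis using br_swap[of "A N" "\<Sum>k\<le>N - 1. A k"] by (simp add: br_simps)
  qed
  have Z: "Z = y + y * A 1 * A N + y * A 2 * A N"
    unfolding Z_def Y1' Y2' y_def ..
  have ZGG: "br (br Z G) G = h * h * Z * G * G - Z"
  proof -
    have "br (br Z G) G = br (h * Z * G - y * A N) G"
      by (simp only: ZG)
    also have "\<dots> = h * br Z G * G - br y G * A N - y * br (A N) G"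
      by (simp add: br_simps algebra_simps)
    also have "\<dots> = h * h * Z * G * G - Z"
      unfolding ZG yG ANG unfolding Z using arg_cong[OF half, of "\<lambda>t. (t - 1) * (y * A N * G)"]
      by (simp add: algebra_simps)
    finally show ?thesis .
  qed
  have P: "P = (\<Sum>j<N - 2. Y j) + Z"
  proof -
    obtain M where M: "N = Suc (Suc M)" using N by (auto dest!: le_Suc_ex simp: numeral_eq_Suc)
    show ?thesis unfolding P_def Z_def M
      by (simp add: lessThan_Suc_atMost[symmetric] add.assoc)
  qed
  have PG: "br P G = (\<Sum>j<N - 2. br (Y j) G) + br Z G"
    unfolding P by (simp add: br_simps br_sum_left)
  have "h * P * G - br P G = (\<Sum>j<N - 2. h * Y j * G - br (Y j) G) + (h * Z * G - br Z G)"
    unfolding PG unfolding P by (simp add: sum_subtractf sum_distrib_left sum_distrib_right algebra_simps)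
  then show "h * P * G - br P G
      = (\<Sum>j<N - 2. Y j * (\<Sum>k = 2 * ((j + 1) div 2) + 2..N. A k)) + Y (N - 2) * A N"
    by (simp add: generic ZG y_def)
  have "br (br P G) G = (\<Sum>j<N - 2. br (br (Y j) G) G) + br (br Z G) G"
    unfolding PG by (simp add: br_simps br_sum_left)
  also have "\<dots> = (\<Sum>j<N - 2. h * h * Y j * G * G - Y j) + (h * h * Z * G * G - Z)"
    by (simp add: generic ZGG)
  also have "\<dots> = h * h * P * G * G - P"
    unfolding P by (simp add: sum_subtractf sum_distrib_left sum_distrib_right algebra_simps)
  finally show "br (br P G) G = h * h * P * G * G - P" .
qed

text \<open>\<open>entry g k d\<close> is the matrix element with indices \<open>k\<close>, \<open>k + d + 1\<close>.\<close>

primrec entry :: "(nat \<Rightarrow> 'a) \<Rightarrow> nat \<Rightarrow> nat \<Rightarrow> 'a" where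
  "entry g k 0 = g k"
| "entry g k (Suc d) = h * entry g k d * g (k + Suc d) + br (entry g k d) (g (k + Suc d))"

end

section \<open>Generators with Nelson-Regge relations and the braided entries\<close>

text \<open>Far commutativity and two Serre-type relations, with \<open>h * h\<close> for 1/4. The
  relations concern the superdiagonal alone; those for longer entries are derived.\<close>

locale nelson_regge = poisson_ring +
  fixes g :: "nat \<Rightarrow> 'a" and n :: nat
  assumes far: "1 \<le> l \<Longrightarrow> l + 1 < m \<Longrightarrow> m < n \<Longrightarrow> br (g l) (g m) = 0"
    and serre_right: "1 \<le> l \<Longrightarrow> l + 1 < n \<Longrightarrow>
      br (br (g l) (g (l + 1))) (g (l + 1)) = h * h * g l * g (l + 1) * g (l + 1) - g l"
    and serre_left: "1 \<le> l \<Longrightarrow> l + 1 < n \<Longrightarrow>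
      br (g l) (br (g l) (g (l + 1))) = h * h * g l * g l * g (l + 1) - g (l + 1)"
begin

text \<open>Generators are attached on the right, one at a time; by \<open>F_split\<close> any other
  bracketing gives the same element.\<close>

definition F :: "nat \<Rightarrow> nat \<Rightarrow> 'a" where
  "F k l = entry g k (l - k - 1)"

lemma F_elementary: "F l (Suc l) = g l"
  by (simp add: F_def)

lemma F_last: "k < l \<Longrightarrow> F k (Suc l) = h * F k l * g l + br (F k l) (g l)"
  by (cases "l - k") (auto simp: F_def Suc_diff_Suc intro!: arg_cong[of _ _ g] dest: less_imp_Suc_add)

lemma F_far:
  assumes "1 \<le> k" "k < l" "l < m" "m < n"
  shows "br (F k l) (g m) = 0"
  using assms(2,3)
proof (induction l)
  case (Suc l)
  show ?case
  proof (cases "k = l")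
    case True
    then show ?thesis using Suc.prems assms far by (simp add: F_elementary)
  next
    case False
    then have "br (F k l) (g m) = 0" "br (g l) (g m) = 0" "k < l"
      using Suc assms far by auto
    then show ?thesis
      using jacobi[of "F k l" "g l" "g m"] by (simp add: F_last br_simps)
  qed
qed simp

text \<open>Induction on \<open>l\<close>: since \<open>F k m\<close> commutes with
  \<open>g l\<close> for \<open>m < l\<close>, the Jacobi identity moves the operation with
  \<open>g l\<close> into the right factor. This makes the free choice of intermediate indices in
  \<open>generated\<close> harmless.\<close>

lemma F_split:
  assumes "1 \<le> k" "k < m" "m < l" "l \<le> n"
  shows "F k l = h * F k m * F m l + br (F k m) (F m l)"
  using assms(3,4)
proof (induction l)
  case (Suc l)
  show ?case
  proof (cases "m = l")
    case True
    then show ?thesis using assms by (simp add: F_last F_elementary)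
  next
    case False
    then have ml: "m < l" using Suc by simp
    have 0: "br (F k m) (g l) = 0"
      using assms Suc ml by (intro F_far) auto
    have "br (br (F k m) (F m l)) (g l) = br (F k m) (br (F m l) (g l)) - br (F m l) (br (F k m) (g l))"
      by (rule jacobi)
    then have 1: "br (br (F k m) (F m l)) (g l) = br (F k m) (br (F m l) (g l))"
      by (simp add: 0)
    have IH: "F k l = h * F k m * F m l + br (F k m) (F m l)"
      using Suc ml by simp
    have "F k (Suc l) = h * F k l * g l + br (F k l) (g l)"
      using assms ml by (intro F_last) simp
    then show ?thesis
      unfolding F_last[OF ml] IH by (simp add: br_simps 0 1 algebra_simps)
  qed
qed simp

lemma F_far_right:
  assumes "1 \<le> m" "m + 1 < k" "k < l" "l \<le> n"
  shows "br (g m) (F k l) = 0"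
  using assms(3,4)
proof (induction l)
  case (Suc l)
  show ?case
  proof (cases "k = l")
    case True
    then show ?thesis using Suc.prems assms far by (simp add: F_elementary)
  next
    case False
    then have *: "br (g m) (F k l) = 0" "br (g m) (g l) = 0" "k < l"
      using Suc assms far by auto
    then show ?thesis
      using jacobi[of "g m" "F k l" "g l"] by (simp add: F_last br_simps)
  qed
qed simp

text \<open>Of the two factors \<open>F k (i - 1)\<close> and \<open>g (i - 1)\<close> of
  \<open>F k i\<close>, only the second fails to commute with \<open>g i\<close>, so the relation
  for generators carries over.\<close>

lemma F_serre_right:
  assumes "1 \<le> k" "k < i" "i < n"
  shows "br (br (F k i) (g i)) (g i) = h * h * F k i * g i * g i - F k i"
proof (cases "Suc k = i")
  case True
  then show ?thesis using serre_right[of k] assms by (simp add: F_elementary flip: True)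
next
  case False
  define j where "j = i - 1"
  have j: "i = Suc j" "k < j" using False assms by (auto simp: j_def)
  have 0: "br (F k j) (g i) = 0" using assms j by (intro F_far) auto
  have 1: "br (br (F k j) c) (g i) = br (F k j) (br c (g i))" for c
    using jacobi[of "F k j" c "g i"] by (simp add: 0)
  have s: "br (br (g j) (g i)) (g i) = h * h * g j * g i * g i - g j"
    using serre_right[of j] assms j by simp
  show ?thesis
    unfolding j(1) F_last[OF j(2)] unfolding j(1)[symmetric]
    by (simp add: br_simps 0 1 s algebra_simps)
qed

lemma F_serre_left:
  assumes "1 \<le> i" "i + 1 < l" "l \<le> n"
  shows "br (g i) (br (g i) (F (i + 1) l)) = h * h * g i * g i * F (i + 1) l - F (i + 1) l"
proof (cases "l = i + 2")
  case True
  then show ?thesis using serre_left[of i] assms F_elementary[of "i + 1"] by simp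
next
  case False
  have 0: "br (g i) (F (i + 2) l) = 0"
    using assms False by (intro F_far_right) auto
  have 1: "br (g i) (br c (F (i + 2) l)) = br (br (g i) c) (F (i + 2) l)" for c
    by (metis 0 br_0_right diff_zero jacobi)
  have s: "br (g i) (br (g i) (g (i + 1))) = h * h * g i * g i * g (i + 1) - g (i + 1)"
    using serre_left[of i] assms by simp
  have F: "F (i + 1) l = h * g (i + 1) * F (i + 2) l + br (g (i + 1)) (F (i + 2) l)"
    using F_split[of "i + 1" "i + 2" l] F_elementary[of "i + 1"] assms False by simp
  show ?thesis
    unfolding F
    by (simp add: br_simps 0[simplified] 1[simplified] s[simplified] algebra_simps)
qed

text \<open>Up to the signs \<open>(-1)^(k + l)\<close> these are the entries above the diagonal of
  the conjugated matrix \<open>B A B^T\<close>.\<close>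

definition braided :: "nat \<Rightarrow> nat \<Rightarrow> nat \<Rightarrow> 'a" where
  "braided i k l =
    (if k = i then if l = i + 1 then g i else g i * F i l - F (i + 1) l
     else if k = i + 1 then F i l
     else if l = i then F k i * g i - F k (i + 1)
     else if l = i + 1 then F k i
     else F k l)"

text \<open>The relation \<open>R\<close> will be "substituting in the first argument gives the
  second". Each entry is split at an index where both factors are already settled. Entries away from
  the indices \<open>i\<close> and \<open>i + 1\<close> reproduce themselves; at these indices the
  Serre-type relations close the recursion.\<close>

lemma braided_entries:
  assumes i: "1 \<le> i" "i < n"
    and R: "\<And>a a' b b'. R a a' \<Longrightarrow> R b b' \<Longrightarrow> R (h * a * b + br a b) (h * a' * b' + br a' b')"
    and gens: "\<And>l. 1 \<le> l \<Longrightarrow> l < n \<Longrightarrow> R (g l) (braided i l (l + 1))"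
    and kl: "1 \<le> k" "k < l" "l \<le> n"
  shows "R (F k l) (braided i k l)"
proof -
  have split: "R (F k l) c"
    if "1 \<le> k" "k < m" "m < l" "l \<le> n" "R (F k m) a" "R (F m l) b" "h * a * b + br a b = c"
    for k l m a b c
    using R[OF that(5,6)] F_split[OF that(1-4)] that(7) by simp
  have gR: "R (g i) (g i)" using gens[of i] i by (simp add: braided_def)
  have Fgen: "F l (l + 1) = g l" for l using F_elementary by simp
  have low: "R (F k l) (F k l)" if "1 \<le> k" "k < l" "l < i" for k l
    using that(2,3)
  proof (induction l)
    case (Suc l)
    have g: "R (g l) (g l)" using gens[of l] Suc that i by (simp add: braided_def Fgen[unfolded Suc_eq_plus1[symmetric]] F_elementary)
    show ?case
    proof (cases "k = l")
      case False
      then show ?thesis using Suc g that i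
        by (intro split[of k l "Suc l" "F k l" "g l"]) (auto simp: F_elementary F_last)
    qed (use g in \<open>simp add: F_elementary\<close>)
  qed simp
  have high: "R (F k l) (F k l)" if "i + 1 < k" "k < l" "l \<le> n" for k l
    using that(2,3)
  proof (induction l)
    case (Suc l)
    have g: "R (g l) (g l)" using gens[of l] Suc that i by (simp add: braided_def F_elementary)
    show ?case
    proof (cases "k = l")
      case False
      then show ?thesis using Suc g that i
        by (intro split[of k l "Suc l" "F k l" "g l"]) (auto simp: F_elementary F_last)
    qed (use g in \<open>simp add: F_elementary\<close>)
  qed simp
  have ki: "R (F k i) (F k i * g i - F k (i + 1))" if "1 \<le> k" "k < i" for k
  proof (cases "Suc k = i")
    case True
    then show ?thesis using gens[of k] that i by (simp add: braided_def F_elementary flip: True)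
  next
    case False
    define j where "j = i - 1"
    have j: "i = Suc j" "k < j" "j \<ge> 1" using False that by (auto simp: j_def)
    have 0: "br (F k j) (g i) = 0" using that i j by (intro F_far) auto
    have gj: "R (F j i) (g j * g i - F j (i + 1))"
      using gens[of j] j i by (simp add: braided_def F_elementary)
    have e: "F k (i + 1) = h * F k j * F j (i + 1) + br (F k j) (F j (i + 1))"
      using that i j by (intro F_split) auto
    show ?thesis
    proof (rule split[OF _ _ _ _ low gj])
      show "h * F k j * (g j * g i - F j (i + 1)) + br (F k j) (g j * g i - F j (i + 1))
        = F k i * g i - F k (i + 1)"
        unfolding e using F_last[OF j(2)] 0 by (simp add: br_simps j(1) algebra_simps)
    qed (use that i j in auto)
  qed
  \<comment> \<open>With \<open>D = F k i * g i - F k (i + 1) = h F g - {F, g}\<close> the new entry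
    is \<open>h D g + {D, g} = h h F g g - {{F, g}, g}\<close>, which the Serre-type relation
    reduces to \<open>F k i\<close>.\<close>
  have ki1: "R (F k (i + 1)) (F k i)" if "1 \<le> k" "k < i" for k
  proof (rule split[OF _ _ _ _ ki gR[folded Fgen]])
    have 1: "F k (i + 1) = h * F k i * g i + br (F k i) (g i)"
      using F_last[OF that(2)] by simp
    show "h * (F k i * g i - F k (i + 1)) * F i (i + 1) + br (F k i * g i - F k (i + 1)) (F i (i + 1)) = F k i"
    proof -
      have "h * (F k i * g i - F k (i + 1)) * g i + br (F k i * g i - F k (i + 1)) (g i)
          = h * (F k i * g i - F k (i + 1)) * g i + br (F k i) (g i) * g i
            - h * br (F k i) (g i) * g i - br (br (F k i) (g i)) (g i)"
        unfolding 1 by (simp add: br_simps algebra_simps)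
      also have "\<dots> = F k i"
        using arg_cong[OF half, of "\<lambda>t. (1 - t) * (h * F k i * g i * g i + br (F k i) (g i) * g i)"]
        unfolding 1 F_serre_right[OF that i(2)] by (simp add: algebra_simps)
      finally show ?thesis by (simp only: Fgen)
    qed
  qed (use that i in auto)
  have i1l: "R (F (i + 1) l) (F i l)" if "i + 1 < l" "l \<le> n" for l
  proof -
    have g: "R (F (i + 1) (i + 2)) (F i (i + 2))"
      using gens[of "i + 1"] that by (simp add: braided_def F_elementary)
    show ?thesis
    proof (cases "l = i + 2")
      case False
      show ?thesis
        by (rule split[OF _ _ _ _ g high])
          (use that i False F_split[of i "i + 2" l] in auto)
    qed (use g in simp)
  qed
  have il: "R (F i l) (g i * F i l - F (i + 1) l)" if "i + 1 < l" "l \<le> n" for l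
  proof (rule split[OF _ _ _ _ gR[folded Fgen] i1l])
    have 1: "F i l = h * g i * F (i + 1) l + br (g i) (F (i + 1) l)"
      using F_split[of i "i + 1" l] that i by (simp add: Fgen[unfolded Suc_eq_plus1[symmetric]] F_elementary)
    show "h * F i (i + 1) * F i l + br (F i (i + 1)) (F i l) = g i * F i l - F (i + 1) l"
    proof -
      have "h * g i * F i l + br (g i) (F i l) = h * g i * F i l
          + h * g i * br (g i) (F (i + 1) l) + br (g i) (br (g i) (F (i + 1) l))"
        unfolding 1 by (simp add: br_simps algebra_simps)
      also have "\<dots> = g i * F i l - F (i + 1) l"
        using arg_cong[OF half, of "\<lambda>t. (t - 1) * (h * g i * g i * F (i + 1) l + g i * br (g i) (F (i + 1) l))"]
        unfolding 1 F_serre_left[OF i(1) that] by (simp add: algebra_simps)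
      finally show ?thesis by (simp only: Fgen)
    qed
  qed (use that i in auto)
  have mid: "R (F k l) (F k l)" if "1 \<le> k" "k < i" "i + 1 < l" "l \<le> n" for k l
    by (rule split[OF _ _ _ _ ki1 i1l]) (use that F_split[of k i l] in auto)
  consider "l < i" | "l = i" | "l = i + 1" "k = i" | "l = i + 1" "k < i" | "l > i + 1" "k < i"
    | "l > i + 1" "k = i" | "l > i + 1" "k = i + 1" | "k > i + 1"
    using kl by linarith
  then show ?thesis
    by cases (use kl i low high ki ki1 i1l il mid gR in \<open>simp_all add: braided_def F_elementary\<close>)
qed

end

section \<open>The Laurent algebra of the quiver variables and its formal bracket\<close>

definition strip :: "nat \<Rightarrow> vertex set" where
  "strip n = (\<lambda>(i, j). S i j) ` ({1..int n - 1} \<times> {1..int n})"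

lemma finite_strip [simp]: "finite (strip n)"
  by (simp add: strip_def)

lemma Extra_notin_strip [simp]: "Extra \<notin> strip n"
  by (auto simp: strip_def)

lemma quiver_vertices_eq: "quiver_vertices n = insert Extra (strip n)"
  by (simp add: quiver_vertices_def strip_def)

lemma eps_swap: "eps n u v = - eps n v u"
  by (simp add: eps_def)

type_synonym exponent = "vertex \<Rightarrow> real"

text \<open>The log-canonical form: the monomials with exponents \<open>\<alpha>\<close> and
  \<open>\<beta>\<close> have bracket \<open>Om n \<alpha> \<beta>\<close> times their product. It
  lives on the strip because the matrix elements are functions of the strip variables.\<close>

definition Om :: "nat \<Rightarrow> exponent \<Rightarrow> exponent \<Rightarrow> real" where
  "Om n \<alpha> \<beta> = (\<Sum>u\<in>strip n. \<Sum>v\<in>strip n. eps n u v * \<alpha> u * \<beta> v)"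

lemma Om_swap: "Om n \<alpha> \<beta> = - Om n \<beta> \<alpha>"
proof -
  have "Om n \<alpha> \<beta> = (\<Sum>v\<in>strip n. \<Sum>u\<in>strip n. eps n u v * \<alpha> u * \<beta> v)"
    unfolding Om_def by (rule sum.swap)
  also have "\<dots> = (\<Sum>v\<in>strip n. \<Sum>u\<in>strip n. - (eps n v u * \<beta> v * \<alpha> u))"
    by (intro sum.cong refl) (subst eps_swap, simp)
  also have "\<dots> = - Om n \<beta> \<alpha>"
    by (simp add: Om_def sum_negf)
  finally show ?thesis .
qed

lemma Om_add_left: "Om n (\<alpha> + \<beta>) \<gamma> = Om n \<alpha> \<gamma> + Om n \<beta> \<gamma>"
  by (simp add: Om_def algebra_simps sum.distrib)

lemma Om_add_right: "Om n \<gamma> (\<alpha> + \<beta>) = Om n \<gamma> \<alpha> + Om n \<gamma> \<beta>"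
  using Om_add_left[of n \<alpha> \<beta> \<gamma>] by (subst (1 2 3) Om_swap) simp

lemma Om_scale_left: "Om n (\<lambda>v. c * \<alpha> v) \<gamma> = c * Om n \<alpha> \<gamma>"
  by (simp add: Om_def sum_distrib_left mult_ac)

lemma Om_scale_right: "Om n \<gamma> (\<lambda>v. c * \<alpha> v) = c * Om n \<gamma> \<alpha>"
  using Om_scale_left[of n c \<alpha> \<gamma>] Om_swap[of n \<gamma> \<alpha>] Om_swap[of n \<gamma> "\<lambda>v. c * \<alpha> v"] by simp

lemma Om_sum_left: "Om n (\<lambda>v. \<Sum>k\<in>K. f k v) \<gamma> = (\<Sum>k\<in>K. Om n (f k) \<gamma>)"
proof (induction K rule: infinite_finite_induct)
  case (insert k K)
  have "Om n (\<lambda>v. \<Sum>k\<in>insert k K. f k v) \<gamma> = Om n (f k + (\<lambda>v. \<Sum>k\<in>K. f k v)) \<gamma>"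
    using insert by (simp add: plus_fun_def)
  then show ?case using insert by (simp add: Om_add_left)
qed (auto simp: Om_def)

lemma Om_sum_right: "Om n \<gamma> (\<lambda>v. \<Sum>k\<in>K. f k v) = (\<Sum>k\<in>K. Om n \<gamma> (f k))"
  using Om_sum_left[of n f K \<gamma>] by (subst (1 2) Om_swap) (simp add: sum_negf)

lemma Om_unit_left: "u \<in> strip n \<Longrightarrow> Om n (\<lambda>v. of_bool (v = u)) \<beta> = (\<Sum>v\<in>strip n. eps n u v * \<beta> v)"
proof -
  assume u: "u \<in> strip n"
  have "Om n (\<lambda>v. of_bool (v = u)) \<beta>
      = (\<Sum>w\<in>strip n. if w = u then \<Sum>v\<in>strip n. eps n w v * \<beta> v else 0)"
    unfolding Om_def by (intro sum.cong) auto
  then show ?thesis using u by simp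
qed

lemma Om_units: "u \<in> strip n \<Longrightarrow> v \<in> strip n \<Longrightarrow>
    Om n (\<lambda>w. of_bool (w = u)) (\<lambda>w. of_bool (w = v)) = eps n u v"
  by (subst Om_unit_left) (simp_all add: of_bool_def if_distrib[of "\<lambda>y. _ * y"] cong: if_cong)

abbreviation (input) keys where "keys \<equiv> Poly_Mapping.keys"
abbreviation (input) lookup where "lookup \<equiv> Poly_Mapping.lookup"

text \<open>The group algebra of the exponent space. Exponents are real to accommodate the square
  root in a telescopic sum.\<close>

type_synonym laurent = "exponent \<Rightarrow>\<^sub>0 real"

lemma poly_mapping_induct_single [case_names single add]:
  fixes p :: "'a \<Rightarrow>\<^sub>0 'b::comm_monoid_add"
  assumes "\<And>k c. P (Poly_Mapping.single k c)" and "\<And>p q. P p \<Longrightarrow> P q \<Longrightarrow> P (p + q)"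
  shows "P p"
proof -
  have "P (\<Sum>k\<in>K. Poly_Mapping.single k (lookup p k))" if "finite K" for K
    using that
  proof (induction K)
    case empty
    show ?case using assms(1)[of undefined 0] by simp
  qed (use assms in simp)
  moreover have "p = (\<Sum>k\<in>keys p. Poly_Mapping.single k (lookup p k))"
    by (rule poly_mapping_eqI)
      (auto simp: lookup_sum lookup_single when_def not_in_keys_iff_lookup_eq_zero)
  ultimately show ?thesis by (metis finite_keys)
qed

definition pb :: "nat \<Rightarrow> laurent \<Rightarrow> laurent \<Rightarrow> laurent" where
  "pb n p q = (\<Sum>\<alpha>\<in>keys p. \<Sum>\<beta>\<in>keys q.
     Poly_Mapping.single (\<alpha> + \<beta>) (lookup p \<alpha> * lookup q \<beta> * Om n \<alpha> \<beta>))"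

lemma pb_add_left: "pb n (p + q) r = pb n p r + pb n q r"
  unfolding pb_def
  by (rule setsum_keys_plus_distrib)
    (simp_all add: single_add[symmetric] sum.distrib[symmetric] algebra_simps)

lemma pb_swap: "pb n p q = - pb n q p"
proof -
  have "pb n p q = (\<Sum>\<beta>\<in>keys q. \<Sum>\<alpha>\<in>keys p.
     Poly_Mapping.single (\<alpha> + \<beta>) (lookup p \<alpha> * lookup q \<beta> * Om n \<alpha> \<beta>))"
    unfolding pb_def by (rule sum.swap)
  also have "\<dots> = (\<Sum>\<beta>\<in>keys q. \<Sum>\<alpha>\<in>keys p.
     - Poly_Mapping.single (\<beta> + \<alpha>) (lookup q \<beta> * lookup p \<alpha> * Om n \<beta> \<alpha>))"
    by (intro sum.cong refl) (subst Om_swap, simp add: single_uminus[symmetric] add.commute mult_ac)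
  finally show ?thesis by (simp add: pb_def sum_negf)
qed

lemma pb_add_right: "pb n r (p + q) = pb n r p + pb n r q"
  using pb_add_left[of n p q r] by (subst (1 2 3) pb_swap) simp

lemma pb_single: "pb n (Poly_Mapping.single \<alpha> a) (Poly_Mapping.single \<beta> b)
    = Poly_Mapping.single (\<alpha> + \<beta>) (a * b * Om n \<alpha> \<beta>)"
  by (auto simp: pb_def)

lemma pb_mult_left: "pb n (p * q) r = p * pb n q r + pb n p r * q"
proof (induction p rule: poly_mapping_induct_single)
  case (single \<alpha> a)
  show ?case
  proof (induction q rule: poly_mapping_induct_single)
    case (single \<beta> b)
    show ?case
    proof (induction r rule: poly_mapping_induct_single)
      case (single \<gamma> c)
      show ?case
        by (simp add: mult_single pb_single Om_add_left single_add[symmetric] algebra_simps)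
    qed (simp add: pb_add_right algebra_simps)
  qed (simp add: pb_add_left algebra_simps)
qed (simp add: pb_add_left algebra_simps)

lemma pb_jacobi: "pb n (pb n p q) r = pb n p (pb n q r) - pb n q (pb n p r)"
proof (induction p rule: poly_mapping_induct_single)
  case (single \<alpha> a)
  show ?case
  proof (induction q rule: poly_mapping_induct_single)
    case (single \<beta> b)
    show ?case
    proof (induction r rule: poly_mapping_induct_single)
      case (single \<gamma> c)
      show ?case
        using Om_swap[of n \<beta> \<alpha>]
        by (simp add: pb_single Om_add_left Om_add_right single_diff[symmetric] algebra_simps)
    qed (simp add: pb_add_right algebra_simps)
  qed (simp add: pb_add_left pb_add_right algebra_simps)
qed (simp add: pb_add_left pb_add_right algebra_simps)

definition half :: laurent where
  "half = Poly_Mapping.single 0 (1 / 2)"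

interpretation laurent: poisson_ring "pb n" half for n
proof
  show "half + half = 1" by (simp add: half_def single_add[symmetric])
qed (rule pb_add_left pb_swap pb_mult_left pb_jacobi)+

section \<open>Evaluation at positive states and the bracket defined by derivatives\<close>

text \<open>The exponential of a linear form in logarithms is multiplicative in
  \<open>\<alpha>\<close> and positive at every state; it is the intended monomial when the state is
  positive.\<close>

definition monom_at :: "nat \<Rightarrow> exponent \<Rightarrow> state \<Rightarrow> real" where
  "monom_at n \<alpha> x = exp (\<Sum>v\<in>strip n. \<alpha> v * ln (x v))"

lemma monom_at_add: "monom_at n (\<alpha> + \<beta>) x = monom_at n \<alpha> x * monom_at n \<beta> x"
  by (simp add: monom_at_def algebra_simps sum.distrib exp_add)

lemma monom_at_0 [simp]: "monom_at n 0 x = 1"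
  by (simp add: monom_at_def)

lemma monom_at_pos [simp]: "monom_at n \<alpha> x > 0"
  by (simp add: monom_at_def)

definition ev :: "nat \<Rightarrow> laurent \<Rightarrow> state \<Rightarrow> real" where
  "ev n p x = (\<Sum>\<alpha>\<in>keys p. lookup p \<alpha> * monom_at n \<alpha> x)"

lemma ev_add: "ev n (p + q) x = ev n p x + ev n q x"
  unfolding ev_def by (rule setsum_keys_plus_distrib) (simp_all add: algebra_simps)

lemma ev_single: "ev n (Poly_Mapping.single \<alpha> c) x = c * monom_at n \<alpha> x"
  by (auto simp: ev_def)

lemma ev_mult: "ev n (p * q) x = ev n p x * ev n q x"
proof (induction p rule: poly_mapping_induct_single)
  case (single \<alpha> a)
  show ?case
    by (induction q rule: poly_mapping_induct_single)
      (simp_all add: mult_single ev_single ev_add monom_at_add algebra_simps)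
qed (simp add: ev_add algebra_simps)

lemma ev_0 [simp]: "ev n 0 x = 0"
  by (simp add: ev_def)

lemma ev_1 [simp]: "ev n 1 x = 1"
  using ev_single[of n 0 1 x] by simp

lemma ev_half [simp]: "ev n half x = 1 / 2"
  by (simp add: half_def ev_single)

lemma ev_minus: "ev n (- p) x = - ev n p x"
  using ev_add[of n p "- p" x] by simp

lemma ev_diff: "ev n (p - q) x = ev n p x - ev n q x"
  using ev_add[of n p "- q" x] by (simp add: ev_minus)

lemma ev_sum: "ev n (sum f K) x = (\<Sum>k\<in>K. ev n (f k) x)"
  by (induction K rule: infinite_finite_induct) (simp_all add: ev_add)

lemma ev_cong: "(\<And>v. v \<in> strip n \<Longrightarrow> x v = y v) \<Longrightarrow> ev n p x = ev n p y"
  by (simp add: ev_def monom_at_def)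

definition positive :: "nat \<Rightarrow> state \<Rightarrow> bool" where
  "positive n x \<longleftrightarrow> (\<forall>v\<in>strip n. 0 < x v)"

text \<open>\<open>\<gamma>\<close> is the gradient of \<open>f\<close> in the logarithms of the variables; \<open>f\<close> does not
  depend on the variable of \<open>Extra\<close>.\<close>

definition log_gradient :: "nat \<Rightarrow> (state \<Rightarrow> real) \<Rightarrow> state \<Rightarrow> exponent \<Rightarrow> bool" where
  "log_gradient n f x \<gamma> \<longleftrightarrow> (\<forall>u\<in>quiver_vertices n.
     ((\<lambda>t. f (x(u := t))) has_real_derivative (if u = Extra then 0 else \<gamma> u / x u)) (at (x u)))"

text \<open>The factors \<open>x u * x v\<close> of the bracket cancel the denominators of the
  logarithmic gradients, and the derivatives in \<open>Extra\<close> vanish.\<close>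

lemma poisson_log_gradient:
  assumes "positive n x" "log_gradient n f x \<gamma>" "log_gradient n g x \<delta>"
  shows "poisson n f g x = Om n \<gamma> \<delta>"
proof -
  have *: "pderiv_at u f x = (if u = Extra then 0 else \<gamma> u / x u)"
      "pderiv_at u g x = (if u = Extra then 0 else \<delta> u / x u)" if "u \<in> quiver_vertices n" for u
    using assms(2,3) that unfolding log_gradient_def pderiv_at_def
    by (auto intro!: DERIV_imp_deriv)
  have "poisson n f g x = (\<Sum>u\<in>quiver_vertices n. \<Sum>v\<in>quiver_vertices n.
     eps n u v * x u * x v * (if u = Extra then 0 else \<gamma> u / x u) * (if v = Extra then 0 else \<delta> v / x v))"
    unfolding poisson_def by (intro sum.cong refl) (simp add: *)
  also have "\<dots> = (\<Sum>u\<in>strip n. \<Sum>v\<in>strip n.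
     eps n u v * x u * x v * (if u = Extra then 0 else \<gamma> u / x u) * (if v = Extra then 0 else \<delta> v / x v))"
    by (simp add: quiver_vertices_eq)
  also have "\<dots> = Om n \<gamma> \<delta>"
    unfolding Om_def using assms(1)
    by (intro sum.cong refl) (auto simp: positive_def)
  finally show ?thesis .
qed

text \<open>Positivity is an open condition in each strip variable and does not restrict
  \<open>Extra\<close>, so agreement on positive states determines the derivatives.\<close>

lemma log_gradient_cong:
  assumes "positive n x" "\<And>y. positive n y \<Longrightarrow> f y = g y" "log_gradient n f x \<gamma>"
  shows "log_gradient n g x \<gamma>"
  unfolding log_gradient_def
proof
  fix u assume u: "u \<in> quiver_vertices n"
  have d: "((\<lambda>t. f (x(u := t))) has_real_derivative (if u = Extra then 0 else \<gamma> u / x u)) (at (x u))"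
    using assms(3) u by (simp add: log_gradient_def)
  show "((\<lambda>t. g (x(u := t))) has_real_derivative (if u = Extra then 0 else \<gamma> u / x u)) (at (x u))"
  proof (cases "u = Extra")
    case True
    then have "f (x(u := t)) = g (x(u := t))" for t
      using assms(1) by (intro assms(2)) (auto simp: positive_def)
    then show ?thesis using d by simp
  next
    case False
    then have "x u > 0" using u assms(1) by (auto simp: positive_def quiver_vertices_eq)
    show ?thesis
      by (rule has_field_derivative_transform_within_open[OF d, of "{0<..}"])
        (use \<open>x u > 0\<close> assms(1) in \<open>auto intro!: assms(2) simp: positive_def\<close>)
  qed
qed

lemma log_gradient_add:
  "log_gradient n f x \<gamma> \<Longrightarrow> log_gradient n g x \<delta> \<Longrightarrow> log_gradient n (\<lambda>x. f x + g x) x (\<lambda>u. \<gamma> u + \<delta> u)"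
  unfolding log_gradient_def
  by (auto intro!: derivative_eq_intros simp: add_divide_distrib split: if_splits)

lemma log_gradient_const: "log_gradient n (\<lambda>x. c) x (\<lambda>u. 0)"
  by (simp add: log_gradient_def)

lemma log_gradient_sum:
  "(\<And>k. k \<in> K \<Longrightarrow> log_gradient n (f k) x (\<gamma> k)) \<Longrightarrow>
    log_gradient n (\<lambda>x. \<Sum>k\<in>K. f k x) x (\<lambda>u. \<Sum>k\<in>K. \<gamma> k u)"
  by (induction K rule: infinite_finite_induct) (auto intro: log_gradient_add log_gradient_const)

lemma log_gradient_compose:
  assumes "log_gradient n f x \<gamma>" "(F has_real_derivative D) (at (f x))"
  shows "log_gradient n (\<lambda>x. F (f x)) x (\<lambda>u. D * \<gamma> u)"
  unfolding log_gradient_def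
proof
  fix u assume u: "u \<in> quiver_vertices n"
  have "((\<lambda>t. f (x(u := t))) has_real_derivative (if u = Extra then 0 else \<gamma> u / x u)) (at (x u))"
    using assms(1) u by (simp add: log_gradient_def)
  from DERIV_chain2[OF _ this, of F D] assms(2)
  show "((\<lambda>t. F (f (x(u := t)))) has_real_derivative (if u = Extra then 0 else D * \<gamma> u / x u)) (at (x u))"
    by (auto split: if_splits)
qed

lemma log_gradient_cmult:
  "log_gradient n f x \<gamma> \<Longrightarrow> log_gradient n (\<lambda>x. c * f x) x (\<lambda>u. c * \<gamma> u)"
  by (rule log_gradient_compose) (auto intro!: derivative_eq_intros)

lemma log_gradient_ln:
  "log_gradient n f x \<gamma> \<Longrightarrow> f x > 0 \<Longrightarrow> log_gradient n (\<lambda>x. ln (f x)) x (\<lambda>u. \<gamma> u / f x)"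
  using log_gradient_compose[of n f x \<gamma> ln "1 / f x"] DERIV_ln_divide[of "f x"] by simp

lemma log_gradient_var:
  assumes "positive n x" "v \<in> strip n"
  shows "log_gradient n (\<lambda>x. ln (x v)) x (\<lambda>u. of_bool (u = v))"
  using assms unfolding log_gradient_def positive_def
  by (auto intro!: derivative_eq_intros)

text \<open>The substitution \<open>\<phi>\<close> has the logarithmic Jacobian \<open>D\<close>.\<close>

lemma log_gradient_ev_compose:
  assumes "\<And>v. v \<in> strip n \<Longrightarrow> log_gradient n (\<lambda>x. ln (\<phi> x v)) x (D v)"
  shows "log_gradient n (\<lambda>x. ev n p (\<phi> x)) x
    (\<lambda>u. \<Sum>\<alpha>\<in>keys p. lookup p \<alpha> * (monom_at n \<alpha> (\<phi> x) * (\<Sum>v\<in>strip n. \<alpha> v * D v u)))"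
  unfolding ev_def monom_at_def
  by (intro log_gradient_sum log_gradient_cmult log_gradient_compose[where F = exp] DERIV_exp assms)

text \<open>By the chain rule the exponents are pulled back through \<open>D\<close>, so a
  substitution whose logarithmic Jacobian preserves \<open>Om\<close> on unit vectors is a Poisson
  map. The identity substitution identifies \<open>poisson\<close> with \<open>pb\<close>;
  \<open>phi\<close> gives the Poisson property of the transformation.\<close>

lemma poisson_ev_compose:
  assumes "positive n x"
    and "\<And>v. v \<in> strip n \<Longrightarrow> log_gradient n (\<lambda>x. ln (\<phi> x v)) x (D v)"
    and D: "\<And>u v. u \<in> strip n \<Longrightarrow> v \<in> strip n \<Longrightarrow> Om n (D u) (D v) = eps n u v"
  shows "poisson n (\<lambda>x. ev n p (\<phi> x)) (\<lambda>x. ev n q (\<phi> x)) x = ev n (pb n p q) (\<phi> x)"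
proof -
  define E where "E \<alpha> = (\<lambda>u. \<Sum>v\<in>strip n. \<alpha> v * D v u)" for \<alpha>
  have Om: "Om n (E \<alpha>) (E \<beta>) = Om n \<alpha> \<beta>" for \<alpha> \<beta>
    unfolding E_def Om_sum_left Om_sum_right Om_scale_left Om_scale_right Om_def[of n \<alpha> \<beta>]
    by (simp add: D sum_distrib_left mult_ac)
  have lg: "log_gradient n (\<lambda>x. ev n p (\<phi> x)) x
      (\<lambda>u. \<Sum>\<alpha>\<in>keys p. lookup p \<alpha> * (monom_at n \<alpha> (\<phi> x) * E \<alpha> u))" for p
    unfolding E_def by (rule log_gradient_ev_compose[OF assms(2)])
  have "poisson n (\<lambda>x. ev n p (\<phi> x)) (\<lambda>x. ev n q (\<phi> x)) x
    = (\<Sum>\<alpha>\<in>keys p. \<Sum>\<beta>\<in>keys q. lookup p \<alpha> * (monom_at n \<alpha> (\<phi> x) * (lookup q \<beta> * (monom_at n \<beta> (\<phi> x) * Om n \<alpha> \<beta>))))"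
    unfolding poisson_log_gradient[OF assms(1) lg lg]
    by (simp add: Om_sum_left Om_sum_right Om_scale_left Om_scale_right Om sum_distrib_left)
  also have "\<dots> = ev n (pb n p q) (\<phi> x)"
    unfolding pb_def by (simp add: ev_sum ev_single monom_at_add mult_ac)
  finally show ?thesis .
qed

lemma poisson_ev:
  assumes "positive n x"
  shows "poisson n (ev n p) (ev n q) x = ev n (pb n p q) x"
  using poisson_ev_compose[where \<phi> = "\<lambda>x. x", OF assms log_gradient_var[OF assms], where p = p and q = q] by (simp add: Om_units)

lemma log_gradient_ev:
  assumes "positive n x"
  shows "log_gradient n (ev n p) x (\<lambda>u. \<Sum>\<alpha>\<in>keys p. lookup p \<alpha> * (monom_at n \<alpha> x * (\<Sum>v\<in>strip n. \<alpha> v * of_bool (u = v))))"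
  using log_gradient_ev_compose[where \<phi> = "\<lambda>x. x", OF log_gradient_var[OF assms], where p = p] by simp

lemma poisson_cong:
  assumes "positive n x" "\<And>y. positive n y \<Longrightarrow> f y = f' y" "\<And>y. positive n y \<Longrightarrow> g y = g' y"
    and "log_gradient n f x \<gamma>" "log_gradient n g x \<delta>"
  shows "poisson n f' g' x = poisson n f g x"
  using assms poisson_log_gradient log_gradient_cong by metis

lemma poisson_eq_ev:
  assumes "positive n x" "\<And>y. positive n y \<Longrightarrow> f y = ev n p y" "\<And>y. positive n y \<Longrightarrow> g y = ev n q y"
  shows "poisson n f g x = ev n (pb n p q) x"
  using poisson_cong[OF assms(1) assms(2,3)[symmetric] log_gradient_ev[OF assms(1)] log_gradient_ev[OF assms(1)]]
    poisson_ev[OF assms(1)] by simp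

section \<open>Vertices modulo the Moebius rule and the arrows at a path\<close>

lemma sv_shift: "n > 0 \<Longrightarrow> sv n (if even t then i else int n - i) (j + t * int n) = sv n i j"
proof -
  assume n: "n > 0"
  have "(j + t * int n - 1) div int n = (j - 1) div int n + t"
    using n div_mult_self1[of "int n" "j - 1" t] by (simp add: algebra_simps)
  moreover have "(j + t * int n - 1) mod int n = (j - 1) mod int n"
    using mod_mult_self1[of "j - 1" t "int n"] by (simp add: algebra_simps)
  ultimately show ?thesis by (auto simp: sv_def)
qed

lemma sv_eq_iff:
  assumes "n > 0"
  shows "sv n i j = sv n i' j' \<longleftrightarrow>
    (\<exists>t. j' = j + t * int n \<and> i' = (if even t then i else int n - i))"
proof
  assume *: "sv n i j = sv n i' j'"
  then have m: "(j - 1) mod int n = (j' - 1) mod int n" by (simp add: sv_def)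
  define t where "t = (j' - 1) div int n - (j - 1) div int n"
  have "t * int n = (j' - 1) div int n * int n - (j - 1) div int n * int n"
    by (simp add: t_def algebra_simps)
  then have "j' = j + t * int n"
    using div_mult_mod_eq[of "j - 1" "int n"] div_mult_mod_eq[of "j' - 1" "int n"] m by linarith
  moreover have "i' = (if even t then i else int n - i)"
    using * unfolding t_def sv_def by (auto split: if_splits)
  ultimately show "\<exists>t. j' = j + t * int n \<and> i' = (if even t then i else int n - i)" by blast
next
  assume "\<exists>t. j' = j + t * int n \<and> i' = (if even t then i else int n - i)"
  then show "sv n i j = sv n i' j'" using sv_shift[OF assms] by metis
qed

lemma sv_in_strip: "1 \<le> i \<Longrightarrow> i \<le> int n - 1 \<Longrightarrow> sv n i j \<in> strip n"
proof -
  assume i: "1 \<le> i" "i \<le> int n - 1"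
  define r where "r = (j - 1) mod int n"
  have "0 \<le> r" "r < int n" using i unfolding r_def by simp_all
  then show ?thesis using i
    by (auto simp: sv_def strip_def image_def simp flip: r_def)
qed

lemma sv_neq_Extra [simp]: "sv n i j \<noteq> Extra" "Extra \<noteq> sv n i j"
  by (simp_all add: sv_def)

lemma sv_parity:
  assumes "n > 0" "sv n i j = sv n i' j'" shows "even (i + j) \<longleftrightarrow> even (i' + j')"
  using assms by (auto simp: sv_eq_iff split: if_splits)

text \<open>Arrows are introduced through representatives \<open>(i, j)\<close>. Two representatives
  of one vertex differ by \<open>t\<close> Moebius shifts, which respect horizontal steps and, for
  odd \<open>t\<close>, exchange the two vertical ones.\<close>

lemma sv_neighbour:
  assumes "n > 0" "sv n i j = sv n i' j'" "1 \<le> i'" "i' \<le> int n - 1"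
  shows "sv n i (j + d) = sv n i' (j' + d)"
    and "e \<in> {1, -1} \<Longrightarrow> 1 \<le> i + e \<Longrightarrow> i + e \<le> int n - 1 \<Longrightarrow>
      \<exists>e'\<in>{1, -1}. 1 \<le> i' + e' \<and> i' + e' \<le> int n - 1 \<and> sv n (i + e) j = sv n (i' + e') j'"
proof -
  obtain t where t: "j' = j + t * int n" "i' = (if even t then i else int n - i)"
    using assms(2) sv_eq_iff[OF assms(1)] by blast
  show "sv n i (j + d) = sv n i' (j' + d)"
    unfolding sv_eq_iff[OF assms(1)] using t by (intro exI[of _ t]) auto
  assume e: "e \<in> {1, -1}" "1 \<le> i + e" "i + e \<le> int n - 1"
  show "\<exists>e'\<in>{1, -1}. 1 \<le> i' + e' \<and> i' + e' \<le> int n - 1 \<and> sv n (i + e) j = sv n (i' + e') j'"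
  proof (rule bexI[of _ "if even t then e else - e"])
    show "1 \<le> i' + (if even t then e else - e) \<and> i' + (if even t then e else - e) \<le> int n - 1
        \<and> sv n (i + e) j = sv n (i' + (if even t then e else - e)) j'"
      unfolding sv_eq_iff[OF assms(1)] using t e by (auto intro!: exI[of _ t])
  qed (use e in auto)
qed

text \<open>The parity of \<open>i + j\<close> is independent of the representative, so among strip
  vertices only the vertical rules can produce an arrow ending here. The three companions below rest
  on the same argument.\<close>

lemma arrow_into_even:
  assumes "n > 0" "1 \<le> i" "i \<le> int n - 1" "even (i + j)" "v \<noteq> Extra"
  shows "arrow n v (sv n i j) \<longleftrightarrow> (2 \<le> i \<and> v = sv n (i - 1) j) \<or> (i \<le> int n - 2 \<and> v = sv n (i + 1) j)"
proof
  have step: "(2 \<le> i \<and> v = sv n (i - 1) j) \<or> (i \<le> int n - 2 \<and> v = sv n (i + 1) j)"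
    if eq: "sv n i0 j0 = sv n i j" and v: "v = sv n (i0 + e) j0"
    and e: "e \<in> {1, -1}" "1 \<le> i0 + e" "i0 + e \<le> int n - 1" for i0 j0 e
    using sv_neighbour(2)[OF assms(1) eq assms(2,3) e] v by auto
  assume "arrow n v (sv n i j)"
  then show "(2 \<le> i \<and> v = sv n (i - 1) j) \<or> (i \<le> int n - 2 \<and> v = sv n (i + 1) j)"
  proof cases
    case (down i0 j0)
    then show ?thesis using step[of i0 j0 1] by simp
  next
    case (up i0 j0)
    then show ?thesis using step[of i0 j0 "-1"] by simp
  next
    case (right i0 j0)
    then show ?thesis using sv_parity[OF assms(1), of i j i0 "j0 + 1"] assms by auto
  next
    case (left i0 j0)
    then show ?thesis using sv_parity[OF assms(1), of i j i0 "j0 - 1"] assms by auto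
  qed (use assms in auto)
next
  assume "(2 \<le> i \<and> v = sv n (i - 1) j) \<or> (i \<le> int n - 2 \<and> v = sv n (i + 1) j)"
  then show "arrow n v (sv n i j)" using assms arrow.up[of i n j] arrow.down[of i n j] by auto
qed

lemma arrow_into_odd:
  assumes "n > 0" "1 \<le> i" "i \<le> int n - 1" "odd (i + j)" "v \<noteq> Extra"
  shows "arrow n v (sv n i j) \<longleftrightarrow> v = sv n i (j - 1) \<or> v = sv n i (j + 1)"
proof
  assume "arrow n v (sv n i j)"
  then show "v = sv n i (j - 1) \<or> v = sv n i (j + 1)"
  proof cases
    case (down i0 j0)
    then show ?thesis using sv_parity[OF assms(1), of i j i0 j0] assms by auto
  next
    case (up i0 j0)
    then show ?thesis using sv_parity[OF assms(1), of i j i0 j0] assms by auto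
  next
    case (right i0 j0)
    then show ?thesis using sv_neighbour(1)[OF assms(1), of i0 "j0 + 1" i j "-1"] assms by auto
  next
    case (left i0 j0)
    then show ?thesis using sv_neighbour(1)[OF assms(1), of i0 "j0 - 1" i j "1"] assms by auto
  qed (use assms in auto)
next
  assume "v = sv n i (j - 1) \<or> v = sv n i (j + 1)"
  then show "arrow n v (sv n i j)"
    using assms arrow.right[of i n "j - 1"] arrow.left[of i n "j + 1"] by auto
qed

lemma arrow_from_even:
  assumes "n > 0" "1 \<le> i" "i \<le> int n - 1" "even (i + j)" "v \<noteq> Extra"
  shows "arrow n (sv n i j) v \<longleftrightarrow> v = sv n i (j - 1) \<or> v = sv n i (j + 1)"
proof
  assume "arrow n (sv n i j) v"
  then show "v = sv n i (j - 1) \<or> v = sv n i (j + 1)"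
  proof cases
    case (down i0 j0)
    then show ?thesis using sv_parity[OF assms(1), of i j "i0 + 1" j0] assms by auto
  next
    case (up i0 j0)
    then show ?thesis using sv_parity[OF assms(1), of i j "i0 - 1" j0] assms by auto
  next
    case (right i0 j0)
    then show ?thesis using sv_neighbour(1)[OF assms(1), of i0 j0 i j 1] assms by auto
  next
    case (left i0 j0)
    then show ?thesis using sv_neighbour(1)[OF assms(1), of i0 j0 i j "-1"] assms by auto
  qed (use assms in auto)
next
  assume "v = sv n i (j - 1) \<or> v = sv n i (j + 1)"
  then show "arrow n (sv n i j) v"
    using assms arrow.right[of i n j] arrow.left[of i n j] by auto
qed

lemma arrow_from_odd:
  assumes "n > 0" "1 \<le> i" "i \<le> int n - 1" "odd (i + j)" "v \<noteq> Extra"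
  shows "arrow n (sv n i j) v \<longleftrightarrow> (2 \<le> i \<and> v = sv n (i - 1) j) \<or> (i \<le> int n - 2 \<and> v = sv n (i + 1) j)"
proof
  have step: "(2 \<le> i \<and> v = sv n (i - 1) j) \<or> (i \<le> int n - 2 \<and> v = sv n (i + 1) j)"
    if eq: "sv n i0 j0 = sv n i j" and v: "v = sv n (i0 + e) j0"
    and e: "e \<in> {1, -1}" "1 \<le> i0 + e" "i0 + e \<le> int n - 1" for i0 j0 e
    using sv_neighbour(2)[OF assms(1) eq assms(2,3) e] v by auto
  assume "arrow n (sv n i j) v"
  then show "(2 \<le> i \<and> v = sv n (i - 1) j) \<or> (i \<le> int n - 2 \<and> v = sv n (i + 1) j)"
  proof cases
    case (down i0 j0)
    then show ?thesis using step[of "i0 + 1" j0 "-1"] by simp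
  next
    case (up i0 j0)
    then show ?thesis using step[of "i0 - 1" j0 1] by simp
  next
    case (right i0 j0)
    then show ?thesis using sv_parity[OF assms(1), of i j i0 j0] assms by auto
  next
    case (left i0 j0)
    then show ?thesis using sv_parity[OF assms(1), of i j i0 j0] assms by auto
  qed (use assms in auto)
next
  assume "(2 \<le> i \<and> v = sv n (i - 1) j) \<or> (i \<le> int n - 2 \<and> v = sv n (i + 1) j)"
  then show "arrow n (sv n i j) v"
    using assms arrow.up[of "i + 1" n j] arrow.down[of "i - 1" n j] by auto
qed

lemma path_odd: "path n q (2 * m + 1) = sv n (int m + 1) (q - int m)"
  by (simp add: path_def add.commute)

lemma path_even: "path n q (2 * m) = sv n (int m) (q - int m)"
  by (simp add: path_def)

lemma adj_odd: "adj n q (2 * m + 1) = sv n (int m + 2) (q - int m)"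
  by (simp add: adj_def)

lemma adj_even: "adj n q (2 * m) = sv n (int m) (q - int m - 1)"
  by (simp add: adj_def)

lemma path_in_strip: "1 \<le> k \<Longrightarrow> k \<le> 2 * n - 2 \<Longrightarrow> path n q k \<in> strip n"
  unfolding path_def by (rule sv_in_strip) auto

lemma adj_in_strip: "1 \<le> k \<Longrightarrow> k \<le> 2 * n - 4 \<Longrightarrow> adj n q k \<in> strip n"
  unfolding adj_def by (auto intro!: sv_in_strip elim!: oddE evenE)

lemma of_bool_disj_disjoint: "\<not> (P \<and> Q) \<Longrightarrow> of_bool (P \<or> Q) = (of_bool P + of_bool Q :: real)"
  by auto

text \<open>The local picture: \<open>a_(k-1)\<close> and \<open>b_k\<close> point to
  \<open>a_k\<close>, which points to \<open>a_(k+1)\<close> and \<open>b_(k-2)\<close>; in addition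
  the Moebius rule produces an arrow from the first to the last path vertex. The side conditions of
  the six indicators drop the neighbours missing at the ends.\<close>

lemma eps_path:
  assumes n: "n > 3" and q: "odd q" and k: "1 \<le> k" "k \<le> 2 * n - 2" and v: "v \<in> strip n"
  shows "eps n v (path n q k) =
      of_bool (2 \<le> k \<and> v = path n q (k - 1)) + of_bool (k \<le> 2 * n - 4 \<and> v = adj n q k)
    + of_bool (k = 2 * n - 2 \<and> v = path n q 1)
    - of_bool (k < 2 * n - 2 \<and> v = path n q (k + 1)) - of_bool (3 \<le> k \<and> v = adj n q (k - 2))
    - of_bool (k = 1 \<and> v = path n q (2 * n - 2))"
proof (cases "odd k")
  case True
  then obtain m where m: "k = 2 * m + 1" by (auto elim: oddE)
  have E: "v \<noteq> Extra" using v by auto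
  have p: "path n q k = sv n (int m + 1) (q - int m)" using path_odd m by simp
  have r: "n > 0" "1 \<le> int m + 1" "int m + 1 \<le> int n - 1" "even (int m + 1 + (q - int m))"
    using n k m q by auto
  have prev: "path n q (k - 1) = sv n (int m) (q - int m)" using path_even m by simp
  have next': "path n q (k + 1) = sv n (int m + 1) (q - int m - 1)"
    using path_even[of n q "m + 1"] m by (simp add: algebra_simps)
  have a: "adj n q k = sv n (int m + 2) (q - int m)" using adj_odd m by simp
  have b: "adj n q (k - 2) = sv n (int m + 1) (q - int m + 1)" if "m \<ge> 1"
  proof -
    have "k - 2 = 2 * (m - 1) + 1" using m that by simp
    then show ?thesis using adj_odd[of n q "m - 1"] that by (simp add: of_nat_diff algebra_simps)
  qed
  \<comment> \<open>By the Moebius rule the last path vertex sits next to the first one, which is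
    the origin of the closing arrow.\<close>
  have c: "path n q (2 * n - 2) = sv n 1 (q + 1)"
  proof -
    have "2 * n - 2 = 2 * (n - 1)" by simp
    then have "path n q (2 * n - 2) = sv n (int n - 1) (q - int n + 1)"
      using path_even[of n q "n - 1"] n by (simp add: of_nat_diff algebra_simps)
    then show ?thesis using sv_moebius[of n 1 "q - int n + 1"] n by simp
  qed
  have d1: "sv n (int m) (q - int m) \<noteq> sv n (int m + 2) (q - int m)"
    using sv_eqD[of n "int m" "q - int m" "int m + 2" "q - int m"] n by auto
  have d2: "sv n (int m + 1) (q - int m - 1) \<noteq> sv n (int m + 1) (q - int m + 1)"
    using sv_eqD[of n "int m + 1" "q - int m - 1" "int m + 1" "q - int m + 1"] n by auto
  have e: "int m + 1 + 1 = int m + 2" "int m + 1 - 1 = int m" by simp_all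
  have i: "of_bool (arrow n v (path n q k)) = (of_bool (m \<ge> 1 \<and> v = sv n (int m) (q - int m))
      + of_bool (m + 3 \<le> n \<and> v = sv n (int m + 2) (q - int m)) :: real)"
    unfolding p arrow_into_even[OF r E] e using n d1 by (subst of_bool_disj_disjoint) auto
  have o: "of_bool (arrow n (path n q k) v) = (of_bool (v = sv n (int m + 1) (q - int m - 1))
      + of_bool (v = sv n (int m + 1) (q - int m + 1)) :: real)"
    unfolding p arrow_from_even[OF r E] using n d2 by (subst of_bool_disj_disjoint) auto
  have conds: "(2 \<le> k) = (m \<ge> 1)" "(k \<le> 2 * n - 4) = (m + 3 \<le> n)" "(k = 2 * n - 2) = False"
      "(k < 2 * n - 2) = True" "(3 \<le> k) = (m \<ge> 1)" "(k = 1) = (m = 0)"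
    using n k unfolding m by presburger+
  show ?thesis
    unfolding eps_def i o prev next' a conds
    using b c by (cases "m = 0") simp_all
next
  case False
  then obtain m where m: "k = 2 * m" by (auto elim: evenE)
  have E: "v \<noteq> Extra" using v by auto
  have p: "path n q k = sv n (int m) (q - int m)" using path_even m by simp
  have r: "n > 0" "1 \<le> int m" "int m \<le> int n - 1" "odd (int m + (q - int m))"
    using n k m q by auto
  have prev: "path n q (k - 1) = sv n (int m) (q - int m + 1)"
  proof -
    have "k - 1 = 2 * (m - 1) + 1" using m k by simp
    then show ?thesis using path_odd[of n q "m - 1"] m k by (simp add: of_nat_diff algebra_simps)
  qed
  have next': "path n q (k + 1) = sv n (int m + 1) (q - int m)"
    using path_odd[of n q m] m by simp
  have a: "adj n q k = sv n (int m) (q - int m - 1)" using adj_even m by simp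
  have b: "adj n q (k - 2) = sv n (int m - 1) (q - int m)"
  proof -
    have "k - 2 = 2 * (m - 1)" using m k by simp
    then show ?thesis using adj_even[of n q "m - 1"] m k by (simp add: of_nat_diff algebra_simps)
  qed
  have c: "path n q 1 = sv n (int n - 1) (q - int n)"
    using path_odd[of n q 0] sv_moebius[of n 1 "q - int n"] n by simp
  have d1: "sv n (int m - 1) (q - int m) \<noteq> sv n (int m + 1) (q - int m)"
    using sv_eqD[of n "int m - 1" "q - int m" "int m + 1" "q - int m"] n by auto
  have d2: "sv n (int m) (q - int m - 1) \<noteq> sv n (int m) (q - int m + 1)"
    using sv_eqD[of n "int m" "q - int m - 1" "int m" "q - int m + 1"] n by auto
  have i: "of_bool (arrow n v (path n q k)) = (of_bool (v = sv n (int m) (q - int m - 1))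
      + of_bool (v = sv n (int m) (q - int m + 1)) :: real)"
    unfolding p arrow_into_odd[OF r E] using n d2 by (subst of_bool_disj_disjoint) auto
  have o: "of_bool (arrow n (path n q k) v) = (of_bool (m \<ge> 2 \<and> v = sv n (int m - 1) (q - int m))
      + of_bool (m + 2 \<le> n \<and> v = sv n (int m + 1) (q - int m)) :: real)"
    unfolding p arrow_from_odd[OF r E] using n d1 by (subst of_bool_disj_disjoint) auto
  have conds: "(2 \<le> k) = True" "(k \<le> 2 * n - 4) = (m \<noteq> n - 1)" "(k = 2 * n - 2) = (m = n - 1)"
      "(k < 2 * n - 2) = (m + 2 \<le> n)" "(3 \<le> k) = (m \<ge> 2)" "(k = 1) = False"
    using n k unfolding m by presburger+
  show ?thesis
    unfolding eps_def i o prev next' a b conds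
    using c n by (cases "m = n - 1") (simp_all add: of_nat_diff)
qed

section \<open>The form \<open>Om\<close> on exponents supported on one path\<close>

abbreviation unit_exp :: "vertex \<Rightarrow> exponent" where
  "unit_exp u \<equiv> (\<lambda>v. of_bool (v = u))"

definition comb :: "(nat \<Rightarrow> vertex) \<Rightarrow> nat \<Rightarrow> (nat \<Rightarrow> real) \<Rightarrow> exponent" where
  "comb w N \<sigma> = (\<lambda>v. \<Sum>j=1..N. \<sigma> j * of_bool (v = w j))"

lemma Om_comb_left: "Om n (comb w N \<sigma>) \<beta> = (\<Sum>j=1..N. \<sigma> j * Om n (unit_exp (w j)) \<beta>)"
  unfolding comb_def Om_sum_left Om_scale_left ..

lemma Om_comb_right: "Om n \<alpha> (comb w N \<sigma>) = (\<Sum>j=1..N. \<sigma> j * Om n \<alpha> (unit_exp (w j)))"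
  unfolding comb_def Om_sum_right Om_scale_right ..

locale zigzag =
  fixes n :: nat and q :: int
  assumes n: "n > 3" and q: "odd q"
begin

abbreviation N :: nat where "N \<equiv> 2 * n - 2"
abbreviation pth :: "nat \<Rightarrow> vertex" where "pth \<equiv> path n q"
abbreviation adjv :: "nat \<Rightarrow> vertex" where "adjv \<equiv> adj n q"

lemma N: "6 \<le> N"
  using n by simp

lemma pth_eq_iff: "1 \<le> i \<Longrightarrow> i \<le> N \<Longrightarrow> 1 \<le> j \<Longrightarrow> j \<le> N \<Longrightarrow> pth i = pth j \<longleftrightarrow> i = j"
  using inj_onD[OF path_inj[of n q], of i j] by auto

lemma adjv_eq_iff: "1 \<le> i \<Longrightarrow> i \<le> N - 2 \<Longrightarrow> 1 \<le> j \<Longrightarrow> j \<le> N - 2 \<Longrightarrow> adjv i = adjv j \<longleftrightarrow> i = j"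
  using inj_onD[OF adj_inj[of n q], of i j] by auto

lemma pth_neq_adjv: "1 \<le> i \<Longrightarrow> i \<le> N \<Longrightarrow> 1 \<le> j \<Longrightarrow> j \<le> N - 2 \<Longrightarrow> pth i \<noteq> adjv j"
  using path_neq_adj[of i n j q] by auto

lemma sum_of_bool_eq:
  fixes f :: "nat \<Rightarrow> real"
  shows "finite K \<Longrightarrow> (\<Sum>j\<in>K. f j * of_bool (j = a \<and> P)) = of_bool (a \<in> K \<and> P) * f a"
  by (cases P) (simp_all add: of_bool_def if_distrib cong: if_cong)

text \<open>A path vertex sees its two path neighbours, with the antiperiodic continuation
  \<open>\<sigma> (N + 1) = - \<sigma> 1\<close> and \<open>\<sigma> 0 = - \<sigma> N\<close>: the
  closing arrow runs from \<open>pth 1\<close> to \<open>pth N\<close>, against the cyclic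
  direction.\<close>

lemma Om_pth:
  assumes i: "1 \<le> i" "i \<le> N"
  shows "Om n (unit_exp (pth i)) (comb pth N \<sigma>) =
    (if i < N then \<sigma> (i + 1) else - \<sigma> 1) - (if i = 1 then - \<sigma> N else \<sigma> (i - 1))"
proof -
  have e: "eps n (pth i) (pth j) = of_bool (j = i + 1 \<and> True) + of_bool (j = N \<and> i = 1)
      - of_bool (j = i - 1 \<and> 2 \<le> i) - of_bool (j = 1 \<and> i = N)" if j: "j \<in> {1..N}" for j
  proof -
    have e1: "(2 \<le> j \<and> pth i = pth (j - 1)) = (j = i + 1)" using i j by (cases "2 \<le> j") (auto simp: pth_eq_iff)
    have e2: "(j \<le> 2 * n - 4 \<and> pth i = adjv j) = False" using i j N pth_neq_adjv[of i j] by auto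
    have e3: "(j = 2 * n - 2 \<and> pth i = pth 1) = (j = N \<and> i = 1)" using i N pth_eq_iff[of i 1] by auto
    have e4: "(j < 2 * n - 2 \<and> pth i = pth (j + 1)) = (j = i - 1 \<and> 2 \<le> i)" using i j pth_eq_iff[of i "j + 1"] by auto
    have e5: "(3 \<le> j \<and> pth i = adjv (j - 2)) = False" using i j N pth_neq_adjv[of i "j - 2"] by (cases "3 \<le> j") simp_all
    have e6: "(j = 1 \<and> pth i = pth (2 * n - 2)) = (j = 1 \<and> i = N)" using i N pth_eq_iff[of i N] by auto
    have j': "1 \<le> j" "j \<le> N" using j by auto
    show ?thesis
      unfolding eps_path[OF n q j' path_in_strip[OF i]] e1 e2 e3 e4 e5 e6 by simp
  qed
  have "Om n (unit_exp (pth i)) (comb pth N \<sigma>) = (\<Sum>j=1..N. \<sigma> j * eps n (pth i) (pth j))"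
    unfolding Om_comb_right by (intro sum.cong refl) (simp add: Om_units path_in_strip path_in_strip[OF i])
  also have "\<dots> = (\<Sum>j=1..N. \<sigma> j * of_bool (j = i + 1 \<and> True)) + (\<Sum>j=1..N. \<sigma> j * of_bool (j = N \<and> i = 1))
      - (\<Sum>j=1..N. \<sigma> j * of_bool (j = i - 1 \<and> 2 \<le> i)) - (\<Sum>j=1..N. \<sigma> j * of_bool (j = 1 \<and> i = N))"
    unfolding sum.distrib[symmetric] sum_subtractf[symmetric]
    by (intro sum.cong refl) (simp only: e distrib_left right_diff_distrib)
  finally have *: "Om n (unit_exp (pth i)) (comb pth N \<sigma>)
      = of_bool (i + 1 \<in> {1..N} \<and> True) * \<sigma> (i + 1) + of_bool (N \<in> {1..N} \<and> i = 1) * \<sigma> N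
        - of_bool (i - 1 \<in> {1..N} \<and> 2 \<le> i) * \<sigma> (i - 1) - of_bool (1 \<in> {1..N} \<and> i = N) * \<sigma> 1"
    unfolding sum_of_bool_eq[OF finite_atLeastAtMost] .
  have m: "(i + 1 \<in> {1..N} \<and> True) = (i < N)" "(N \<in> {1..N} \<and> i = 1) = (i = 1)"
      "(i - 1 \<in> {1..N} \<and> 2 \<le> i) = (i \<noteq> 1)" "(1 \<in> {1..N} \<and> i = N) = (\<not> i < N)"
    using i N by auto
  show ?thesis unfolding * m by auto
qed

text \<open>This is the negative of the value at \<open>pth (i + 1)\<close>. Hence the product of
  the variables at \<open>adjv i\<close> and \<open>pth (i + 1)\<close> commutes with the whole
  path, which is what \<open>log_gradient_phi_aux\<close> exploits.\<close>

lemma Om_adjv: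
  assumes i: "1 \<le> i" "i \<le> N - 2"
  shows "Om n (unit_exp (adjv i)) (comb pth N \<sigma>) = \<sigma> i - \<sigma> (i + 2)"
proof -
  have s: "adjv i \<in> strip n" using i by (intro adj_in_strip) auto
  have e: "eps n (adjv i) (pth j) = of_bool (j = i) - of_bool (j = i + 2)" if j: "j \<in> {1..N}" for j
  proof -
    have "pth k \<noteq> adjv i" if "1 \<le> k" "k \<le> N" for k using that i by (rule pth_neq_adjv)
    then have ne: "(adjv i = pth k) = False" if "1 \<le> k" "k \<le> N" for k using that by metis
    have e1: "(2 \<le> j \<and> adjv i = pth (j - 1)) = False" using j ne[of "j - 1"] by (cases "2 \<le> j") simp_all
    have e2: "(j \<le> 2 * n - 4 \<and> adjv i = adjv j) = (j = i)" using i j N adjv_eq_iff[of i j] by auto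
    have e3: "(j = 2 * n - 2 \<and> adjv i = pth 1) = False" using N ne[of 1] by auto
    have e4: "(j < 2 * n - 2 \<and> adjv i = pth (j + 1)) = False" using j ne[of "j + 1"] by auto
    have e5: "(3 \<le> j \<and> adjv i = adjv (j - 2)) = (j = i + 2)" using i j N adjv_eq_iff[of i "j - 2"] by auto
    have e6: "(j = 1 \<and> adjv i = pth (2 * n - 2)) = False" using N ne[of N] by auto
    have j': "1 \<le> j" "j \<le> N" using j by auto
    show ?thesis
      unfolding eps_path[OF n q j' s] e1 e2 e3 e4 e5 e6 by simp
  qed
  have "Om n (unit_exp (adjv i)) (comb pth N \<sigma>) = (\<Sum>j=1..N. \<sigma> j * eps n (adjv i) (pth j))"
    unfolding Om_comb_right by (intro sum.cong refl) (simp add: Om_units path_in_strip s)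
  also have "\<dots> = (\<Sum>j=1..N. \<sigma> j * of_bool (j = i \<and> True)) - (\<Sum>j=1..N. \<sigma> j * of_bool (j = i + 2 \<and> True))"
    unfolding sum_subtractf[symmetric]
    by (intro sum.cong refl) (simp add: e algebra_simps)
  finally show ?thesis
    unfolding sum_of_bool_eq[OF finite_atLeastAtMost] using i by auto
qed

lemma Om_other:
  assumes "v \<in> strip n" "v \<notin> pth ` {1..N}" "v \<notin> adjv ` {1..N - 2}"
  shows "Om n (unit_exp v) (comb pth N \<sigma>) = 0"
proof -
  have "eps n v (pth j) = 0" if j: "j \<in> {1..N}" for j
  proof -
    have a: "(v = pth k) = False" if "1 \<le> k" "k \<le> N" for k using assms(2) that by auto
    have b: "(v = adjv k) = False" if "1 \<le> k" "k \<le> N - 2" for k using assms(3) that by auto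
    have e1: "(2 \<le> j \<and> v = pth (j - 1)) = False" using j a[of "j - 1"] by (cases "2 \<le> j") simp_all
    have e2: "(j \<le> 2 * n - 4 \<and> v = adjv j) = False" using j N b[of j] by auto
    have e3: "(j = 2 * n - 2 \<and> v = pth 1) = False" using N a[of 1] by auto
    have e4: "(j < 2 * n - 2 \<and> v = pth (j + 1)) = False" using j a[of "j + 1"] by auto
    have e5: "(3 \<le> j \<and> v = adjv (j - 2)) = False" using j N b[of "j - 2"] by (cases "3 \<le> j") simp_all
    have e6: "(j = 1 \<and> v = pth (2 * n - 2)) = False" using N a[of N] by auto
    have j': "1 \<le> j" "j \<le> N" using j by auto
    show ?thesis
      unfolding eps_path[OF n q j' assms(1)] e1 e2 e3 e4 e5 e6 by simp
  qed
  then show ?thesis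
    unfolding Om_comb_right by (intro sum.neutral) (simp add: Om_units path_in_strip assms(1))
qed

lemma Om_pth_pth:
  "Om n (comb pth N \<rho>) (comb pth N \<sigma>)
    = (\<Sum>i=1..N - 1. \<rho> i * \<sigma> (i + 1) - \<rho> (i + 1) * \<sigma> i) + \<rho> 1 * \<sigma> N - \<rho> N * \<sigma> 1"
proof -
  have "Om n (comb pth N \<rho>) (comb pth N \<sigma>)
      = (\<Sum>i=1..N. \<rho> i * (if i < N then \<sigma> (i + 1) else - \<sigma> 1) - \<rho> i * (if i = 1 then - \<sigma> N else \<sigma> (i - 1)))"
    unfolding Om_comb_left by (intro sum.cong refl) (subst Om_pth, auto simp: right_diff_distrib)
  also have "\<dots> = (\<Sum>i=1..N. \<rho> i * (if i < N then \<sigma> (i + 1) else - \<sigma> 1))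
      - (\<Sum>i=1..N. \<rho> i * (if i = 1 then - \<sigma> N else \<sigma> (i - 1)))"
    by (rule sum_subtractf)
  also have "(\<Sum>i=1..N. \<rho> i * (if i < N then \<sigma> (i + 1) else - \<sigma> 1))
      = (\<Sum>i=1..N - 1. \<rho> i * \<sigma> (i + 1)) - \<rho> N * \<sigma> 1"
  proof -
    have "{1..N} = insert N {1..N - 1}" using N by auto
    then have "(\<Sum>i=1..N. \<rho> i * (if i < N then \<sigma> (i + 1) else - \<sigma> 1))
        = - \<rho> N * \<sigma> 1 + (\<Sum>i=1..N - 1. \<rho> i * (if i < N then \<sigma> (i + 1) else - \<sigma> 1))"
      using N by simp
    also have "(\<Sum>i=1..N - 1. \<rho> i * (if i < N then \<sigma> (i + 1) else - \<sigma> 1))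
        = (\<Sum>i=1..N - 1. \<rho> i * \<sigma> (i + 1))"
      using N by (intro sum.cong refl) auto
    finally show ?thesis by simp
  qed
  also have "(\<Sum>i=1..N. \<rho> i * (if i = 1 then - \<sigma> N else \<sigma> (i - 1)))
      = (\<Sum>i=1..N - 1. \<rho> (i + 1) * \<sigma> i) - \<rho> 1 * \<sigma> N"
  proof -
    have "{1..N} = insert 1 {Suc 1..Suc (N - 1)}" using N by auto
    then have "(\<Sum>i=1..N. \<rho> i * (if i = 1 then - \<sigma> N else \<sigma> (i - 1)))
        = - \<rho> 1 * \<sigma> N + (\<Sum>i=Suc 1..Suc (N - 1). \<rho> i * (if i = 1 then - \<sigma> N else \<sigma> (i - 1)))"
      by simp
    also have "(\<Sum>i=Suc 1..Suc (N - 1). \<rho> i * (if i = 1 then - \<sigma> N else \<sigma> (i - 1)))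
        = (\<Sum>i=1..N - 1. \<rho> (i + 1) * \<sigma> i)"
      unfolding sum.shift_bounds_cl_Suc_ivl by (intro sum.cong) auto
    finally show ?thesis by simp
  qed
  finally show ?thesis by (simp add: sum_subtractf)
qed

end

text \<open>The exponents of the monomials of a telescopic sum along \<open>w\<close>.\<close>

definition sg :: "nat \<Rightarrow> nat \<Rightarrow> real" where
  "sg k j = (if j \<le> k then - 1 / 2 else 1 / 2)"

abbreviation theta :: "(nat \<Rightarrow> vertex) \<Rightarrow> nat \<Rightarrow> nat \<Rightarrow> exponent" where
  "theta w N k \<equiv> comb w N (sg k)"

abbreviation tail_exp :: "(nat \<Rightarrow> vertex) \<Rightarrow> nat \<Rightarrow> nat \<Rightarrow> exponent" where
  "tail_exp w N r \<equiv> comb w N (\<lambda>j. of_bool (r \<le> j))"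

context zigzag
begin

text \<open>Two tail products differ in their bracket only through the arrow into
  \<open>pth s\<close> from its predecessor; a tail that starts at 1 gains a second unit from the
  closing arrow.\<close>

lemma Om_tails:
  assumes "1 \<le> r" "r < s"
  shows "Om n (tail_exp pth N r) (tail_exp pth N s) = of_bool (s \<le> N) * (if r = 1 then 2 else 1)"
proof -
  have "of_bool (r \<le> i) * of_bool (s \<le> i + 1) - of_bool (r \<le> i + 1) * of_bool (s \<le> i)
      = (of_bool (i = s - 1) :: real)" for i
    using assms by auto
  then have "Om n (tail_exp pth N r) (tail_exp pth N s)
      = (\<Sum>i=1..N - 1. of_bool (i = s - 1)) + of_bool (r \<le> 1) * of_bool (s \<le> N) - of_bool (r \<le> N) * of_bool (s \<le> 1)"
    unfolding Om_pth_pth by simp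
  also have "(\<Sum>i=1..N - 1. of_bool (i = s - 1)) = (of_bool (s \<le> N) :: real)"
    using assms N by (auto simp: of_bool_def)
  finally show ?thesis using assms by auto
qed

text \<open>Each sign change inside the path contributes 1/2. The closing arrow restores a missing
  half when exactly one of the two cuts lies at an end of the path, but not when both do.\<close>

lemma Om_theta:
  assumes "j < k" "k \<le> N"
  shows "Om n (theta pth N j) (theta pth N k) = (if j = 0 \<and> k = N then 0 else 1)"
proof -
  have "sg j i * sg k (i + 1) - sg j (i + 1) * sg k i
      = of_bool (i = j) * (1 / 2) + of_bool (i = k) * (1 / 2)" for i
    using assms by (auto simp: sg_def)
  then have "Om n (theta pth N j) (theta pth N k)
      = (\<Sum>i=1..N - 1. of_bool (i = j) * (1 / 2) + of_bool (i = k) * (1 / 2)) + sg j 1 * sg k N - sg j N * sg k 1"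
    unfolding Om_pth_pth by simp
  also have "(\<Sum>i=1..N - 1. of_bool (i = j) * (1 / 2) + of_bool (i = k) * (1 / 2))
      = of_bool (1 \<le> j) / 2 + (of_bool (k < N) / 2 :: real)"
    using assms N by (auto simp: sum.distrib of_bool_def sum_divide_distrib[symmetric])
  finally have *: "Om n (theta pth N j) (theta pth N k)
    = of_bool (1 \<le> j) / 2 + of_bool (k < N) / 2 + sg j 1 * sg k N - sg j N * sg k 1" .
  have "sg j 1 * sg k N - sg j N * sg k 1 = (if (j = 0) = (k < N) then 1 / 2 else 0)"
    using assms N by (auto simp: sg_def)
  with * show ?thesis using assms by (auto split: if_splits)
qed

end

section \<open>Intersections of two source paths\<close>

text \<open>The column bounds force the number \<open>t\<close> of Moebius shifts to be 0, 1 or 2,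
  giving the three alternatives.\<close>

lemma sv_cross:
  assumes n: "n > 0" and s: "0 < s" "s < int n"
    and I: "0 \<le> I'" "I' < int n" and K: "0 \<le> K'" "K' < int n"
  shows "sv n I (q - 2 * s - I') = sv n K (q - K') \<longleftrightarrow>
    (2 * s + I' = K' \<and> K = I) \<or> (2 * s + I' = K' + int n \<and> K = int n - I)
    \<or> (2 * s + I' = K' + 2 * int n \<and> K = I)"
proof
  assume "sv n I (q - 2 * s - I') = sv n K (q - K')"
  then obtain t where t: "q - K' = q - 2 * s - I' + t * int n" "K = (if even t then I else int n - I)"
    using sv_eq_iff[OF n] by blast
  then have e: "t * int n = 2 * s + I' - K'" by linarith
  have "t * int n < 3 * int n" "(-1) * int n < t * int n" unfolding e using s I K by linarith+
  then have "t < 3" "-1 < t" using n by (simp_all only: mult_less_cancel_right)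
  then consider "t = 0" | "t = 1" | "t = 2" by linarith
  then show "(2 * s + I' = K' \<and> K = I) \<or> (2 * s + I' = K' + int n \<and> K = int n - I)
    \<or> (2 * s + I' = K' + 2 * int n \<and> K = I)"
    by cases (use t e in auto)
next
  assume "(2 * s + I' = K' \<and> K = I) \<or> (2 * s + I' = K' + int n \<and> K = int n - I)
    \<or> (2 * s + I' = K' + 2 * int n \<and> K = I)"
  then show "sv n I (q - 2 * s - I') = sv n K (q - K')"
  proof (elim disjE conjE)
    assume "2 * s + I' = K' + int n" "K = int n - I"
    then show ?thesis unfolding sv_eq_iff[OF n] by (intro exI[of _ 1]) auto
  next
    assume "2 * s + I' = K' + 2 * int n" "K = I"
    then show ?thesis unfolding sv_eq_iff[OF n] by (intro exI[of _ 2]) auto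
  qed (auto simp: sv_eq_iff[OF n] intro!: exI[of _ 0])
qed

context zigzag
begin

text \<open>After an even number of Moebius shifts the rows would agree while the columns differ by
  at least two, which a zig-zag does not allow. Only a single shift remains, and it yields two
  consecutive shared vertices.\<close>

lemma path_eq_pth:
  assumes s: "1 \<le> s" "s \<le> n - 1" and i: "1 \<le> i" "i \<le> N" and k: "1 \<le> k" "k \<le> N"
  shows "path n (q - 2 * int s) i = pth k \<longleftrightarrow>
    (i = N - 2 * s + 1 \<and> k = 2 * s - 1) \<or> (i = N - 2 * s + 2 \<and> k = 2 * s)"
proof -
  have "path n (q - 2 * int s) i = pth k \<longleftrightarrow>
    (2 * int s + int (i div 2) = int (k div 2) \<and> int ((k + 1) div 2) = int ((i + 1) div 2))
    \<or> (2 * int s + int (i div 2) = int (k div 2) + int n \<and> int ((k + 1) div 2) = int n - int ((i + 1) div 2))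
    \<or> (2 * int s + int (i div 2) = int (k div 2) + 2 * int n \<and> int ((k + 1) div 2) = int ((i + 1) div 2))"
    unfolding path_def using n s i k by (intro sv_cross) auto
  also have "\<dots> \<longleftrightarrow> (i = N - 2 * s + 1 \<and> k = 2 * s - 1) \<or> (i = N - 2 * s + 2 \<and> k = 2 * s)"
  proof -
    obtain s' where s': "s = Suc s'" using s by (cases s) auto
    define d where "d = n - s' - 2"
    have d: "n = s' + d + 2" using s n unfolding d_def s' by simp
    have e: "N - 2 * s = 2 * d" "2 * s - 1 = 2 * s' + 1" "2 * s = 2 * s' + 2"
      unfolding d s' by auto
    obtain I where I: "i = 2 * I \<or> i = 2 * I + 1" by (meson evenE oddE)
    obtain K where K: "k = 2 * K \<or> k = 2 * K + 1" by (meson evenE oddE)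
    have i': "1 \<le> i" "i \<le> 2 * s' + 2 * d + 2" and k': "1 \<le> k" "k \<le> 2 * s' + 2 * d + 2"
      using i k unfolding d by auto
    show ?thesis
      using I K
    proof (elim disjE)
      assume I: "i = 2 * I" and K: "k = 2 * K"
      show ?thesis unfolding e using i' k' unfolding I K d s' by (auto; presburger?)
    next
      assume I: "i = 2 * I" and K: "k = 2 * K + 1"
      show ?thesis unfolding e using i' k' unfolding I K d s' by (auto; presburger?)
    next
      assume I: "i = 2 * I + 1" and K: "k = 2 * K"
      show ?thesis unfolding e using i' k' unfolding I K d s' by (auto; presburger?)
    next
      assume I: "i = 2 * I + 1" and K: "k = 2 * K + 1"
      show ?thesis unfolding e using i' k' unfolding I K d s' by (auto; presburger?)
    qed
  qed
  finally show ?thesis .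
qed

text \<open>The first two alternatives are the vertices just before and just after the shared pair.
  The last two belong to the preceding path (\<open>s = 1\<close>) and, up to the period
  \<open>2n\<close>, to the following one (\<open>s = n - 1\<close>), which run alongside the
  reference path.\<close>

lemma path_eq_adjv:
  assumes s: "1 \<le> s" "s \<le> n - 1" and i: "1 \<le> i" "i \<le> N" and j: "1 \<le> j" "j \<le> N - 2"
  shows "path n (q - 2 * int s) i = adjv j \<longleftrightarrow>
    (s \<le> n - 2 \<and> i = N - 2 * s \<and> j = 2 * s - 1) \<or> (2 \<le> s \<and> i = N - 2 * s + 3 \<and> j = 2 * s - 2)
    \<or> (s = 1 \<and> odd i \<and> j = i + 1) \<or> (s = n - 1 \<and> even i \<and> i = j + 3)"
proof (cases "odd j")
  case True
  then obtain m where m: "j = 2 * m + 1" by (auto elim: oddE)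
  have "path n (q - 2 * int s) i = adjv j \<longleftrightarrow>
    (2 * int s + int (i div 2) = int m \<and> int m + 2 = int ((i + 1) div 2))
    \<or> (2 * int s + int (i div 2) = int m + int n \<and> int m + 2 = int n - int ((i + 1) div 2))
    \<or> (2 * int s + int (i div 2) = int m + 2 * int n \<and> int m + 2 = int ((i + 1) div 2))"
    unfolding path_def m adj_odd using n s i j m by (intro sv_cross) auto
  also have "\<dots> \<longleftrightarrow> (s \<le> n - 2 \<and> i = N - 2 * s \<and> j = 2 * s - 1) \<or> (2 \<le> s \<and> i = N - 2 * s + 3 \<and> j = 2 * s - 2)
    \<or> (s = 1 \<and> odd i \<and> j = i + 1) \<or> (s = n - 1 \<and> even i \<and> i = j + 3)"
  proof -
    obtain s' where s': "s = Suc s'" using s by (cases s) auto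
    define d where "d = n - s' - 2"
    have d: "n = s' + d + 2" using s n unfolding d_def s' by simp
    have e: "N - 2 * s = 2 * d" "2 * s - 1 = 2 * s' + 1" "2 * s - 2 = 2 * s'"
      "(s \<le> n - 2) = (1 \<le> d)" "(s = n - 1) = (d = 0)" "(2 \<le> s) = (1 \<le> s')" "(s = 1) = (s' = 0)"
      unfolding d s' by auto
    have r: "m \<le> s' + d" using j unfolding m d by simp
    have n': "s' + d \<ge> 2" using n unfolding d by simp
    obtain I where I: "i = 2 * I \<or> i = 2 * I + 1" by (meson evenE oddE)
    have i': "1 \<le> i" "i \<le> 2 * s' + 2 * d + 2" using i unfolding d by auto
    show ?thesis
      using I
    proof
      assume I: "i = 2 * I"
      have "2 * I \<noteq> 2 * d + 3" "Suc (2 * m) \<noteq> 2 * s'" "2 * m \<noteq> Suc (2 * I)"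
        "2 * m \<noteq> Suc (2 * s')" "2 * I \<noteq> 2 * m + 3" by presburger+
      then show ?thesis unfolding e using i' r n' unfolding I m d s'
        by (intro iffI; elim disjE conjE; simp; presburger?)
    next
      assume I: "i = 2 * I + 1"
      have "2 * I \<noteq> 2 * d + 3" "Suc (2 * m) \<noteq> 2 * s'" "2 * m \<noteq> Suc (2 * I)"
        "2 * m \<noteq> Suc (2 * s')" "2 * I \<noteq> 2 * m + 3" by presburger+
      then show ?thesis unfolding e using i' r n' unfolding I m d s'
        by (intro iffI; elim disjE conjE; simp; presburger?)
    qed
  qed
  finally show ?thesis .
next
  case False
  then obtain m where m: "j = 2 * m" by (auto elim: evenE)
  have "path n (q - 2 * int s) i = adjv j \<longleftrightarrow>
    (2 * int s + int (i div 2) = int m + 1 \<and> int m = int ((i + 1) div 2))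
    \<or> (2 * int s + int (i div 2) = int m + 1 + int n \<and> int m = int n - int ((i + 1) div 2))
    \<or> (2 * int s + int (i div 2) = int m + 1 + 2 * int n \<and> int m = int ((i + 1) div 2))"
    unfolding path_def m adj_even diff_diff_eq[of q "int m" 1] using n s i j m by (intro sv_cross) auto
  also have "\<dots> \<longleftrightarrow> (s \<le> n - 2 \<and> i = N - 2 * s \<and> j = 2 * s - 1) \<or> (2 \<le> s \<and> i = N - 2 * s + 3 \<and> j = 2 * s - 2)
    \<or> (s = 1 \<and> odd i \<and> j = i + 1) \<or> (s = n - 1 \<and> even i \<and> i = j + 3)"
  proof -
    obtain s' where s': "s = Suc s'" using s by (cases s) auto
    define d where "d = n - s' - 2"
    have d: "n = s' + d + 2" using s n unfolding d_def s' by simp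
    have e: "N - 2 * s = 2 * d" "2 * s - 1 = 2 * s' + 1" "2 * s - 2 = 2 * s'"
      "(s \<le> n - 2) = (1 \<le> d)" "(s = n - 1) = (d = 0)" "(2 \<le> s) = (1 \<le> s')" "(s = 1) = (s' = 0)"
      unfolding d s' by auto
    have r: "m \<le> s' + d" using j unfolding m d by simp
    have n': "s' + d \<ge> 2" using n unfolding d by simp
    obtain I where I: "i = 2 * I \<or> i = 2 * I + 1" by (meson evenE oddE)
    have i': "1 \<le> i" "i \<le> 2 * s' + 2 * d + 2" using i unfolding d by auto
    show ?thesis
      using I
    proof
      assume I: "i = 2 * I"
      have "2 * I \<noteq> 2 * d + 3" "Suc (2 * m) \<noteq> 2 * s'" "2 * m \<noteq> Suc (2 * I)"
        "2 * m \<noteq> Suc (2 * s')" "2 * I \<noteq> 2 * m + 3" by presburger+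
      then show ?thesis unfolding e using i' r n' unfolding I m d s'
        by (intro iffI; elim disjE conjE; simp; presburger?)
    next
      assume I: "i = 2 * I + 1"
      have "2 * I \<noteq> 2 * d + 3" "Suc (2 * m) \<noteq> 2 * s'" "2 * m \<noteq> Suc (2 * I)"
        "2 * m \<noteq> Suc (2 * s')" "2 * I \<noteq> 2 * m + 3" by presburger+
      then show ?thesis unfolding e using i' r n' unfolding I m d s'
        by (intro iffI; elim disjE conjE; simp; presburger?)
    qed
  qed
  finally show ?thesis .
qed

end

section \<open>Brackets of telescopic sums along source paths\<close>

abbreviation X :: "exponent \<Rightarrow> laurent" where
  "X \<alpha> \<equiv> Poly_Mapping.single \<alpha> 1"

definition tele :: "(nat \<Rightarrow> vertex) \<Rightarrow> nat \<Rightarrow> laurent" where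
  "tele w N = (\<Sum>k\<le>N. X (theta w N k))"

lemma pb_X: "pb n (X \<alpha>) (X \<beta>) = Poly_Mapping.single 0 (Om n \<alpha> \<beta>) * X \<alpha> * X \<beta>"
  by (simp add: pb_single mult_single)

lemma single_of_bool: "Poly_Mapping.single 0 (of_bool P) = (of_bool P :: laurent)"
  by simp

lemma X_mult: "X \<alpha> * X \<beta> = X (\<alpha> + \<beta>)"
  by (simp add: mult_single)

lemma theta_Suc: "k < N \<Longrightarrow> theta w N k = theta w N (Suc k) + unit_exp (w (Suc k))"
proof
  fix v assume k: "k < N"
  have "theta w N k v = (\<Sum>j=1..N. sg (Suc k) j * of_bool (v = w j) + of_bool (v = w j) * of_bool (j = Suc k \<and> True))"
    unfolding comb_def by (intro sum.cong) (auto simp: sg_def)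
  also have "\<dots> = theta w N (Suc k) v + of_bool (v = w (Suc k))"
    unfolding sum.distrib sum_of_bool_eq[OF finite_atLeastAtMost] using k by (simp add: comb_def)
  finally show "theta w N k v = (theta w N (Suc k) + unit_exp (w (Suc k))) v" by simp
qed

lemma theta_ends: "theta w N 0 + theta w N N = 0"
  by (simp add: fun_eq_iff comb_def sum.distrib[symmetric]) (auto simp: sg_def intro!: sum.neutral)

lemma X_theta_Suc: "k < N \<Longrightarrow> X (theta w N k) = X (theta w N (Suc k)) * X (unit_exp (w (Suc k)))"
  unfolding X_mult by (subst theta_Suc) auto

lemma X_theta_ends: "X (theta w N 0) * X (theta w N N) = 1"
  unfolding X_mult theta_ends by simp

context zigzag
begin

text \<open>Only four consecutive vertices of the shifted path, of types \<open>b, a, a, b\<close>,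
  interact with the reference path. Their contributions combine into differences of coefficients two
  places apart, and these are indicators of two adjacent cuts.\<close>

lemma Om_cross_far:
  assumes s: "2 \<le> s" "s \<le> n - 2"
  shows "Om n (theta (path n (q - 2 * int s)) N k') (theta pth N k) =
    of_bool (k \<in> {2 * s - 1, 2 * s}) * of_bool (k' \<in> {N - 2 * s, N - 2 * s + 1})
    - of_bool (k \<in> {2 * s - 2, 2 * s - 1}) * of_bool (k' \<in> {N - 2 * s + 1, N - 2 * s + 2})"
proof -
  define w where "w = path n (q - 2 * int s)"
  define c where "c = N - 2 * s"
  have c: "2 \<le> c" "c + 4 \<le> N" using s by (auto simp: c_def)
  have s': "1 \<le> s" "s \<le> n - 1" using s by auto
  define f where "f i = (if i = c then sg k (2 * s - 1) - sg k (2 * s + 1)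
      else if i = c + 1 then sg k (2 * s) - sg k (2 * s - 2)
      else if i = c + 2 then sg k (2 * s + 1) - sg k (2 * s - 1)
      else if i = c + 3 then sg k (2 * s - 2) - sg k (2 * s) else 0)" for i
  have f: "Om n (unit_exp (w i)) (theta pth N k) = f i" if i: "i \<in> {1..N}" for i
  proof -
    have i': "1 \<le> i" "i \<le> N" using i by auto
    note P = path_eq_pth[OF s' i', folded w_def c_def]
    note A = path_eq_adjv[OF s' i', folded w_def c_def]
    consider "i = c" | "i = c + 1" | "i = c + 2" | "i = c + 3" | "i \<notin> {c..c + 3}" by fastforce
    then show ?thesis
    proof cases
      case 1
      then have "w i = adjv (2 * s - 1)" using A[of "2 * s - 1"] s n by auto
      then show ?thesis using 1 s Om_adjv[of "2 * s - 1" "sg k"] by (simp add: f_def)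
    next
      case 2
      then have "w i = pth (2 * s - 1)" using P[of "2 * s - 1"] s n by auto
      moreover have "1 \<le> 2 * s - 1" "2 * s - 1 < N" "2 * s - 1 \<noteq> 1" "2 * s - 1 \<le> N"
        "2 * s - 1 + 1 = 2 * s" "2 * s - 1 - 1 = 2 * s - 2" using s by auto
      ultimately show ?thesis using 2 by (simp only: Om_pth f_def if_True if_False) simp
    next
      case 3
      then have "w i = pth (2 * s)" using P[of "2 * s"] s n by auto
      moreover have "1 \<le> 2 * s" "2 * s < N" "2 * s \<noteq> 1" "2 * s \<le> N" using s by auto
      ultimately show ?thesis using 3 by (simp only: Om_pth f_def if_True if_False) simp
    next
      case 4
      then have "w i = adjv (2 * s - 2)" using A[of "2 * s - 2"] s n by auto
      moreover have "1 \<le> 2 * s - 2" "2 * s - 2 \<le> N - 2" "2 * s - 2 + 2 = 2 * s" using s by auto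
      ultimately show ?thesis using 4 by (simp only: Om_adjv f_def if_True if_False) simp
    next
      case 5
      have "w i \<noteq> pth j" if "j \<in> {1..N}" for j using P[of j] 5 that by auto
      then have "w i \<notin> pth ` {1..N}" by blast
      moreover have "w i \<noteq> adjv j" if "j \<in> {1..N - 2}" for j using A[of j] 5 that s by auto
      then have "w i \<notin> adjv ` {1..N - 2}" by blast
      moreover have "w i \<in> strip n" unfolding w_def using i' by (rule path_in_strip)
      ultimately have "Om n (unit_exp (w i)) (theta pth N k) = 0" by (intro Om_other)
      then show ?thesis using 5 by (auto simp: f_def)
    qed
  qed
  have "Om n (theta w N k') (theta pth N k) = (\<Sum>i=1..N. sg k' i * f i)"
    unfolding Om_comb_left by (intro sum.cong) (auto simp: f)
  also have "\<dots> = (\<Sum>i\<in>{c, c + 1, c + 2, c + 3}. sg k' i * f i)"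
    using c by (intro sum.mono_neutral_right) (auto simp: f_def)
  also have "\<dots> = sg k' c * f c + sg k' (c + 1) * f (c + 1) + sg k' (c + 2) * f (c + 2) + sg k' (c + 3) * f (c + 3)"
    by simp
  also have "\<dots> = (sg k (2 * s + 1) - sg k (2 * s - 1)) * (sg k' (c + 2) - sg k' c)
      - (sg k (2 * s) - sg k (2 * s - 2)) * (sg k' (c + 3) - sg k' (c + 1))"
    by (simp add: f_def algebra_simps)
  also have "sg k (2 * s + 1) - sg k (2 * s - 1) = of_bool (k \<in> {2 * s - 1, 2 * s})"
    using s by (auto simp: sg_def)
  also have "sg k (2 * s) - sg k (2 * s - 2) = of_bool (k \<in> {2 * s - 2, 2 * s - 1})"
    using s by (auto simp: sg_def)
  also have "sg k' (c + 2) - sg k' c = of_bool (k' \<in> {c, c + 1})"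
    by (auto simp: sg_def)
  also have "sg k' (c + 3) - sg k' (c + 1) = of_bool (k' \<in> {c + 1, c + 2})"
    by (auto simp: sg_def)
  finally show ?thesis by (simp only: w_def c_def)
qed

text \<open>The double sum collapses to a difference of two products of two-term sums. Removing the
  two shared variables \<open>U\<close> and \<open>V\<close> from the monomials shows that the
  products coincide.\<close>

lemma pb_far:
  assumes s: "2 \<le> s" "s \<le> n - 2"
  shows "pb n (tele (path n (q - 2 * int s)) N) (tele pth N) = 0"
proof -
  define w where "w = path n (q - 2 * int s)"
  define c where "c = N - 2 * s"
  define Y where "Y k = X (theta w N k)" for k
  define A where "A k = X (theta pth N k)" for k
  have c: "2 \<le> c" "c + 4 \<le> N" using s by (auto simp: c_def)
  have s': "1 \<le> s" "s \<le> n - 1" using s by auto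
  have pair: "(\<Sum>k\<le>N. of_bool (k \<in> {a, a + 1}) * Z k) = Z a + Z (a + 1)" if "a < N" for Z :: "nat \<Rightarrow> laurent" and a
  proof -
    have "(\<Sum>k\<le>N. of_bool (k \<in> {a, a + 1}) * Z k) = (\<Sum>k\<in>{a, a + 1}. Z k)"
      using that by (intro sum.mono_neutral_cong_right) auto
    then show ?thesis by simp
  qed
  have "pb n (Y k') (A k) = (of_bool (k' \<in> {c, c + 1}) * Y k') * (of_bool (k \<in> {2 * s - 1, 2 * s - 1 + 1}) * A k)
      - (of_bool (k' \<in> {c + 1, c + 1 + 1}) * Y k') * (of_bool (k \<in> {2 * s - 2, 2 * s - 2 + 1}) * A k)" for k k'
  proof -
    have e: "2 * s - 1 + 1 = 2 * s" "2 * s - 2 + 1 = 2 * s - 1" "c + 1 + 1 = c + 2" using s by auto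
    show ?thesis
      unfolding Y_def A_def pb_X w_def Om_cross_far[OF s] c_def[symmetric] e
      by (auto simp: single_diff algebra_simps)
  qed
  then have "pb n (tele w N) (tele pth N)
    = (\<Sum>k'\<le>N. \<Sum>k\<le>N. (of_bool (k' \<in> {c, c + 1}) * Y k') * (of_bool (k \<in> {2 * s - 1, 2 * s - 1 + 1}) * A k)
      - (of_bool (k' \<in> {c + 1, c + 1 + 1}) * Y k') * (of_bool (k \<in> {2 * s - 2, 2 * s - 2 + 1}) * A k))"
    unfolding tele_def laurent.br_sum_left unfolding laurent.br_sum_right
    by (simp only: Y_def A_def)
  also have "\<dots> = (Y c + Y (c + 1)) * (A (2 * s - 1) + A (2 * s - 1 + 1))
      - (Y (c + 1) + Y (c + 1 + 1)) * (A (2 * s - 2) + A (2 * s - 2 + 1))"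
    unfolding sum_subtractf sum_product[symmetric] using c s by (subst (1 2 3 4) pair) auto
  also have "\<dots> = 0"
  proof -
    have w: "w (Suc c) = pth (2 * s - 1)" "w (Suc (Suc c)) = pth (2 * s)"
      using path_eq_pth[OF s', of "c + 1" "2 * s - 1"] path_eq_pth[OF s', of "c + 2" "2 * s"] c s
      unfolding w_def c_def by auto
    define U where "U = X (unit_exp (pth (2 * s - 1)))"
    define V where "V = X (unit_exp (pth (2 * s)))"
    have e: "2 * s - 1 = Suc (2 * s - 2)" "2 * s = Suc (Suc (2 * s - 2))" using s by auto
    have "Y c = Y (Suc c) * U" "Y (Suc c) = Y (Suc (Suc c)) * V"
      unfolding Y_def U_def V_def w[symmetric] using c by (auto intro: X_theta_Suc)
    moreover have "A (2 * s - 2) = A (Suc (2 * s - 2)) * U"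
      unfolding A_def U_def e(1) using s by (intro X_theta_Suc) auto
    moreover have "A (Suc (2 * s - 2)) = A (Suc (Suc (2 * s - 2))) * V"
      unfolding A_def V_def e(2)[symmetric] e(1)[symmetric] using s X_theta_Suc[of "2 * s - 1" N pth] by auto
    ultimately show ?thesis
      using e by (simp add: algebra_simps)
  qed
  finally show ?thesis by (simp only: w_def)
qed

end

lemma half_cond:
  fixes k M :: nat
  assumes "k \<le> 2 * M" "2 \<le> M"
  shows "(if k \<le> 1 then 2 * M - 2 < 2 * M - 1 else 2 * (k div 2) - 1 \<le> 2 * M - 2) = (k \<noteq> 2 * M)"
proof -
  have "2 * (k div 2) - 1 \<le> 2 * M - 2 \<longleftrightarrow> k \<noteq> 2 * M" using assms by presburger
  then show ?thesis using assms by auto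
qed

lemma mirror_cond:
  fixes k k' M :: nat
  assumes k: "k \<le> 2 * M" "k' \<le> 2 * M" "2 \<le> M"
  shows "(if 2 * M - k' \<le> 1 then 2 * M - k < 2 * M - 1 else 2 * ((2 * M - k') div 2) - 1 \<le> 2 * M - k)
    = (if k \<le> 1 then k' < 2 * M - 1 else 2 * (k div 2) - 1 \<le> k')"
proof -
  have *: "(2 * (a div 2) - 1 \<le> b) = (a div 2 \<le> (b + 1) div 2)" for a b :: nat by presburger
  have d: "(2 * M - k') div 2 = M - (k' + 1) div 2" "(2 * M - k + 1) div 2 = M - k div 2"
    using k by presburger+
  define a where "a = k div 2"
  define b where "b = (k' + 1) div 2"
  have "(k \<le> 1) = (a = 0)" "(k' < 2 * M - 1) = (b < M)" "(2 * M - k < 2 * M - 1) = (a \<noteq> 0)"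
    "(2 * M - k' \<le> 1) = (\<not> b < M)" "a \<le> M"
    using k unfolding a_def b_def by presburger+
  then show ?thesis
    unfolding * unfolding d a_def[symmetric] b_def[symmetric] by auto
qed

context zigzag
begin

text \<open>The odd vertices of the preceding path, up to the shared pair, are neighbours
  \<open>b\<close> of the reference path. Of these a cut at \<open>k\<close> with
  \<open>2 \<le> k < N\<close> is seen only by the vertex at position
  \<open>2 * (k div 2) - 1\<close>; the remaining terms come from \<open>b_1\<close> and the shared
  vertices \<open>a_1\<close>, \<open>a_2\<close>.\<close>

lemma Om_cross_near:
  assumes k: "k \<le> N"
  shows "Om n (theta (path n (q - 2)) N k') (theta pth N k) =
    of_bool (k \<in> {1, 2}) * of_bool (k' \<in> {N - 2, N - 1})
    + (if k \<le> 1 then sg k' (N - 1) else - sg k' (2 * (k div 2) - 1))"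
proof -
  define w where "w = path n (q - 2)"
  have s': "1 \<le> (1::nat)" "1 \<le> n - 1" using n by auto
  define f where "f i = - of_bool (i = 2 * (k div 2) - 1 \<and> 2 \<le> k \<and> k < N)
      + (sg k 1 - sg k 3) * of_bool (i = N - 2 \<and> True) + (sg k 2 + sg k N) * of_bool (i = N - 1 \<and> True)
      + (sg k 3 - sg k 1) * of_bool (i = N \<and> True)" for i
  have f: "Om n (unit_exp (w i)) (theta pth N k) = f i" if i: "i \<in> {1..N}" for i
  proof -
    have i': "1 \<le> i" "i \<le> N" using i by auto
    have P: "w i = pth j \<longleftrightarrow> (i = N - 1 \<and> j = 1) \<or> (i = N \<and> j = 2)" if "1 \<le> j" "j \<le> N" for j
    proof -
      have "N - 2 * 1 + 1 = N - 1" "N - 2 * 1 + 2 = N" "2 * 1 - 1 = (1::nat)" "2 * 1 = (2::nat)" using n by auto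
      then show ?thesis using path_eq_pth[OF s' i' that] by (simp only: w_def of_nat_1 mult_1_right)
    qed
    have A: "w i = adjv j \<longleftrightarrow> (i = N - 2 \<and> j = 1) \<or> (odd i \<and> j = i + 1)" if "1 \<le> j" "j \<le> N - 2" for j
    proof -
      have "N - 2 * 1 = N - 2" "2 * 1 - 1 = (1::nat)" "2 * 1 = (2::nat)" "1 \<le> n - 2" "\<not> 2 \<le> (1::nat)"
        "1 \<noteq> n - 1" using n by auto
      then show ?thesis using path_eq_adjv[OF s' i' that] by (simp only: w_def of_nat_1 mult_1_right) blast
    qed
    have odd_k: "2 \<le> k \<Longrightarrow> odd (2 * (k div 2) - 1)" by presburger
    have small_k: "2 * (k div 2) - 1 < N - 1" if "k < N"
    proof -
      have "2 * (k div 2) \<le> k" by simp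
      then show ?thesis using that n by simp
    qed
    have even_N: "even N" "even (N - 2)" using n by auto
    have "i = N - 2 \<or> i = N - 1 \<or> i = N \<or> odd i \<and> i \<le> N - 3 \<or> even i \<and> i \<le> N - 4"
    proof -
      have "odd (N - 3)" using n by auto
      moreover have "i \<le> N - 4 \<or> i = N - 3 \<or> i = N - 2 \<or> i = N - 1 \<or> i = N"
      proof -
        obtain d where d: "N = i + d" using i' le_Suc_ex by blast
        then show ?thesis by (cases "d < 4") auto
      qed
      moreover have "i \<le> N - 4 \<Longrightarrow> i \<le> N - 3" by linarith
      ultimately show ?thesis by blast
    qed
    then consider "i = N - 2" | "i = N - 1" | "i = N" | "odd i" "i \<le> N - 3" | "even i" "i \<le> N - 4"
      by blast
    then show ?thesis
    proof cases
      case 1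
      then have wi: "w i = adjv 1" using A[of 1] n by auto
      have a: "i \<noteq> 2 * (k div 2) - 1 \<or> \<not> (2 \<le> k \<and> k < N)" using 1 odd_k even_N by metis
      have o: "Om n (unit_exp (adjv 1)) (theta pth N k) = sg k 1 - sg k 3"
        using n by (subst Om_adjv) (simp_all add: numeral_3_eq_3)
      have b: "i \<noteq> N - 1" "i \<noteq> N" using 1 n by auto
      have h: "(i = 2 * (k div 2) - 1 \<and> 2 \<le> k \<and> k < N) = False" "(i = N - 2 \<and> True) = True"
          "(i = N - 1 \<and> True) = False" "(i = N \<and> True) = False"
        using a b 1 by blast+
      show ?thesis unfolding f_def h wi o by simp
    next
      case 2
      then have wi: "w i = pth 1" using P[of 1] n by auto
      have a: "i \<noteq> 2 * (k div 2) - 1 \<or> \<not> (2 \<le> k \<and> k < N)" using 2 small_k by auto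
      have o: "Om n (unit_exp (pth 1)) (theta pth N k) = sg k 2 + sg k N"
      proof -
        have "1 \<le> N" "1 < N" using n by auto
        then show ?thesis by (simp only: Om_pth if_True one_add_one) simp
      qed
      have b: "i \<noteq> N - 2" "i \<noteq> N" using 2 n by auto
      have h: "(i = 2 * (k div 2) - 1 \<and> 2 \<le> k \<and> k < N) = False" "(i = N - 2 \<and> True) = False"
          "(i = N - 1 \<and> True) = True" "(i = N \<and> True) = False"
        using a b 2 by blast+
      show ?thesis unfolding f_def h wi o by simp
    next
      case 3
      then have wi: "w i = pth 2" using P[of 2] n by auto
      have a: "i \<noteq> 2 * (k div 2) - 1 \<or> \<not> (2 \<le> k \<and> k < N)" using 3 odd_k even_N by metis
      have o: "Om n (unit_exp (pth 2)) (theta pth N k) = sg k 3 - sg k 1"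
      proof -
        have "(1::nat) \<le> 2" "2 \<le> N" "2 < N" using n by auto
        then show ?thesis by (simp only: Om_pth if_True) simp
      qed
      have b: "i \<noteq> N - 2" "i \<noteq> N - 1" using 3 n by auto
      have h: "(i = 2 * (k div 2) - 1 \<and> 2 \<le> k \<and> k < N) = False" "(i = N - 2 \<and> True) = False"
          "(i = N - 1 \<and> True) = False" "(i = N \<and> True) = True"
        using a b 3 by blast+
      show ?thesis unfolding f_def h wi o by simp
    next
      case 4
      then have "w i = adjv (i + 1)" using A[of "i + 1"] i' n by auto
      then have "Om n (unit_exp (w i)) (theta pth N k) = sg k (i + 1) - sg k (i + 1 + 2)"
        using Om_adjv[of "i + 1" "sg k"] 4 n by auto
      also have "\<dots> = - of_bool (i = 2 * (k div 2) - 1 \<and> 2 \<le> k \<and> k < N)"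
      proof -
        have "(i = 2 * (k div 2) - 1 \<and> 2 \<le> k) = (i + 1 \<le> k \<and> k < i + 3)"
          using 4(1) by presburger
        moreover have "k < i + 3 \<Longrightarrow> k < N" using 4(2) n by simp
        ultimately have "(i = 2 * (k div 2) - 1 \<and> 2 \<le> k \<and> k < N) = (i + 1 \<le> k \<and> k < i + 3)"
          by blast
        then show ?thesis by (auto simp: sg_def)
      qed
      also have "\<dots> = f i" using 4 n by (auto simp: f_def)
      finally show ?thesis .
    next
      case 5
      have b: "i \<noteq> N - 2" "i \<noteq> N - 1" "i \<noteq> N" using 5(2) n by auto
      have "w i \<noteq> pth j" if "j \<in> {1..N}" for j using P[of j] b that by auto
      then have "w i \<notin> pth ` {1..N}" by blast
      moreover have "w i \<noteq> adjv j" if "j \<in> {1..N - 2}" for j using A[of j] 5(1) b that by auto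
      then have "w i \<notin> adjv ` {1..N - 2}" by blast
      moreover have "w i \<in> strip n" unfolding w_def using i' by (rule path_in_strip)
      ultimately have "Om n (unit_exp (w i)) (theta pth N k) = 0" by (intro Om_other)
      moreover have "i \<noteq> 2 * (k div 2) - 1 \<or> \<not> 2 \<le> k" using 5 odd_k by metis
      ultimately show ?thesis using b by (auto simp: f_def)
    qed
  qed
  have "Om n (theta w N k') (theta pth N k) = (\<Sum>i=1..N. sg k' i * f i)"
    unfolding Om_comb_left by (intro sum.cong) (auto simp: f)
  also have "\<dots> = - (\<Sum>i=1..N. sg k' i * of_bool (i = 2 * (k div 2) - 1 \<and> 2 \<le> k \<and> k < N))
      + (sg k 1 - sg k 3) * (\<Sum>i=1..N. sg k' i * of_bool (i = N - 2 \<and> True))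
      + (sg k 2 + sg k N) * (\<Sum>i=1..N. sg k' i * of_bool (i = N - 1 \<and> True))
      + (sg k 3 - sg k 1) * (\<Sum>i=1..N. sg k' i * of_bool (i = N \<and> True))"
    unfolding sum_distrib_left sum_negf[symmetric] sum.distrib[symmetric]
    by (intro sum.cong) (simp_all only: f_def algebra_simps)
  also have "\<dots> = - of_bool (2 * (k div 2) - 1 \<in> {1..N} \<and> 2 \<le> k \<and> k < N) * sg k' (2 * (k div 2) - 1)
     + (sg k 1 - sg k 3) * sg k' (N - 2) + (sg k 2 + sg k N) * sg k' (N - 1) + (sg k 3 - sg k 1) * sg k' N"
  proof -
    have "(N - 2 \<in> {1..N} \<and> True) = True" "(N - 1 \<in> {1..N} \<and> True) = True" "(N \<in> {1..N} \<and> True) = True"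
      using n by auto
    then show ?thesis unfolding sum_of_bool_eq[OF finite_atLeastAtMost] by (simp only: of_bool_eq mult_1_left mult_minus_left)
  qed
  also have "(2 * (k div 2) - 1 \<in> {1..N} \<and> 2 \<le> k \<and> k < N) = (2 \<le> k \<and> k < N)"
  proof -
    have "2 \<le> k \<Longrightarrow> 1 \<le> 2 * (k div 2) - 1" by presburger
    moreover have "2 * (k div 2) - 1 \<le> k" by simp
    ultimately show ?thesis by auto
  qed
  also have "- of_bool (2 \<le> k \<and> k < N) * sg k' (2 * (k div 2) - 1)
     + (sg k 1 - sg k 3) * sg k' (N - 2) + (sg k 2 + sg k N) * sg k' (N - 1) + (sg k 3 - sg k 1) * sg k' N
    = - of_bool (2 \<le> k \<and> k < N) * sg k' (2 * (k div 2) - 1) + (sg k 2 + sg k N) * sg k' (N - 1)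
      + (sg k 3 - sg k 1) * (sg k' N - sg k' (N - 2))"
    by (simp add: algebra_simps)
  also have "sg k 3 - sg k 1 = of_bool (k \<in> {1, 2})" by (auto simp: sg_def)
  also have "sg k' N - sg k' (N - 2) = of_bool (k' \<in> {N - 2, N - 1})" using n by (auto simp: sg_def)
  also have "sg k 2 + sg k N = of_bool (k \<le> 1) - of_bool (k = N)" using k n by (auto simp: sg_def)
  also have "- of_bool (2 \<le> k \<and> k < N) * sg k' (2 * (k div 2) - 1) + (of_bool (k \<le> 1) - of_bool (k = N)) * sg k' (N - 1)
      = (if k \<le> 1 then sg k' (N - 1) else - sg k' (2 * (k div 2) - 1))"
  proof -
    have "2 * (N div 2) - 1 = N - 1" by presburger
    then show ?thesis using k n by (cases "k \<le> 1"; cases "k = N") auto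
  qed
  finally show ?thesis by (simp only: w_def add.commute)
qed

text \<open>Arranged by the hypotheses \<open>low\<close>, \<open>top2\<close>, \<open>top1\<close>
  and \<open>top0\<close> of \<open>adjacent_brackets\<close>; the uniform description in
  \<open>near_sign_alt\<close> is the one that comes out of \<open>Om_cross_near\<close> and
  exhibits the symmetry.\<close>

definition near_sign :: "nat \<Rightarrow> nat \<Rightarrow> laurent" where
  "near_sign k' k = (if k' < N - 2 then if k \<le> 2 * ((k' + 1) div 2) + 1 then half else - half
    else if k' = N - 2 then (if k = N then - half else half) + of_bool (k \<in> {1, 2})
    else if k' = N - 1 then (if k \<le> 1 then - half else half) + of_bool (k \<in> {1, 2})
    else if k \<le> 1 then - half else half)"

lemma near_sign_alt:
  assumes k: "k \<le> N" "k' \<le> N"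
  shows "near_sign k' k = of_bool (k \<in> {1, 2} \<and> k' \<in> {N - 2, N - 1})
     + (if (if k \<le> 1 then k' < N - 1 else 2 * (k div 2) - 1 \<le> k') then half else - half)"
proof -
  consider "k' < N - 2" | "k' = N - 2" | "k' = N - 1" | "k' = N" using k by linarith
  then show ?thesis
  proof cases
    case 1
    have c: "(if k \<le> 1 then k' < N - 1 else 2 * (k div 2) - 1 \<le> k') = (k \<le> 2 * ((k' + 1) div 2) + 1)"
    proof -
      have "2 * (k div 2) - 1 \<le> k' \<longleftrightarrow> k \<le> 2 * ((k' + 1) div 2) + 1" by presburger
      then show ?thesis using 1 by auto
    qed
    have h: "(k' < N - 2) = True" "(k' \<in> {N - 2, N - 1}) = False" using 1 by auto
    show ?thesis unfolding near_sign_def c h by simp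
  next
    case 2
    have c: "(if k \<le> 1 then k' < N - 1 else 2 * (k div 2) - 1 \<le> k') = (k \<noteq> N)"
      unfolding 2 using half_cond[of k "n - 1"] n k by (simp only: diff_mult_distrib2 mult_1_right)
    have h: "(k' < N - 2) = False" "(k' = N - 2) = True" "(k' \<in> {N - 2, N - 1}) = True" using 2 by auto
    show ?thesis unfolding near_sign_def c h by simp
  next
    case 3
    have c: "(if k \<le> 1 then k' < N - 1 else 2 * (k div 2) - 1 \<le> k') = (\<not> k \<le> 1)"
      using 3 n k by auto
    have h: "(k' < N - 2) = False" "(k' = N - 2) = False" "(k' = N - 1) = True" "(k' \<in> {N - 2, N - 1}) = True"
      using 3 n by auto
    show ?thesis unfolding near_sign_def c h by simp
  next
    case 4
    have c: "(if k \<le> 1 then k' < N - 1 else 2 * (k div 2) - 1 \<le> k') = (\<not> k \<le> 1)"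
      using 4 n k by auto
    have h: "(k' < N - 2) = False" "(k' = N - 2) = False" "(k' = N - 1) = False" "(k' \<in> {N - 2, N - 1}) = False"
      using 4 n by auto
    show ?thesis unfolding near_sign_def c h by simp
  qed
qed

text \<open>Reversal of both paths, with the two sums exchanging roles, preserves the coefficients.
  This lets the preceding path play the part of \<open>A\<close> in
  \<open>adjacent_brackets\<close>.\<close>

lemma near_sign_mirror:
  assumes "k \<le> N" "k' \<le> N"
  shows "near_sign (N - k) (N - k') = near_sign k' k"
proof -
  have "(N - k' \<in> {1, 2} \<and> N - k \<in> {N - 2, N - 1}) = (k \<in> {1, 2} \<and> k' \<in> {N - 2, N - 1})"
    using assms n by auto
  moreover have "(if N - k' \<le> 1 then N - k < N - 1 else 2 * ((N - k') div 2) - 1 \<le> N - k)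
      = (if k \<le> 1 then k' < N - 1 else 2 * (k div 2) - 1 \<le> k')"
    using mirror_cond[of k "n - 1" k'] assms n by (simp only: diff_mult_distrib2 mult_1_right)
  ultimately show ?thesis
    unfolding near_sign_alt[OF assms] by (subst near_sign_alt) simp_all
qed

lemma Om_cross_near_sign:
  assumes k: "k \<le> N" "k' \<le> N"
  shows "Poly_Mapping.single 0 (Om n (theta (path n (q - 2)) N k') (theta pth N k)) = near_sign k' k"
proof -
  have hm: "Poly_Mapping.single 0 (- (1 / 2) :: real) = - half"
    using single_uminus[of 0 "1 / 2 :: real"] by (simp add: half_def)
  have S: "Poly_Mapping.single 0 (of_bool P + (if R then 1 / 2 else - (1 / 2) :: real))
     = of_bool P + (if R then half else - half)" for P R
    unfolding single_add by (simp add: hm half_def[symmetric] single_of_bool)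
  have "of_bool (k \<in> {1, 2}) * of_bool (k' \<in> {N - 2, N - 1})
      + (if k \<le> 1 then sg k' (N - 1) else - sg k' (2 * (k div 2) - 1))
    = of_bool (k \<in> {1, 2} \<and> k' \<in> {N - 2, N - 1})
      + (if (if k \<le> 1 then k' < N - 1 else 2 * (k div 2) - 1 \<le> k') then 1 / 2 else - (1 / 2))"
    unfolding of_bool_conj by (auto simp: sg_def)
  then show ?thesis
    unfolding Om_cross_near[OF k(1)] near_sign_alt[OF k] by (simp only: S)
qed

lemma pb_near_terms:
  assumes "k \<le> N" "k' \<le> N"
  shows "pb n (X (theta (path n (q - 2)) N k')) (X (theta pth N k))
    = near_sign k' k * X (theta (path n (q - 2)) N k') * X (theta pth N k)"
  unfolding pb_X Om_cross_near_sign[OF assms] ..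

lemma pb_theta:
  assumes "j < k" "k \<le> N"
  shows "pb n (X (theta pth N j)) (X (theta pth N k)) = (if j = 0 \<and> k = N then 0 else X (theta pth N j) * X (theta pth N k))"
  unfolding pb_X Om_theta[OF assms] by simp

text \<open>The expansion into monomials of \<open>half * P * G - {P, G}\<close>, that is of
  \<open>G_(i-1,i) G_(i,i+1) - G_(i-1,i+1)\<close>, the value which the braid group assigns to
  \<open>G_(i-1,i)\<close>.\<close>

definition near_product :: laurent where
  "near_product = (\<Sum>j<N - 2. X (theta (path n (q - 2)) N j) * (\<Sum>k = 2 * ((j + 1) div 2) + 2..N. X (theta pth N k)))
    + X (theta (path n (q - 2)) N (N - 2)) * X (theta pth N N)"

text \<open>All four follow by removing the shared variables at \<open>pth 1\<close> and
  \<open>pth 2\<close>, since the extreme monomials of each sum are reciprocal.\<close>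

lemma near_ratios:
  defines "Y \<equiv> \<lambda>k. X (theta (path n (q - 2)) N k)" and "A \<equiv> \<lambda>k. X (theta pth N k)"
  shows "Y (N - 1) = Y (N - 2) * A 1 * A N" "Y N = Y (N - 2) * A 2 * A N"
    "A 1 = A 2 * Y 0 * Y (N - 1)" "A 0 = A 2 * Y 0 * Y (N - 2)"
proof -
  have s: "1 \<le> (1::nat)" "1 \<le> n - 1" using n by auto
  define U where "U = X (unit_exp (pth 1))"
  define V where "V = X (unit_exp (pth 2))"
  have w: "path n (q - 2) (N - 1) = pth 1" "path n (q - 2) N = pth 2"
    using path_eq_pth[OF s, of "N - 1" 1] path_eq_pth[OF s, of N 2] n by simp_all
  have 1: "A 0 = A 1 * U" "A 1 = A 2 * V"
    using X_theta_Suc[of 0 N pth] X_theta_Suc[of 1 N pth] n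
    unfolding A_def U_def V_def by (simp_all add: numeral_2_eq_2)
  have e: "Suc (N - 2) = N - 1" "Suc (N - 1) = N" using n by auto
  have 2: "Y (N - 2) = Y (N - 1) * U" "Y (N - 1) = Y N * V"
    using X_theta_Suc[of "N - 2" N "path n (q - 2)"] X_theta_Suc[of "N - 1" N "path n (q - 2)"] n
    unfolding Y_def U_def V_def by (simp_all only: e w)
  have 3: "A 0 * A N = 1" "Y 0 * Y N = 1"
    unfolding A_def Y_def by (rule X_theta_ends)+
  have "Y (N - 2) * A 1 * A N = Y (N - 1) * (A 0 * A N)"
    unfolding 1(1) 2(1) by (simp only: mult_ac)
  then show "Y (N - 1) = Y (N - 2) * A 1 * A N" using 3 by simp
  have "Y (N - 2) * A 2 * A N = Y N * (A 0 * A N)"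
    unfolding 1 2 by (simp only: mult_ac)
  then show "Y N = Y (N - 2) * A 2 * A N" using 3 by simp
  have "A 2 * Y 0 * Y (N - 1) = A 1 * (Y 0 * Y N)"
    unfolding 1 2 by (simp only: mult_ac)
  then show "A 1 = A 2 * Y 0 * Y (N - 1)" using 3 by simp
  have "A 2 * Y 0 * Y (N - 2) = A 0 * (Y 0 * Y N)"
    unfolding 1 2 by (simp only: mult_ac)
  then show "A 0 = A 2 * Y 0 * Y (N - 2)" using 3 by simp
qed

lemma pb_near:
  defines "P \<equiv> tele (path n (q - 2)) N" and "G \<equiv> tele pth N"
  shows "half * P * G - pb n P G = near_product"
    and "pb n (pb n P G) G = half * half * P * G * G - P"
proof -
  define Y where "Y k = X (theta (path n (q - 2)) N k)" for k
  define A where "A k = X (theta pth N k)" for k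
  have t: "pb n (Y k') (A k) = near_sign k' k * Y k' * A k" if "k \<le> N" "k' \<le> N" for k k'
    unfolding Y_def A_def using pb_near_terms that by blast
  note * = laurent.adjacent_brackets[of N n A Y]
  have h: "even N" "4 \<le> N" using n by auto
  have "pb n (A 0) (A N) = 0" unfolding A_def using n by (subst pb_theta) auto
  note prems = h _ this X_theta_ends[of pth N, folded A_def] near_ratios(1,2)[folded Y_def A_def]
  have PG: "P = (\<Sum>k\<le>N. Y k)" "G = (\<Sum>k\<le>N. A k)"
    by (simp_all add: P_def G_def tele_def Y_def A_def)
  show "half * P * G - pb n P G = near_product"
    unfolding near_product_def PG Y_def[symmetric] A_def[symmetric]
    by (rule *(1)[OF prems]) (use n pb_theta in \<open>auto simp: t near_sign_def A_def[symmetric]\<close>)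
  show "pb n (pb n P G) G = half * half * P * G * G - P"
    unfolding PG
    by (rule *(2)[OF prems]) (use n pb_theta in \<open>auto simp: t near_sign_def A_def[symmetric]\<close>)
qed

end

context zigzag
begin

lemma tele_reverse: "tele w M = (\<Sum>k\<le>M. X (theta w M (M - k)))"
proof -
  have "(\<Sum>k\<le>M. X (theta w M k)) = (\<Sum>k\<le>M. X (theta w M (M - k)))"
    by (rule sum.reindex_bij_witness[of _ "\<lambda>k. M - k" "\<lambda>k. M - k"]) auto
  then show ?thesis by (simp only: tele_def)
qed

lemma zigzag_prev: "zigzag n (q - 2)"
  using n q by unfold_locales auto

text \<open>An instance of \<open>adjacent_brackets\<close> for the opposite bracket, with both sums
  written in reverse order and interchanged.\<close>

lemma pb_near_mirror:
  defines "P \<equiv> tele (path n (q - 2)) N" and "G \<equiv> tele pth N"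
  shows "half * P * G - pb n P G
      = (\<Sum>j<N - 2. X (theta pth N (N - j)) * (\<Sum>k = 2 * ((j + 1) div 2) + 2..N. X (theta (path n (q - 2)) N (N - k))))
        + X (theta pth N 2) * X (theta (path n (q - 2)) N 0)"
    and "pb n P (pb n P G) = half * half * P * P * G - G"
proof -
  define Y where "Y k = X (theta pth N (N - k))" for k
  define A where "A k = X (theta (path n (q - 2)) N (N - k))" for k
  interpret prev: zigzag n "q - 2" by (rule zigzag_prev)
  have t: "pb n (A k) (Y j) = near_sign j k * Y j * A k" if "k \<le> N" "j \<le> N" for j k
    unfolding Y_def A_def using pb_near_terms[of "N - j" "N - k"] near_sign_mirror[OF that] by (simp add: mult_ac)
  have a: "pb n (A k) (A j) = (if j = 0 \<and> k = N then 0 else A j * A k)" if "j < k" "k \<le> N" for j k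
    unfolding A_def using prev.pb_theta[of "N - k" "N - j"] that by (auto simp: mult.commute)
  note * = poisson_ring.adjacent_brackets[OF laurent.opposite[of n], of N A Y]
  have h: "even N" "4 \<le> N" using n by auto
  have e: "N - (N - 2) = 2" "N - (N - 1) = 1" "N - N = 0" using n by auto
  have 1: "pb n (A N) (A 0) = 0" using n by (subst a) auto
  have 2: "A 0 * A N = 1"
    unfolding A_def using X_theta_ends[of "path n (q - 2)" N] by (simp add: mult.commute)
  have 3: "Y (N - 1) = Y (N - 2) * A 1 * A N" "Y N = Y (N - 2) * A 2 * A N"
    unfolding Y_def A_def e using near_ratios(3,4) by (simp_all only: diff_zero mult_ac)
  note prems = h _ 1 2 3
  have PG: "P = (\<Sum>k\<le>N. A k)" "G = (\<Sum>k\<le>N. Y k)"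
    unfolding P_def G_def Y_def A_def by (rule tele_reverse)+
  have 4: "half * G * P - pb n P G = (\<Sum>j<N - 2. Y j * (\<Sum>k = 2 * ((j + 1) div 2) + 2..N. A k)) + Y (N - 2) * A N"
    unfolding PG
    by (rule *(1)[OF prems]) (use n in \<open>auto simp: a t near_sign_def\<close>)
  then show "half * P * G - pb n P G
      = (\<Sum>j<N - 2. X (theta pth N (N - j)) * (\<Sum>k = 2 * ((j + 1) div 2) + 2..N. X (theta (path n (q - 2)) N (N - k))))
        + X (theta pth N 2) * X (theta (path n (q - 2)) N 0)"
    unfolding Y_def A_def e by (simp only: mult_ac)
  have 5: "pb n P (pb n P G) = half * half * G * P * P - G"
    unfolding PG
    by (rule *(2)[OF prems]) (use n in \<open>auto simp: a t near_sign_def\<close>)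
  then show "pb n P (pb n P G) = half * half * P * P * G - G"
    by (simp only: mult_ac)
qed

end

section \<open>The source elements as a family with Nelson-Regge relations\<close>

definition source_tele :: "nat \<Rightarrow> int \<Rightarrow> nat \<Rightarrow> laurent" where
  "source_tele n c l = tele (path n (2 * int l + c)) (2 * n - 2)"

text \<open>Paths with indices \<open>l < m\<close> are displaced by \<open>2 (m - l)\<close>. With
  the later path as reference, \<open>pb_far\<close> settles distance at least two, and
  \<open>pb_near\<close> with its mirror settles distance one.\<close>

lemma nelson_regge_source:
  assumes "n > 3" "odd c"
  shows "nelson_regge (pb n) half (source_tele n c) n"
proof
  fix l m :: nat
  assume lm: "1 \<le> l" "l + 1 < m" "m < n"
  interpret zigzag n "2 * int m + c" using assms by unfold_locales auto
  have e: "2 * int m + c - 2 * int (m - l) = 2 * int l + c" using lm by (simp add: of_nat_diff)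
  have "2 \<le> m - l" "m - l \<le> n - 2" using lm by auto
  from pb_far[OF this] show "pb n (source_tele n c l) (source_tele n c m) = 0"
    unfolding e source_tele_def .
next
  fix l :: nat
  assume l: "1 \<le> l" "l + 1 < n"
  interpret zigzag n "2 * int (l + 1) + c" using assms by unfold_locales auto
  have e: "2 * int (l + 1) + c - 2 = 2 * int l + c" by simp
  show "pb n (pb n (source_tele n c l) (source_tele n c (l + 1))) (source_tele n c (l + 1)) =
      half * half * source_tele n c l * source_tele n c (l + 1) * source_tele n c (l + 1) - source_tele n c l"
    using pb_near(2) unfolding source_tele_def e .
  show "pb n (source_tele n c l) (pb n (source_tele n c l) (source_tele n c (l + 1))) =
      half * half * source_tele n c l * source_tele n c l * source_tele n c (l + 1) - source_tele n c (l + 1)"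
    using pb_near_mirror(2) unfolding source_tele_def e .
qed

lemma monom_at_comb:
  assumes "\<And>j. j \<in> {1..N} \<Longrightarrow> w j \<in> strip n"
  shows "monom_at n (comb w N \<sigma>) x = exp (\<Sum>j=1..N. \<sigma> j * ln (x (w j)))"
proof -
  have "(\<Sum>v\<in>strip n. comb w N \<sigma> v * ln (x v)) = (\<Sum>j=1..N. \<Sum>v\<in>strip n. if v = w j then \<sigma> j * ln (x v) else 0)"
    unfolding comb_def sum_distrib_right by (subst sum.swap) (intro sum.cong refl, auto)
  also have "\<dots> = (\<Sum>j=1..N. \<sigma> j * ln (x (w j)))"
    using assms by (intro sum.cong refl) simp
  finally show ?thesis by (simp add: monom_at_def)
qed

lemma exp_half_ln: "0 < y \<Longrightarrow> exp (1 / 2 * ln y) = sqrt y"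
  by (simp add: ln_sqrt[symmetric])

lemma monom_at_theta:
  assumes w: "\<And>j. j \<in> {1..N} \<Longrightarrow> w j \<in> strip n" and x: "positive n x" and k: "k \<le> N"
  shows "monom_at n (theta w N k) x = sqrt (\<Prod>j=1..N. x (w j)) / (\<Prod>j=1..k. x (w j))"
proof -
  have pos: "0 < x (w j)" if "j \<in> {1..N}" for j using w[OF that] x by (auto simp: positive_def)
  have "(\<Sum>j=1..N. sg k j * ln (x (w j)))
      = (\<Sum>j=1..N. 1 / 2 * ln (x (w j)) - (if j \<le> k then ln (x (w j)) else 0))"
    by (intro sum.cong refl) (auto simp: sg_def)
  also have "\<dots> = 1 / 2 * (\<Sum>j=1..N. ln (x (w j))) - (\<Sum>j=1..N. if j \<le> k then ln (x (w j)) else 0)"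
    by (simp add: sum_subtractf sum_distrib_left)
  also have "(\<Sum>j=1..N. if j \<le> k then ln (x (w j)) else 0) = (\<Sum>j=1..k. ln (x (w j)))"
    using k by (intro sum.mono_neutral_cong_right) auto
  also have "(\<Sum>j=1..N. ln (x (w j))) = ln (\<Prod>j=1..N. x (w j))"
    using pos less_imp_neq by (subst ln_prod) fastforce+
  also have "(\<Sum>j=1..k. ln (x (w j))) = ln (\<Prod>j=1..k. x (w j))"
    using pos k less_imp_neq by (subst ln_prod) fastforce+
  finally have "monom_at n (theta w N k) x
      = exp (1 / 2 * ln (\<Prod>j=1..N. x (w j)) - ln (\<Prod>j=1..k. x (w j)))"
    using monom_at_comb[OF w, where \<sigma> = "sg k"] by simp
  also have "\<dots> = sqrt (\<Prod>j=1..N. x (w j)) / (\<Prod>j=1..k. x (w j))"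
  proof -
    have "0 < (\<Prod>j=1..N. x (w j))" "0 < (\<Prod>j=1..k. x (w j))"
      using pos k by (auto intro!: prod_pos)
    then show ?thesis unfolding exp_diff by (simp only: exp_half_ln exp_ln)
  qed
  finally show ?thesis .
qed

definition tel :: "nat \<Rightarrow> (nat \<Rightarrow> real) \<Rightarrow> real" where
  "tel N y = sqrt (\<Prod>j=1..N. y j) * (\<Sum>k\<le>N. 1 / (\<Prod>j=1..k. y j))"

lemma telescopic_eq_tel: "telescopic (map y [1..<Suc N]) = tel N y"
proof -
  have "prod_list (take k (map y [1..<Suc N])) = (\<Prod>j=1..k. y j)" if "k \<le> N" for k
  proof -
    have "take k [1..<Suc N] = [1..<Suc k]" using that by (simp add: take_upt del: upt_Suc)
    then show ?thesis
      by (simp add: take_map prod.distinct_set_conv_list[symmetric] atLeastLessThanSuc_atLeastAtMost del: upt_Suc)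
  qed
  from this this[of N] show ?thesis
    unfolding telescopic_def tel_def by (simp del: upt_Suc)
qed

lemma ev_tele:
  assumes w: "\<And>j. j \<in> {1..N} \<Longrightarrow> w j \<in> strip n" and x: "positive n x"
  shows "ev n (tele w N) x = tel N (\<lambda>j. x (w j))"
  unfolding tele_def ev_sum ev_single tel_def sum_distrib_left
  by (intro sum.cong refl) (subst monom_at_theta[OF w x]; simp)

lemma path_target_in_strip: "1 \<le> k \<Longrightarrow> k \<le> 2 * n - 2 \<Longrightarrow> path_target n q k \<in> strip n"
  unfolding path_target_def by (rule sv_in_strip) auto

lemma elem_source_eq:
  assumes "n > 0"
  shows "elem_source n c l x = tel (2 * n - 2) (\<lambda>k. x (path n (2 * int l + c) k))"
proof -
  have "2 * n - 1 = Suc (2 * n - 2)" using assms by simp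
  then show ?thesis unfolding elem_source_def by (simp only: telescopic_eq_tel)
qed

lemma elem_target_eq:
  assumes "n > 0"
  shows "elem_target n c l x = tel (2 * n - 2) (\<lambda>k. x (path_target n (2 * int l + c) k))"
proof -
  have "2 * n - 1 = Suc (2 * n - 2)" using assms by simp
  then show ?thesis unfolding elem_target_def by (simp only: telescopic_eq_tel)
qed

text \<open>The free choice of intermediate indices is absorbed by \<open>F_split\<close>, and
  \<open>poisson_eq_ev\<close> replaces the bracket defined by derivatives with the formal
  one.\<close>

lemma generated_source:
  assumes n: "n > 3" and c: "odd c"
    and gen: "generated n 1 (elem_source n c) k l f" and "1 \<le> k" "l \<le> n"
  shows "positive n x \<Longrightarrow> f x = ev n (nelson_regge.F (pb n) half (source_tele n c) k l) x \<and> k < l"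
  using gen assms(4,5)
proof (induction arbitrary: x)
  case (elementary l)
  interpret nelson_regge "pb n" half "source_tele n c" n by (rule nelson_regge_source[OF n c])
  show ?case
  proof -
    have "elem_source n c l x = ev n (source_tele n c l) x"
      using n elementary unfolding source_tele_def
      by (subst ev_tele) (auto intro: path_in_strip simp: elem_source_eq)
    then show ?thesis using F_elementary[of l] by simp
  qed
next
  case (bracket k m l f g)
  interpret nelson_regge "pb n" half "source_tele n c" n by (rule nelson_regge_source[OF n c])
  have f: "f y = ev n (F k m) y" and g: "g y = ev n (F m l) y" if "positive n y" for y
  proof -
    have "1 \<le> m" "m \<le> n" using bracket.hyps bracket.prems by linarith+
    then show "f y = ev n (F k m) y" "g y = ev n (F m l) y"
      using bracket.IH(1)[OF that] bracket.IH(2)[OF that] bracket.prems by blast+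
  qed
  show ?case
    using F_split[of k m l] bracket.hyps bracket.prems f g poisson_eq_ev[OF bracket.prems(1) f g]
    by (simp add: ev_add ev_mult)
qed

section \<open>The transformation preserves the Poisson bracket\<close>

lemma Om_minus_left: "Om n (- \<alpha>) \<beta> = - Om n \<alpha> \<beta>"
  using Om_scale_left[of n "-1" \<alpha> \<beta>] by (simp add: fun_Compl_def)

lemma Om_diff_left: "Om n (\<alpha> - \<beta>) \<gamma> = Om n \<alpha> \<gamma> - Om n \<beta> \<gamma>"
  using Om_add_left[of n \<alpha> "- \<beta>" \<gamma>] by (simp add: Om_minus_left)

lemma Om_diff_right: "Om n \<gamma> (\<alpha> - \<beta>) = Om n \<gamma> \<alpha> - Om n \<gamma> \<beta>"
  using Om_diff_left[of n \<alpha> \<beta> \<gamma>] by (subst (1 2 3) Om_swap) simp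

lemma Om_self [simp]: "Om n \<alpha> \<alpha> = 0"
  using Om_swap[of n \<alpha> \<alpha>] by simp

lemma Om_zero [simp]: "Om n 0 \<alpha> = 0" "Om n \<alpha> 0 = 0"
  by (simp_all add: Om_def)

lemma log_gradient_diff:
  "log_gradient n f x \<gamma> \<Longrightarrow> log_gradient n g x \<delta> \<Longrightarrow> log_gradient n (\<lambda>x. f x - g x) x (\<gamma> - \<delta>)"
  using log_gradient_add[of n f x \<gamma> "\<lambda>x. (-1) * g x" "\<lambda>u. (-1) * \<delta> u"] log_gradient_cmult[of n g x \<delta> "-1"]
  by (simp add: fun_diff_def)

lemma log_gradient_plus:
  "log_gradient n f x \<gamma> \<Longrightarrow> log_gradient n g x \<delta> \<Longrightarrow> log_gradient n (\<lambda>x. f x + g x) x (\<gamma> + \<delta>)"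
  using log_gradient_add[of n f x \<gamma> g \<delta>] by (simp add: plus_fun_def)

context zigzag
begin

abbreviation tlx :: "nat \<Rightarrow> exponent" where "tlx r \<equiv> tail_exp pth N r"

text \<open>Tail products are the convenient coordinates on the path: each \<open>\<eta>_k\<close>
  is a plain sum of them (\<open>et_eq\<close>), and they transform by a short formula
  (\<open>pr_transformed\<close>).\<close>

definition pr :: "state \<Rightarrow> nat \<Rightarrow> real" where
  "pr x r = (\<Prod>j=r..N. x (pth j))"

definition et :: "state \<Rightarrow> nat \<Rightarrow> real" where
  "et x k = eta n (\<lambda>k. x (pth k)) k"

lemma et_eq: "et x k = (\<Sum>r=k + 1..N + 1. pr x r)"
proof -
  have "2 * n - 1 = N + 1" using n by simp
  then show ?thesis unfolding et_def eta_def pr_def by simp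
qed

lemma pr_Suc: "r \<le> N \<Longrightarrow> pr x r = x (pth r) * pr x (Suc r)"
  unfolding pr_def by (rule prod.atLeast_Suc_atMost)

lemma pr_last: "pr x (N + 1) = 1"
  unfolding pr_def by simp

lemma et_Suc: "k \<le> N \<Longrightarrow> et x k = pr x (k + 1) + et x (k + 1)"
  unfolding et_eq by (cases "k = N") (auto simp: sum.atLeast_Suc_atMost)

lemma et_last: "et x N = 1"
  unfolding et_eq using pr_last by simp

lemma pth_pos: "positive n x \<Longrightarrow> 1 \<le> k \<Longrightarrow> k \<le> N \<Longrightarrow> 0 < x (pth k)"
  using path_in_strip[of k n q] by (simp add: positive_def)

lemma pr_pos: "positive n x \<Longrightarrow> 1 \<le> r \<Longrightarrow> 0 < pr x r"
  unfolding pr_def by (intro prod_pos) (auto intro!: pth_pos)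

lemma et_pos: "positive n x \<Longrightarrow> k \<le> N \<Longrightarrow> 0 < et x k"
  unfolding et_eq by (intro sum_pos) (auto intro!: pr_pos)

lemma tl_last: "tlx (N + 1) = 0"
  by (auto simp: comb_def fun_eq_iff)

lemma unit_exp_tl: "1 \<le> k \<Longrightarrow> k \<le> N \<Longrightarrow> unit_exp (pth k) = tlx k - tlx (k + 1)"
proof
  fix v assume k: "1 \<le> k" "k \<le> N"
  have "tlx k v - tlx (k + 1) v = (\<Sum>j=1..N. of_bool (v = pth j) * of_bool (j = k \<and> True))"
    unfolding comb_def sum_subtractf[symmetric] by (intro sum.cong) auto
  also have "\<dots> = of_bool (v = pth k)"
    unfolding sum_of_bool_eq[OF finite_atLeastAtMost] using k by simp
  finally show "of_bool (v = pth k) = (tlx k - tlx (k + 1)) v" by simp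
qed

lemma log_gradient_pr:
  assumes x: "positive n x" and r: "1 \<le> r"
  shows "log_gradient n (\<lambda>x. ln (pr x r)) x (tlx r)"
proof (rule log_gradient_cong[OF x])
  show "log_gradient n (\<lambda>x. \<Sum>j=1..N. of_bool (r \<le> j) * ln (x (pth j))) x (tlx r)"
    unfolding comb_def
    by (intro log_gradient_sum log_gradient_cmult log_gradient_var[OF x] path_in_strip) auto
  fix y assume y: "positive n y"
  have pos: "y (pth j) \<noteq> 0" if "j \<in> {r..N}" for j
  proof -
    have "1 \<le> j" "j \<le> N" using that r by auto
    from pth_pos[OF y this] show ?thesis by simp
  qed
  have "ln (pr y r) = (\<Sum>j=r..N. ln (y (pth j)))"
    unfolding pr_def by (rule ln_prod) (use pos in blast)+
  also have "\<dots> = (\<Sum>j=1..N. of_bool (r \<le> j) * ln (y (pth j)))"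
    using r by (intro sum.mono_neutral_cong_left) auto
  finally show "(\<Sum>j=1..N. of_bool (r \<le> j) * ln (y (pth j))) = ln (pr y r)" ..
qed

text \<open>The logarithmic gradient of \<open>et\<close> itself, whereas \<open>hv\<close> below is
  that of \<open>ln\<close> of it. Both combine the constant vectors \<open>tlx r\<close>, so their
  brackets reduce to \<open>Om_tails\<close>.\<close>

definition Mv :: "state \<Rightarrow> nat \<Rightarrow> exponent" where
  "Mv x k = (\<lambda>u. \<Sum>r=k + 1..N + 1. pr x r * tlx r u)"

definition hv :: "state \<Rightarrow> nat \<Rightarrow> exponent" where
  "hv x k = (\<lambda>u. (1 / et x k) * Mv x k u)"

lemma log_gradient_et:
  assumes x: "positive n x" and k: "k \<le> N"
  shows "log_gradient n (\<lambda>x. ln (et x k)) x (hv x k)"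
proof -
  have p: "log_gradient n (\<lambda>x. pr x r) x (\<lambda>u. pr x r * tlx r u)" if r: "1 \<le> r" for r
  proof (rule log_gradient_cong[OF x])
    show "log_gradient n (\<lambda>x. exp (ln (pr x r))) x (\<lambda>u. pr x r * tlx r u)"
      using log_gradient_compose[OF log_gradient_pr[OF x r], of exp "pr x r"] pr_pos[OF x r]
        DERIV_exp[of "ln (pr x r)"] by simp
  qed (use pr_pos r in simp)
  have "log_gradient n (\<lambda>x. et x k) x (Mv x k)"
    unfolding et_eq Mv_def by (intro log_gradient_sum p) auto
  from log_gradient_ln[OF this et_pos[OF x k]] show ?thesis
    by (simp add: hv_def)
qed

lemma hv_last: "hv x N = 0"
  unfolding hv_def Mv_def using tl_last by (simp add: fun_eq_iff)

lemma sum_pr: "k \<le> m \<Longrightarrow> m \<le> N \<Longrightarrow> (\<Sum>r=k + 1..m. pr x r) = et x k - et x m"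
proof (induction m rule: dec_induct)
  case (step m)
  then show ?case using et_Suc[of m x] by simp
qed simp

lemma Om_tl_Mv: "Om n (tlx r) (Mv x k) = (\<Sum>s=k + 1..N + 1. pr x s * Om n (tlx r) (tlx s))"
  unfolding Mv_def Om_sum_right Om_scale_right ..

lemma Om_tl_Mv_last: "Om n (tlx r) (Mv x k) = (\<Sum>s=k + 1..N. pr x s * Om n (tlx r) (tlx s))"
  unfolding Om_tl_Mv using tl_last by (cases "k \<le> N") auto

lemma Om_first_Mv: "1 \<le> k \<Longrightarrow> k \<le> N \<Longrightarrow> Om n (tlx 1) (Mv x k) = 2 * (et x k - 1)"
proof -
  assume k: "1 \<le> k" "k \<le> N"
  have "Om n (tlx 1) (Mv x k) = (\<Sum>s=k + 1..N. 2 * pr x s)"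
    unfolding Om_tl_Mv_last using k by (intro sum.cong) (simp_all add: Om_tails)
  then show ?thesis using sum_pr[of k N x] k et_last by (simp add: sum_distrib_left[symmetric])
qed

lemma Om_tl_Mv_low:
  assumes "2 \<le> r" "r \<le> k" "k \<le> N"
  shows "Om n (tlx r) (Mv x k) = et x k - 1"
proof -
  have "Om n (tlx r) (Mv x k) = (\<Sum>s=k + 1..N. pr x s)"
    unfolding Om_tl_Mv_last using assms by (intro sum.cong) (simp_all add: Om_tails)
  then show ?thesis using sum_pr[of k N x] assms et_last by simp
qed

text \<open>Tails with \<open>s < r\<close> enter with a minus sign, those with \<open>s > r\<close>
  with a plus sign, and \<open>s = r\<close> drops out; \<open>1 \<le> k\<close> keeps the
  exceptional tail that starts at 1 out of the sum.\<close>

lemma Om_tl_Mv_high: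
  assumes k: "1 \<le> k" "k < r" "r \<le> N"
  shows "Om n (tlx r) (Mv x k) = et x r - 1 - et x k + et x (r - 1)"
proof -
  have "{k + 1..N} = {k + 1..r - 1} \<union> {r} \<union> {r + 1..N}" using k by auto
  then have "Om n (tlx r) (Mv x k) = (\<Sum>s=k + 1..r - 1. pr x s * Om n (tlx r) (tlx s))
      + (\<Sum>s=r + 1..N. pr x s * Om n (tlx r) (tlx s))"
    unfolding Om_tl_Mv_last using k by (simp add: sum.union_disjoint)
  also have "(\<Sum>s=k + 1..r - 1. pr x s * Om n (tlx r) (tlx s)) = (\<Sum>s=k + 1..r - 1. - pr x s)"
  proof (rule sum.cong[OF refl])
    fix s assume s: "s \<in> {k + 1..r - 1}"
    have "Om n (tlx s) (tlx r) = 1" using s k by (subst Om_tails) auto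
    then show "pr x s * Om n (tlx r) (tlx s) = - pr x s" using Om_swap[of n "tlx r" "tlx s"] by simp
  qed
  also have "(\<Sum>s=r + 1..N. pr x s * Om n (tlx r) (tlx s)) = (\<Sum>s=r + 1..N. pr x s)"
    using k by (intro sum.cong) (simp_all add: Om_tails)
  finally show ?thesis
    using sum_pr[of r N x] sum_pr[of k "r - 1" x] k et_last by (simp add: sum_negf)
qed

text \<open>The vectors \<open>Mv x j\<close> and \<open>Mv x k\<close> differ by the tails
  \<open>j + 1..k\<close>, all of which pair with \<open>Mv x k\<close> to the same value.\<close>

lemma Om_Mv_Mv:
  assumes jk: "1 \<le> j" "j \<le> k" "k \<le> N"
  shows "Om n (Mv x j) (Mv x k) = (et x j - et x k) * (et x k - 1)"
proof -
  have "{j + 1..N + 1} = {j + 1..k} \<union> {k + 1..N + 1}" using jk by auto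
  then have "Mv x j = (\<lambda>u. \<Sum>r=j + 1..k. pr x r * tlx r u) + Mv x k"
    unfolding Mv_def fun_eq_iff using jk by (simp add: sum.union_disjoint)
  then have "Om n (Mv x j) (Mv x k) = (\<Sum>r=j + 1..k. pr x r * Om n (tlx r) (Mv x k))"
    by (simp add: Om_add_left Om_sum_left Om_scale_left)
  also have "\<dots> = (\<Sum>r=j + 1..k. pr x r) * (et x k - 1)"
    unfolding sum_distrib_right using jk by (intro sum.cong) (simp_all add: Om_tl_Mv_low)
  finally show ?thesis using sum_pr[of j k x] jk by simp
qed

lemma Om_hv:
  assumes x: "positive n x"
  shows "1 \<le> k \<Longrightarrow> k \<le> N \<Longrightarrow> Om n (tlx 1) (hv x k) = 2 - 2 * (1 / et x k)"
    "2 \<le> r \<Longrightarrow> r \<le> k \<Longrightarrow> k \<le> N \<Longrightarrow> Om n (tlx r) (hv x k) = 1 - 1 / et x k"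
    "1 \<le> k \<Longrightarrow> k < r \<Longrightarrow> r \<le> N \<Longrightarrow>
      Om n (tlx r) (hv x k) = (et x r + et x (r - 1)) * (1 / et x k) - 1 / et x k - 1"
    "1 \<le> j \<Longrightarrow> j \<le> k \<Longrightarrow> k \<le> N \<Longrightarrow>
      Om n (hv x j) (hv x k) = 1 - 1 / et x k - et x k * (1 / et x j) + 1 / et x j"
proof -
  have e: "et x k \<noteq> 0" if "k \<le> N" for k using et_pos[OF x that] by simp
  show "1 \<le> k \<Longrightarrow> k \<le> N \<Longrightarrow> Om n (tlx 1) (hv x k) = 2 - 2 * (1 / et x k)"
    unfolding hv_def Om_scale_right using e[of k] by (simp only: Om_first_Mv) (simp add: field_simps)
  show "2 \<le> r \<Longrightarrow> r \<le> k \<Longrightarrow> k \<le> N \<Longrightarrow> Om n (tlx r) (hv x k) = 1 - 1 / et x k"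
    unfolding hv_def Om_scale_right using e[of k] by (simp only: Om_tl_Mv_low) (simp add: field_simps)
  show "1 \<le> k \<Longrightarrow> k < r \<Longrightarrow> r \<le> N \<Longrightarrow>
      Om n (tlx r) (hv x k) = (et x r + et x (r - 1)) * (1 / et x k) - 1 / et x k - 1"
    unfolding hv_def Om_scale_right using e[of k] by (simp only: Om_tl_Mv_high) (simp add: field_simps)
  show "1 \<le> j \<Longrightarrow> j \<le> k \<Longrightarrow> k \<le> N \<Longrightarrow>
      Om n (hv x j) (hv x k) = 1 - 1 / et x k - et x k * (1 / et x j) + 1 / et x j"
    unfolding hv_def Om_scale_right Om_scale_left using e[of k] e[of j] by (simp only: Om_Mv_Mv) (simp add: field_simps)
qed

text \<open>The logarithmic gradients of the transformed products \<open>a'\<^sub>r \<cdots> a'\<^sub>N\<close>.\<close>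

definition tlx' :: "state \<Rightarrow> nat \<Rightarrow> exponent" where
  "tlx' x r = (if r = 1 then tlx 1 - hv x 1 - hv x 1
    else if r \<le> N then tlx 1 - hv x 1 - hv x r - hv x (r - 1) + tlx r else 0)"

text \<open>The core of the Poisson property. Expanded bilinearly with the values of
  \<open>Om_hv\<close>, the left side is a combination of \<open>1 / \<eta>\<close> and of quotients
  of two \<open>\<eta>\<close>; all of these cancel by \<open>\<eta> * (1 / \<eta>) = 1\<close>,
  leaving the constant.\<close>

lemma Om_tl':
  assumes x: "positive n x" and rs: "1 \<le> r" "r < s"
  shows "Om n (tlx' x r) (tlx' x s) = Om n (tlx r) (tlx s)"
proof (cases "s \<le> N")
  case False
  then show ?thesis using rs by (simp add: tlx'_def Om_tails)
next
  case s: True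
  have sw: "Om n (hv x k) (tlx r) = - Om n (tlx r) (hv x k)" for k r by (rule Om_swap)
  note simps = Om_add_left Om_add_right Om_diff_left Om_diff_right sw
  have e: "et x 1 \<noteq> 0" "et x s \<noteq> 0" "et x (s - 1) \<noteq> 0" "et x r \<noteq> 0" "et x (r - 1) \<noteq> 0"
  proof -
    have "1 \<le> N" "s \<le> N" "s - 1 \<le> N" "r \<le> N" "r - 1 \<le> N" using s rs by auto
    from this[THEN et_pos[OF x]]
    show "et x 1 \<noteq> 0" "et x s \<noteq> 0" "et x (s - 1) \<noteq> 0" "et x r \<noteq> 0" "et x (r - 1) \<noteq> 0" by simp_all
  qed
  have hs: "Om n (hv x (1)) (hv x (s)) = 1 - 1 / et x (s) - et x (s) * (1 / et x (1)) + 1 / et x (1)"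
    "Om n (hv x (1)) (hv x (s - 1)) = 1 - 1 / et x (s - 1) - et x (s - 1) * (1 / et x (1)) + 1 / et x (1)"
    "Om n (tlx 1) (hv x (1)) = 2 - 2 * (1 / et x (1))"
    "Om n (tlx 1) (hv x (s)) = 2 - 2 * (1 / et x (s))"
    "Om n (tlx 1) (hv x (s - 1)) = 2 - 2 * (1 / et x (s - 1))"
    "Om n (tlx s) (hv x (1)) = (et x s + et x (s - 1)) * (1 / et x (1)) - 1 / et x (1) - 1"
    "Om n (tlx 1) (tlx s) = 2"
    by (rule Om_hv[OF x]; use s rs in linarith | (subst Om_tails; use s rs in simp))+
  show ?thesis
  proof (cases "r = 1")
    case True
    have 1: "tlx' x s = tlx 1 - hv x 1 - hv x s - hv x (s - 1) + tlx s" "tlx' x r = tlx 1 - hv x 1 - hv x 1"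
      using True s rs by (simp_all add: tlx'_def)
    have "et x 1 * (1 / et x 1) = 1" using e by simp
    then show ?thesis unfolding 1 unfolding True unfolding simps Om_self hs by (simp only: algebra_simps)
  next
    case False
    then have r: "2 \<le> r" using rs by simp
    have 1: "tlx' x s = tlx 1 - hv x 1 - hv x s - hv x (s - 1) + tlx s"
      "tlx' x r = tlx 1 - hv x 1 - hv x r - hv x (r - 1) + tlx r"
      using r s rs by (simp_all add: tlx'_def)
    have hr: "Om n (hv x (1)) (hv x (r)) = 1 - 1 / et x (r) - et x (r) * (1 / et x (1)) + 1 / et x (1)"
      "Om n (hv x (1)) (hv x (r - 1)) = 1 - 1 / et x (r - 1) - et x (r - 1) * (1 / et x (1)) + 1 / et x (1)"
      "Om n (tlx 1) (hv x (r)) = 2 - 2 * (1 / et x (r))"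
      "Om n (tlx 1) (hv x (r - 1)) = 2 - 2 * (1 / et x (r - 1))"
      "Om n (tlx r) (hv x (1)) = (et x r + et x (r - 1)) * (1 / et x (1)) - 1 / et x (1) - 1"
      "Om n (tlx 1) (tlx r) = 2"
      "Om n (tlx r) (tlx s) = 1"
      "Om n (tlx r) (hv x (s)) = 1 - 1 / et x (s)"
      "Om n (tlx r) (hv x (s - 1)) = 1 - 1 / et x (s - 1)"
      "Om n (tlx s) (hv x (r)) = (et x s + et x (s - 1)) * (1 / et x (r)) - 1 / et x (r) - 1"
      "Om n (tlx s) (hv x (r - 1)) = (et x s + et x (s - 1)) * (1 / et x (r - 1)) - 1 / et x (r - 1) - 1"
      "Om n (hv x (r)) (hv x (s)) = 1 - 1 / et x (s) - et x (s) * (1 / et x (r)) + 1 / et x (r)"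
      "Om n (hv x (r)) (hv x (s - 1)) = 1 - 1 / et x (s - 1) - et x (s - 1) * (1 / et x (r)) + 1 / et x (r)"
      "Om n (hv x (r - 1)) (hv x (s)) = 1 - 1 / et x (s) - et x (s) * (1 / et x (r - 1)) + 1 / et x (r - 1)"
      "Om n (hv x (r - 1)) (hv x (s - 1)) = 1 - 1 / et x (s - 1) - et x (s - 1) * (1 / et x (r - 1)) + 1 / et x (r - 1)"
      by (rule Om_hv[OF x]; use r s rs in linarith | (subst Om_tails; use r s rs in simp))+
    have 2: "Om n (tlx r) (tlx 1) = - 2" "Om n (hv x r) (hv x 1) = - Om n (hv x 1) (hv x r)"
      "Om n (hv x (r - 1)) (hv x 1) = - Om n (hv x 1) (hv x (r - 1))"
      using Om_swap[of n "tlx r" "tlx 1"] hr(6) Om_swap[of n "hv x r" "hv x 1"] Om_swap[of n "hv x (r - 1)" "hv x 1"]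
      by simp_all
    have "et x r * (1 / et x r) = 1" "et x (r - 1) * (1 / et x (r - 1)) = 1"
      "et x s * (1 / et x s) = 1" "et x (s - 1) * (1 / et x (s - 1)) = 1" using e by simp_all
    then show ?thesis unfolding 1 unfolding simps Om_self 2 unfolding hs hr by (simp only: algebra_simps)
  qed
qed

lemma Om_tl'_any:
  assumes x: "positive n x" and "1 \<le> r" "1 \<le> s"
  shows "Om n (tlx' x r) (tlx' x s) = Om n (tlx r) (tlx s)"
  using Om_tl'[OF x, of r s] Om_tl'[OF x, of s r] Om_swap[of n "tlx' x r" "tlx' x s"] Om_swap[of n "tlx r" "tlx s"] assms
  by (cases r s rule: linorder_cases) auto

end

text \<open>A function is wanted for substituting into Laurent polynomials. The relation determines
  it on the quiver vertices, so the arbitrary choice is invisible to evaluation.\<close>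

definition phi :: "nat \<Rightarrow> int \<Rightarrow> state \<Rightarrow> state" where
  "phi n q x = (SOME x'. braid_transformation n q x x')"

context zigzag
begin

lemma braid_transformation_phi: "braid_transformation n q x (phi n q x)"
  unfolding phi_def using braid_transformation_exists[OF n] by (rule someI_ex)

lemma braid_transformationD:
  assumes "braid_transformation n q x x'"
  shows "x' (pth 1) = et x 2 / pr x 2"
    "2 \<le> k \<Longrightarrow> k < N \<Longrightarrow> x' (pth k) = x (pth k) * et x (k + 1) / et x (k - 1)"
    "x' (pth N) = pr x 1 * x (pth N) / (et x 1 * et x (N - 1))"
    "1 \<le> j \<Longrightarrow> j \<le> N - 2 \<Longrightarrow> x' (adjv j) = x (adjv j) * et x j / et x (j + 2)"
    "v \<in> strip n \<Longrightarrow> v \<notin> pth ` {1..N} \<Longrightarrow> v \<notin> adjv ` {1..N - 2} \<Longrightarrow> x' v = x v"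
proof -
  note D = assms[unfolded braid_transformation_def Let_def, folded et_def]
  show "x' (pth 1) = et x 2 / pr x 2"
    using D by (simp add: pr_def)
  show "2 \<le> k \<Longrightarrow> k < N \<Longrightarrow> x' (pth k) = x (pth k) * et x (k + 1) / et x (k - 1)"
    using D by auto
  have "{1..N} = insert N {1..N - 1}" using n by auto
  moreover have "N \<notin> {1..N - 1}" using n by auto
  ultimately have "pr x 1 = x (pth N) * (\<Prod>k=1..N - 1. x (pth k))"
    unfolding pr_def by (simp only: prod.insert finite_atLeastAtMost not_False_eq_True)
  then show "x' (pth N) = pr x 1 * x (pth N) / (et x 1 * et x (N - 1))"
    using D by (simp add: power2_eq_square mult_ac)
  show "1 \<le> j \<Longrightarrow> j \<le> N - 2 \<Longrightarrow> x' (adjv j) = x (adjv j) * et x j / et x (j + 2)"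
    using D by auto
  assume v: "v \<in> strip n" "v \<notin> pth ` {1..N}" "v \<notin> adjv ` {1..N - 2}"
  have "2 * n - 4 = N - 2" by simp
  then have "v \<in> quiver_vertices n - path n q ` {1..N} - adj n q ` {1..2 * n - 4} - {Extra}"
    using v by (auto simp: quiver_vertices_eq)
  then show "x' v = x v" using D by blast
qed

lemma vertex_cases:
  assumes "v \<in> strip n"
  obtains "v = pth 1" | k where "2 \<le> k" "k < N" "v = pth k" | "v = pth N"
    | j where "1 \<le> j" "j \<le> N - 2" "v = adjv j"
    | "v \<notin> pth ` {1..N}" "v \<notin> adjv ` {1..N - 2}"
proof -
  consider k where "1 \<le> k" "k \<le> N" "v = pth k" | j where "1 \<le> j" "j \<le> N - 2" "v = adjv j"
    | "v \<notin> pth ` {1..N}" "v \<notin> adjv ` {1..N - 2}"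
    by (force simp del: diff_diff_left)
  then show ?thesis
  proof cases
    case (1 k)
    then consider "k = 1" | "2 \<le> k" "k < N" | "k = N" by linarith
    then show ?thesis by cases (use 1 that(1,2,3) in blast)+
  qed (use that(4,5) in blast)+
qed

lemma et_pos': "positive n x \<Longrightarrow> k \<le> N \<Longrightarrow> et x k \<noteq> 0"
  using et_pos[of x k] by simp

lemma braid_transformation_positive:
  assumes bt: "braid_transformation n q x x'" and x: "positive n x"
  shows "positive n x'"
  unfolding positive_def
proof
  fix v assume v: "v \<in> strip n"
  have xv: "0 < x v" using v x by (simp add: positive_def)
  have e: "0 < et x k" if "k \<le> N" for k using et_pos[OF x that] .
  note B = braid_transformationD[OF bt]
  from v show "0 < x' v"
  proof (cases rule: vertex_cases)
    case 1
    have "2 \<le> N" using n by auto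
    then show ?thesis unfolding 1 B(1) using e pr_pos[OF x, of 2] by simp
  next
    case (2 k)
    show ?thesis unfolding 2(3) B(2)[OF 2(1,2)] using 2 xv e[of "k + 1"] e[of "k - 1"] by simp
  next
    case 3
    have "1 \<le> N" "N - 1 \<le> N" using n by auto
    then show ?thesis unfolding 3 B(3) using xv 3 e[of 1] e[of "N - 1"] pr_pos[OF x, of 1]
      by (intro divide_pos_pos mult_pos_pos) auto
  next
    case (4 j)
    have "j \<le> N" "j + 2 \<le> N" using 4 n by auto
    then show ?thesis unfolding 4(3) B(4)[OF 4(1,2)] using 4 xv e[of j] e[of "j + 2"] by simp
  next
    case 5
    then show ?thesis using B(5)[OF v] xv by simp
  qed
qed

text \<open>Each variable is an invariant factor with exponent \<open>W\<close>, commuting with the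
  whole path, times a power \<open>\<kappa>\<close> of the path variable \<open>a_r\<close>, which
  is a quotient of consecutive tails. For a path variable \<open>W\<close> is 0; for
  \<open>b_j\<close> the invariant factor is \<open>b_j a_(j+1)\<close>, because \<open>b_j\<close>
  and \<open>a_(j+1)\<close> are multiplied by inverse factors; every other variable is itself
  invariant.\<close>

lemma log_gradient_phi_aux:
  assumes x: "positive n x" and v: "v \<in> strip n"
  shows "\<exists>W \<kappa> r. 1 \<le> r \<and> r \<le> N \<and> unit_exp v = W + (\<lambda>u. \<kappa> * (tlx r - tlx (r + 1)) u)
    \<and> log_gradient n (\<lambda>x. ln (phi n q x v)) x (W + (\<lambda>u. \<kappa> * (tlx' x r - tlx' x (r + 1)) u))
    \<and> (\<forall>s. Om n W (tlx s) = 0)"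
proof -
  note B = braid_transformationD[OF braid_transformation_phi]
  note LE = log_gradient_et[OF x]
  have LV: "log_gradient n (\<lambda>x. ln (x v)) x (unit_exp v)"
    using log_gradient_var[OF x v] .
  have on_path: ?thesis if k: "1 \<le> k" "k \<le> N" and vk: "v = pth k"
    and lg: "log_gradient n (\<lambda>x. ln (phi n q x v)) x (tlx' x k - tlx' x (k + 1))" for k
  proof -
    have "unit_exp v = 0 + (\<lambda>u. 1 * (tlx k - tlx (k + 1)) u)"
      unfolding vk unit_exp_tl[OF k] by (simp add: fun_eq_iff)
    moreover have "tlx' x k - tlx' x (k + 1) = 0 + (\<lambda>u. 1 * (tlx' x k - tlx' x (k + 1)) u)"
      by (simp add: fun_eq_iff)
    moreover have "\<forall>s. Om n 0 (tlx s) = 0" by simp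
    ultimately show ?thesis using k lg by metis
  qed
  have d_mid: "tlx' x k - tlx' x (k + 1) = unit_exp (pth k) + hv x (k + 1) - hv x (k - 1)"
    if "2 \<le> k" "k < N" for k
  proof -
    have t: "tlx' x k = tlx 1 - hv x 1 - hv x k - hv x (k - 1) + tlx k"
      "tlx' x (k + 1) = tlx 1 - hv x 1 - hv x (k + 1) - hv x k + tlx (k + 1)"
      using that by (simp_all add: tlx'_def)
    have u: "unit_exp (pth k) = tlx k - tlx (k + 1)" using that by (intro unit_exp_tl) auto
    show ?thesis unfolding t u by (simp add: algebra_simps)
  qed
  from v show ?thesis
  proof (cases rule: vertex_cases)
    case 1
    show ?thesis
    proof (rule on_path[OF _ _ 1])
      have 2: "log_gradient n (\<lambda>x. ln (et x 2) - ln (pr x 2)) x (hv x 2 - tlx 2)"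
        using n by (intro log_gradient_diff LE log_gradient_pr x) auto
      have "tlx' x 1 - tlx' x (1 + 1) = hv x 2 - tlx 2"
      proof -
        have "2 \<le> N" using n by auto
        then have "tlx' x 1 = tlx 1 - hv x 1 - hv x 1" "tlx' x 2 = tlx 1 - hv x 1 - hv x 2 - hv x 1 + tlx 2"
          by (simp_all add: tlx'_def)
        then show ?thesis unfolding one_add_one by (simp add: fun_eq_iff)
      qed
      moreover have "ln (et y 2) - ln (pr y 2) = ln (phi n q y v)" if "positive n y" for y
      proof -
        have "2 \<le> N" using n by auto
        then show ?thesis
          using et_pos[OF that, of 2] pr_pos[OF that, of 2] unfolding 1 B(1) by (simp add: ln_div)
      qed
      ultimately show "log_gradient n (\<lambda>x. ln (phi n q x v)) x (tlx' x 1 - tlx' x (1 + 1))"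
        using log_gradient_cong[OF x _ 2] by simp
    qed (use n in auto)
  next
    case (2 k)
    show ?thesis
    proof (rule on_path[OF _ _ 2(3)])
      have 3: "log_gradient n (\<lambda>x. ln (x v) + ln (et x (k + 1)) - ln (et x (k - 1))) x
          (unit_exp v + hv x (k + 1) - hv x (k - 1))"
        using 2 by (intro log_gradient_diff log_gradient_plus LE LV) auto
      have "ln (y v) + ln (et y (k + 1)) - ln (et y (k - 1)) = ln (phi n q y v)" if "positive n y" for y
      proof -
        have "0 < et y (k + 1)" "0 < et y (k - 1)" using 2 by (auto intro!: et_pos[OF that])
        moreover have "0 < y v" using that v by (simp add: positive_def)
        ultimately show ?thesis using B(2)[OF 2(1,2), of y] unfolding 2(3) by (simp add: ln_div ln_mult)
      qed
      from log_gradient_cong[OF x this 3]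
      show "log_gradient n (\<lambda>x. ln (phi n q x v)) x (tlx' x k - tlx' x (k + 1))"
        unfolding d_mid[OF 2(1,2)] 2(3) .
    qed (use 2 in auto)
  next
    case 3
    show ?thesis
    proof (rule on_path[OF _ _ 3])
      have 4: "log_gradient n (\<lambda>x. ln (pr x 1) + ln (x v) - ln (et x 1) - ln (et x (N - 1))) x
          (tlx 1 + unit_exp v - hv x 1 - hv x (N - 1))"
        using n by (intro log_gradient_diff log_gradient_plus log_gradient_pr LE LV x) auto
      have "ln (pr y 1) + ln (y v) - ln (et y 1) - ln (et y (N - 1)) = ln (phi n q y v)" if "positive n y" for y
      proof -
        have "0 < et y 1" "0 < et y (N - 1)" using n by (auto intro!: et_pos[OF that])
        moreover have "0 < y v" using that v by (simp add: positive_def)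
        moreover have "0 < pr y 1" using that by (intro pr_pos) auto
        ultimately show ?thesis unfolding 3 B(3) by (simp add: ln_div ln_mult)
      qed
      note 5 = log_gradient_cong[OF x this 4]
      have "tlx' x N - tlx' x (N + 1) = tlx 1 - hv x 1 - hv x N - hv x (N - 1) + tlx N"
      proof -
        have "N \<noteq> 1" "N + 1 \<noteq> 1" "\<not> N + 1 \<le> N" using n by auto
        then show ?thesis unfolding tlx'_def by (simp only: if_False if_True order_refl diff_zero)
      qed
      also have "\<dots> = tlx 1 + unit_exp v - hv x 1 - hv x (N - 1)"
        using unit_exp_tl[of N] n unfolding 3 hv_last tl_last by (simp add: fun_eq_iff)
      finally show "log_gradient n (\<lambda>x. ln (phi n q x v)) x (tlx' x N - tlx' x (N + 1))"
        using 5 by simp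
    qed (use n in auto)
  next
    case (4 j)
    have j: "1 \<le> j + 1" "j + 1 \<le> N" "2 \<le> j + 1" "j + 1 < N" using 4 n by auto
    define W where "W = unit_exp v + unit_exp (pth (j + 1))"
    have 5: "log_gradient n (\<lambda>x. ln (x v) + ln (et x j) - ln (et x (j + 2))) x
        (unit_exp v + hv x j - hv x (j + 2))"
      using 4 n by (intro log_gradient_diff log_gradient_plus LE LV) auto
    have "ln (y v) + ln (et y j) - ln (et y (j + 2)) = ln (phi n q y v)" if "positive n y" for y
    proof -
      have "0 < et y j" "0 < et y (j + 2)" using 4 n by (auto intro!: et_pos[OF that])
      moreover have "0 < y v" using that v by (simp add: positive_def)
      ultimately show ?thesis using B(4)[OF 4(1,2), of y] unfolding 4(3) by (simp add: ln_div ln_mult)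
    qed
    note 6 = log_gradient_cong[OF x this 5]
    have "unit_exp v + hv x j - hv x (j + 2)
        = W + (\<lambda>u. (-1) * (tlx' x (j + 1) - tlx' x (j + 1 + 1)) u)"
      unfolding d_mid[OF j(3,4)] W_def by (simp add: fun_eq_iff)
    then have 7: "log_gradient n (\<lambda>x. ln (phi n q x v)) x (W + (\<lambda>u. (-1) * (tlx' x (j + 1) - tlx' x (j + 1 + 1)) u))"
      using 6 by simp
    have 8: "unit_exp v = W + (\<lambda>u. (-1) * (tlx (j + 1) - tlx (j + 1 + 1)) u)"
      unfolding W_def unit_exp_tl[OF j(1,2)] by (simp add: fun_eq_iff)
    have "Om n W (tlx s) = 0" for s
    proof -
      have "Om n (unit_exp v) (tlx s) = of_bool (s \<le> j) - of_bool (s \<le> j + 2)"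
        unfolding 4(3) by (rule Om_adjv[OF 4(1,2)])
      moreover have "Om n (unit_exp (pth (j + 1))) (tlx s) = of_bool (s \<le> j + 2) - of_bool (s \<le> j)"
        unfolding Om_pth[OF j(1,2)] using 4 j by simp
      ultimately show ?thesis unfolding W_def Om_add_left by simp
    qed
    then show ?thesis using 7 8 j(1,2) by blast
  next
    case 5
    have "phi n q y v = y v" for y using B(5)[OF v 5] .
    then have "log_gradient n (\<lambda>x. ln (phi n q x v)) x (unit_exp v + (\<lambda>u. 0 * (tlx' x 1 - tlx' x (1 + 1)) u))"
      using LV by (simp add: plus_fun_def)
    moreover have "unit_exp v = unit_exp v + (\<lambda>u. 0 * (tlx 1 - tlx (1 + 1)) u)"
      by (simp add: fun_eq_iff)
    moreover have "\<forall>s. Om n (unit_exp v) (tlx s) = 0" using Om_other[OF v 5] by blast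
    moreover have "1 \<le> N" using n by auto
    ultimately show ?thesis by blast
  qed
qed

text \<open>Since each \<open>W\<close> is orthogonal to all tails, the mixed terms vanish before
  and after the transformation, while the path terms keep their brackets by \<open>Om_tl'\<close>.
  So the Jacobian preserves \<open>Om\<close>.\<close>

lemma log_gradient_phi:
  assumes x: "positive n x"
  obtains D where "\<And>v. v \<in> strip n \<Longrightarrow> log_gradient n (\<lambda>x. ln (phi n q x v)) x (D v)"
    and "\<And>u v. u \<in> strip n \<Longrightarrow> v \<in> strip n \<Longrightarrow> Om n (D u) (D v) = eps n u v"
proof -
  have "\<forall>v\<in>strip n. \<exists>t. case t of (W, \<kappa>, r) \<Rightarrow> 1 \<le> r \<and> r \<le> N \<and> unit_exp v = W + (\<lambda>u. \<kappa> * (tlx r - tlx (r + 1)) u)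
    \<and> log_gradient n (\<lambda>x. ln (phi n q x v)) x (W + (\<lambda>u. \<kappa> * (tlx' x r - tlx' x (r + 1)) u))
    \<and> (\<forall>s. Om n W (tlx s) = 0)"
    using log_gradient_phi_aux[OF x] by (auto simp: split_paired_Ex)
  from bchoice[OF this] obtain f where f0: "\<forall>v\<in>strip n. case f v of (W, \<kappa>, r) \<Rightarrow>
    1 \<le> r \<and> r \<le> N \<and> unit_exp v = W + (\<lambda>u. \<kappa> * (tlx r - tlx (r + 1)) u)
    \<and> log_gradient n (\<lambda>x. ln (phi n q x v)) x (W + (\<lambda>u. \<kappa> * (tlx' x r - tlx' x (r + 1)) u))
    \<and> (\<forall>s. Om n W (tlx s) = 0)" by blast
  define W where "W v = fst (f v)" for v
  define K where "K v = fst (snd (f v))" for v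
  define r where "r v = snd (snd (f v))" for v
  have f: "1 \<le> r v" "r v \<le> N" "unit_exp v = W v + (\<lambda>u. K v * (tlx (r v) - tlx (r v + 1)) u)"
    "log_gradient n (\<lambda>x. ln (phi n q x v)) x (W v + (\<lambda>u. K v * (tlx' x (r v) - tlx' x (r v + 1)) u))"
    "Om n (W v) (tlx s) = 0" if "v \<in> strip n" for v s
    using bspec[OF f0 that] by (auto simp: W_def K_def r_def split: prod.splits)
  define Z where "Z v = tlx (r v) - tlx (r v + 1)" for v
  define Z' where "Z' v = tlx' x (r v) - tlx' x (r v + 1)" for v
  define D where "D v = W v + (\<lambda>u. K v * Z' v u)" for v
  note f' = f(3,4)[folded Z_def Z'_def]
  have Wh: "Om n (W v) (hv x k) = 0" if "v \<in> strip n" for v k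
    unfolding hv_def Mv_def Om_scale_right Om_sum_right using f(5)[OF that] by simp
  have Wt: "Om n (W v) (tlx' x s) = 0" if "v \<in> strip n" for v s
    by (simp only: tlx'_def Om_add_right Om_diff_right f(5)[OF that] Wh[OF that] Om_zero split: if_split) simp
  have WZ: "Om n (W v) (Z u) = 0" "Om n (W v) (Z' u) = 0" if "v \<in> strip n" for u v
    unfolding Z_def Z'_def Om_diff_right using Wt[OF that] f(5)[OF that] by simp_all
  have ZW: "Om n (Z u) (W v) = 0" "Om n (Z' u) (W v) = 0" if "v \<in> strip n" for u v
    using WZ[OF that, of u] Om_swap[of n "Z u" "W v"] Om_swap[of n "Z' u" "W v"] by simp_all
  have ZZ: "Om n (Z' u) (Z' v) = Om n (Z u) (Z v)" if "u \<in> strip n" "v \<in> strip n" for u v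
    unfolding Z_def Z'_def Om_diff_left Om_diff_right using f(1)[OF that(1)] f(1)[OF that(2)]
    by (simp add: Om_tl'_any[OF x])
  show ?thesis
  proof
    show "log_gradient n (\<lambda>x. ln (phi n q x v)) x (D v)" if "v \<in> strip n" for v
      unfolding D_def using f'(2)[OF that] .
    fix u v assume uv: "u \<in> strip n" "v \<in> strip n"
    have "Om n (D u) (D v) = Om n (unit_exp u) (unit_exp v)"
      unfolding D_def f'(1)[OF uv(1)] f'(1)[OF uv(2)] Om_add_left Om_add_right Om_scale_left Om_scale_right
        WZ[OF uv(1)] ZW[OF uv(2)] ZZ[OF uv] ..
    then show "Om n (D u) (D v) = eps n u v" using uv by (simp add: Om_units)
  qed
qed

text \<open>The compatibility with brackets that \<open>braided_entries\<close> demands of its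
  relation. The bracket of the composed functions is computed once through the Jacobian of
  \<open>phi\<close> and once from the representatives \<open>p'\<close> and
  \<open>r'\<close>.\<close>

lemma poisson_phi:
  assumes x: "positive n x"
    and P: "\<And>y. positive n y \<Longrightarrow> ev n p (phi n q y) = ev n p' y"
    and Q: "\<And>y. positive n y \<Longrightarrow> ev n r (phi n q y) = ev n r' y"
  shows "ev n (pb n p r) (phi n q x) = ev n (pb n p' r') x"
proof -
  obtain D where D: "\<And>v. v \<in> strip n \<Longrightarrow> log_gradient n (\<lambda>x. ln (phi n q x v)) x (D v)"
    "\<And>u v. u \<in> strip n \<Longrightarrow> v \<in> strip n \<Longrightarrow> Om n (D u) (D v) = eps n u v"
    using log_gradient_phi[OF x] by blast
  have "poisson n (\<lambda>x. ev n p (phi n q x)) (\<lambda>x. ev n r (phi n q x)) x = ev n (pb n p r) (phi n q x)"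
    by (rule poisson_ev_compose[OF x D])
  moreover have "poisson n (\<lambda>x. ev n p (phi n q x)) (\<lambda>x. ev n r (phi n q x)) x = ev n (pb n p' r') x"
    by (rule poisson_eq_ev[OF x P Q])
  ultimately show ?thesis by simp
qed

end

section \<open>The effect of the transformation on the elementary source sums\<close>

definition pp :: "(nat \<Rightarrow> real) \<Rightarrow> nat \<Rightarrow> real" where
  "pp y k = (\<Prod>j=1..k. y j)"

lemma pp_0 [simp]: "pp y 0 = 1"
  by (simp add: pp_def)

lemma pp_Suc [simp]: "pp y (Suc k) = pp y k * y (Suc k)"
  by (simp add: pp_def)

lemma tel_pp: "tel N y = sqrt (pp y N) * (\<Sum>k\<le>N. 1 / pp y k)"
  by (simp add: tel_def pp_def)

lemma pp_pos: "(\<And>j. 1 \<le> j \<Longrightarrow> j \<le> k \<Longrightarrow> 0 < y j) \<Longrightarrow> 0 < pp y k"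
  unfolding pp_def by (intro prod_pos) auto

text \<open>The four multipliers have product 1, so only the prefix products ending at
  \<open>c\<close>, \<open>c + 1\<close> and \<open>c + 2\<close> change, and the sum of their
  reciprocals is preserved. In the applications \<open>E\<close>, \<open>e1\<close>,
  \<open>e2\<close>, \<open>e3\<close> are \<open>\<eta>_(k+2)\<close>, ...,
  \<open>\<eta>_(k-1)\<close>, and \<open>p\<close> is the tail product starting at
  \<open>k + 2\<close>.\<close>

lemma tel_quad:
  fixes y y' :: "nat \<Rightarrow> real"
  assumes c: "1 \<le> c" "c + 3 \<le> N"
    and same: "\<And>j. 1 \<le> j \<Longrightarrow> j \<le> N \<Longrightarrow> j < c \<or> c + 3 < j \<Longrightarrow> y' j = y j"
    and pos: "\<And>j. 1 \<le> j \<Longrightarrow> j \<le> N \<Longrightarrow> 0 < y j"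
    and E: "0 < E" "0 < p"
    and e1: "e1 = E + p" and e2: "e2 = e1 + y (c + 2) * p" and e3: "e3 = e2 + y (c + 1) * y (c + 2) * p"
    and y': "y' c = y c * e2 / E" "y' (c + 1) = y (c + 1) * e1 / e3"
      "y' (c + 2) = y (c + 2) * E / e2" "y' (c + 3) = y (c + 3) * e3 / e1"
  shows "tel N y' = tel N y"
proof -
  have y_pos: "0 < y c" "0 < y (c + 1)" "0 < y (c + 2)" "0 < y (c + 3)" using pos c by auto
  have e_pos: "0 < e1" "0 < e2" "0 < e3"
    unfolding e3 e2 e1 using E y_pos by (auto intro!: add_pos_pos mult_pos_pos)
  have low: "pp y' k = pp y k" if "k < c" for k
    unfolding pp_def using that c by (intro prod.cong) (auto intro!: same)
  obtain m where m: "c = Suc m" using c by (cases c) auto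
  have bm: "pp y' m = pp y m" using low m by simp
  have y'm: "y' (Suc m) = y (Suc m) * e2 / E" "y' (Suc (Suc m)) = y (Suc (Suc m)) * e1 / e3"
      "y' (Suc (Suc (Suc m))) = y (Suc (Suc (Suc m))) * E / e2"
      "y' (Suc (Suc (Suc (Suc m)))) = y (Suc (Suc (Suc (Suc m)))) * e3 / e1"
    using y' unfolding m by (simp_all add: eval_nat_numeral)
  have top: "pp y' k = pp y k" if "c + 3 \<le> k" "k \<le> N" for k
    using that
  proof (induction k rule: dec_induct)
    case base
    have e4: "c + 3 = Suc (Suc (Suc (Suc m)))" using m by simp
    show ?case unfolding e4 pp_Suc y'm bm using e_pos E by simp
  next
    case (step k)
    then show ?case using same[of "Suc k"] by simp
  qed
  have K: "{c, c + 1, c + 2} \<subseteq> {..N}" using c by auto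
  have split: "(\<Sum>k\<le>N. 1 / pp z k) = (\<Sum>k\<in>{..N} - {c, c + 1, c + 2}. 1 / pp z k)
      + (1 / pp z c + 1 / pp z (c + 1) + 1 / pp z (c + 2))" for z :: "nat \<Rightarrow> real"
    using sum.subset_diff[OF K, of "\<lambda>k. 1 / pp z k"] by (simp add: add.assoc)
  have rest: "(\<Sum>k\<in>{..N} - {c, c + 1, c + 2}. 1 / pp y' k) = (\<Sum>k\<in>{..N} - {c, c + 1, c + 2}. 1 / pp y k)"
  proof (rule sum.cong[OF refl])
    fix k assume "k \<in> {..N} - {c, c + 1, c + 2}"
    then have "k < c \<or> c + 3 \<le> k \<and> k \<le> N" by auto
    then show "1 / pp y' k = 1 / pp y k" using low top by auto
  qed
  have mid: "1 / pp y' c + 1 / pp y' (c + 1) + 1 / pp y' (c + 2) = 1 / pp y c + 1 / pp y (c + 1) + 1 / pp y (c + 2)"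
  proof -
    define b where "b = y (Suc m)"
    define u where "u = y (Suc (Suc m))"
    define v where "v = y (Suc (Suc (Suc m)))"
    have buv: "0 < b" "0 < u" "0 < v" using y_pos unfolding b_def u_def v_def m by (simp_all add: eval_nat_numeral)
    have e2': "e2 = e1 + v * p" and e3': "e3 = e2 + u * v * p"
      using e2 e3 unfolding u_def v_def m by (simp_all add: eval_nat_numeral)
    have *: "E / (b * e2) + E * e3 / (b * e2 * u * e1) + e3 / (b * u * v * e1) = 1 / b + 1 / (b * u) + 1 / (b * u * v)"
    proof -
      have "E * u * v * e1 + E * v * e3 + e2 * e3 = (u * v + v + 1) * (e2 * e1)"
        unfolding e3' e2' e1 by (simp add: algebra_simps)
      then have "(E * u * v * e1 + E * v * e3 + e2 * e3) / (b * u * v * e1 * e2) = (u * v + v + 1) * (e2 * e1) / (b * u * v * e1 * e2)"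
        by simp
      then show ?thesis using buv e_pos E by (simp add: field_simps)
    qed
    have "1 / pp y' c + 1 / pp y' (c + 1) + 1 / pp y' (c + 2)
        = (1 / pp y m) * (E / (b * e2) + E * e3 / (b * e2 * u * e1) + e3 / (b * u * v * e1))"
    proof -
      have "1 / pp y' (Suc m) = (1 / pp y m) * (E / (b * e2))"
        by (simp add: bm y'm b_def[symmetric])
      moreover have "1 / pp y' (Suc m + 1) = (1 / pp y m) * (E * e3 / (b * e2 * u * e1))"
        by (simp add: bm y'm b_def[symmetric] u_def[symmetric])
      moreover have "1 / pp y' (Suc m + 2) = (1 / pp y m) * (e3 / (b * u * v * e1))"
        using e_pos E by (simp add: bm y'm b_def[symmetric] u_def[symmetric] v_def[symmetric])
      ultimately show ?thesis unfolding m by (simp only: distrib_left)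
    qed
    also have "\<dots> = 1 / pp y c + 1 / pp y (c + 1) + 1 / pp y (c + 2)"
      unfolding * m by (simp add: b_def[symmetric] u_def[symmetric] v_def[symmetric] add_divide_distrib mult_ac)
    finally show ?thesis .
  qed
  show ?thesis
    unfolding tel_pp split rest mid using top[of N] c by simp
qed

context zigzag
begin

text \<open>The reciprocal of a prefix product is a tail divided by the full product, so the
  reciprocals add up to \<open>\<eta>_0 / p_1\<close>.\<close>

lemma tel_pth:
  assumes x: "positive n x"
  shows "tel N (\<lambda>k. x (pth k)) = et x 0 / sqrt (pr x 1)"
proof -
  have T: "0 < pr x 1" using pr_pos[OF x] by simp
  have "pp (\<lambda>k. x (pth k)) k * pr x (k + 1) = pr x 1" if "k \<le> N" for k
    using that
  proof (induction k)
    case (Suc k)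
    then show ?case using pr_Suc[of "Suc k" x] by (simp add: mult_ac)
  qed simp
  then have "pp (\<lambda>k. x (pth k)) k = pr x 1 / pr x (k + 1)" if "k \<le> N" for k
    using that pr_pos[OF x, of "k + 1"] by (simp add: eq_divide_eq)
  then have "1 / pp (\<lambda>k. x (pth k)) k = pr x (k + 1) / pr x 1" if "k \<le> N" for k
    using that by simp
  then have "(\<Sum>k\<le>N. 1 / pp (\<lambda>k. x (pth k)) k) = (\<Sum>k\<le>N. pr x (k + 1)) / pr x 1"
    by (simp add: sum_divide_distrib)
  also have "(\<Sum>k\<le>N. pr x (k + 1)) = et x 0"
    unfolding et_eq by (rule sum.reindex_bij_witness[of _ "\<lambda>r. r - 1" "\<lambda>k. k + 1"]) auto
  finally have "(\<Sum>k\<le>N. 1 / pp (\<lambda>k. x (pth k)) k) = et x 0 / (sqrt (pr x 1) * sqrt (pr x 1))"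
    using T by simp
  moreover have "pp (\<lambda>k. x (pth k)) N = pr x 1" by (simp add: pp_def pr_def)
  moreover have "s * (e / (s * s)) = e / s" for s e :: real by simp
  ultimately show ?thesis unfolding tel_pp by (simp only:)
qed

context
  fixes x x' :: state
  assumes x: "positive n x" and bt: "braid_transformation n q x x'"
begin

lemmas B = braid_transformationD[OF bt]

lemma et_nz: "k \<le> N \<Longrightarrow> 0 < et x k"
  using et_pos[OF x] .

text \<open>Downward induction from \<open>N\<close>: each step multiplies by
  \<open>a'_r = a_r \<eta>_(r+1) / \<eta>_(r-1)\<close>. This is the formula whose logarithmic
  gradient is \<open>tlx'\<close>.\<close>

lemma pr_transformed:
  assumes r: "2 \<le> r" "r \<le> N"
  shows "pr x' r = pr x 1 * pr x r / (et x 1 * et x r * et x (r - 1))"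
  using r(2,1)
proof (induction rule: inc_induct)
  case base
  have "pr x' N = x' (pth N)" "pr x N = x (pth N)" unfolding pr_def by simp_all
  then show ?case unfolding B(3) using et_last by simp
next
  case (step r)
  have "pr x' r = x' (pth r) * pr x' (Suc r)" using step by (intro pr_Suc) auto
  also have "pr x' (Suc r) = pr x 1 * pr x (Suc r) / (et x 1 * et x (Suc r) * et x r)"
    using step by simp
  also have "x' (pth r) = x (pth r) * et x (r + 1) / et x (r - 1)"
    using step by (intro B(2)) auto
  finally show ?case
    using pr_Suc[of r x] step et_nz[of "Suc r"] by (simp add: field_simps)
qed

lemma pr_transformed_1: "pr x' 1 = pr x 1 / (et x 1)\<^sup>2"
proof -
  have N2: "1 \<le> N" "2 \<le> N" using n by auto
  have "pr x' 1 = x' (pth 1) * pr x' 2"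
    using pr_Suc[of 1 x'] N2 by (simp add: numeral_2_eq_2)
  also have "\<dots> = pr x 1 / (et x 1)\<^sup>2"
    unfolding B(1) pr_transformed[OF order_refl N2(2)] using et_nz[OF N2(2)] pr_pos[OF x, of 2]
    by (simp add: power2_eq_square field_simps)
  finally show ?thesis .
qed

text \<open>As \<open>p_(k+1) = \<eta>_k - \<eta>_(k+1)\<close>, the transformed tails are multiples
  of differences of consecutive \<open>1 / \<eta>\<close>, and their sum telescopes.\<close>

lemma et_transformed:
  assumes k: "1 \<le> k" "k \<le> N"
  shows "et x' k = 1 + pr x 1 / et x 1 * (1 - 1 / et x k)"
  using k(2,1)
proof (induction rule: inc_induct)
  case base
  then show ?case using et_last by simp
next
  case (step k)
  have "et x' k = pr x' (k + 1) + et x' (Suc k)" using step et_Suc[of k x'] by simp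
  also have "et x' (Suc k) = 1 + pr x 1 / et x 1 * (1 - 1 / et x (Suc k))" using step by simp
  also have "pr x' (k + 1) = pr x 1 * pr x (k + 1) / (et x 1 * et x (k + 1) * et x k)"
    using pr_transformed[of "k + 1"] step by simp
  also have "pr x (k + 1) = et x k - et x (k + 1)" using et_Suc[of k x] step by simp
  also have "pr x 1 * (et x k - et x (k + 1)) / (et x 1 * et x (k + 1) * et x k)
      + (1 + pr x 1 / et x 1 * (1 - 1 / et x (Suc k))) = 1 + pr x 1 / et x 1 * (1 - 1 / et x k)"
    using et_nz[of "Suc k"] et_nz[of k] et_nz[of 1] step by (simp add: field_simps)
  finally show ?case .
qed

text \<open>In \<open>\<eta>_0 / sqrt p_1\<close> both numerator and denominator are divided by
  \<open>\<eta>_1\<close>.\<close>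

lemma tel_pth_transformed: "tel N (\<lambda>k. x' (pth k)) = tel N (\<lambda>k. x (pth k))"
proof -
  have N1: "1 \<le> N" using n by auto
  have e1: "0 < et x 1" using et_nz[OF N1] .
  have "et x' 0 = pr x' 1 + et x' 1" "et x 0 = pr x 1 + et x 1"
    using et_Suc[of 0] by simp_all
  moreover have "pr x' 1 + et x' 1 = (pr x 1 + et x 1) / et x 1"
    unfolding pr_transformed_1 et_transformed[OF order_refl N1] using e1 by (simp add: field_simps power2_eq_square)
  ultimately have "et x' 0 = et x 0 / et x 1" by simp
  moreover have "sqrt (pr x' 1) = sqrt (pr x 1) / et x 1"
    unfolding pr_transformed_1 using e1 by (simp add: real_sqrt_divide)
  ultimately show ?thesis
    unfolding tel_pth[OF x] tel_pth[OF braid_transformation_positive[OF bt x]] using e1 by simp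
qed

text \<open>Shared by source and target: the path crosses the altered region in the four consecutive
  vertices \<open>b_k, a_k, a_(k+1), b_(k-1)\<close>.\<close>

lemma tel_quad_transformed:
  assumes w: "\<And>j. 1 \<le> j \<Longrightarrow> j \<le> N \<Longrightarrow> w j \<in> strip n"
    and c: "1 \<le> c" "c + 3 \<le> N" and k: "2 \<le> k" "k + 1 < N"
    and wc: "w c = adjv k" "w (c + 1) = pth k" "w (c + 2) = pth (k + 1)" "w (c + 3) = adjv (k - 1)"
    and other: "\<And>j. 1 \<le> j \<Longrightarrow> j \<le> N \<Longrightarrow> j < c \<or> c + 3 < j \<Longrightarrow> w j \<notin> pth ` {1..N} \<and> w j \<notin> adjv ` {1..N - 2}"
  shows "tel N (\<lambda>j. x' (w j)) = tel N (\<lambda>j. x (w j))"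
proof (rule tel_quad[OF c])
  show "x' (w j) = x (w j)" if "1 \<le> j" "j \<le> N" "j < c \<or> c + 3 < j" for j
    using other[OF that] B(5)[OF w] that by auto
  show "0 < x (w j)" if "1 \<le> j" "j \<le> N" for j using w[OF that] x by (simp add: positive_def)
  show "0 < et x (k + 2)" "0 < pr x (k + 2)" using k et_nz[of "k + 2"] pr_pos[OF x, of "k + 2"] by auto
  show "et x (k + 1) = et x (k + 2) + pr x (k + 2)" using et_Suc[of "k + 1" x] k by simp
  show "et x k = et x (k + 1) + x (w (c + 2)) * pr x (k + 2)"
    unfolding wc using et_Suc[of k x] pr_Suc[of "k + 1" x] k by simp
  show "et x (k - 1) = et x k + x (w (c + 1)) * x (w (c + 2)) * pr x (k + 2)"
    unfolding wc using et_Suc[of "k - 1" x] pr_Suc[of "k + 1" x] pr_Suc[of k x] k by simp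
  show "x' (w c) = x (w c) * et x k / et x (k + 2)" unfolding wc using k by (intro B(4)) auto
  show "x' (w (c + 1)) = x (w (c + 1)) * et x (k + 1) / et x (k - 1)" unfolding wc using k by (intro B(2)) auto
  show "x' (w (c + 2)) = x (w (c + 2)) * et x (k + 2) / et x k" unfolding wc using B(2)[of "k + 1"] k by simp
  show "x' (w (c + 3)) = x (w (c + 3)) * et x (k - 1) / et x (k + 1)" unfolding wc using B(4)[of "k - 1"] k by simp
qed

lemma tel_source_far:
  assumes s: "2 \<le> s" "s \<le> n - 2"
  shows "tel N (\<lambda>j. x' (path n (q - 2 * int s) j)) = tel N (\<lambda>j. x (path n (q - 2 * int s) j))"
proof -
  have s': "1 \<le> s" "s \<le> n - 1" using s by auto
  define w where "w = path n (q - 2 * int s)"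
  define c where "c = N - 2 * s"
  have c: "2 \<le> c" "c + 4 \<le> N" "c \<le> N" "c + 1 \<le> N" "c + 2 \<le> N" "c + 3 \<le> N" using s by (auto simp: c_def)
  note P = path_eq_pth[OF s', folded w_def c_def]
  note A = path_eq_adjv[OF s', folded w_def c_def]
  have k: "1 \<le> 2 * s - 1" "2 * s - 1 \<le> N" "2 * s - 1 \<le> N - 2" "1 \<le> 2 * s" "2 * s \<le> N" "1 \<le> 2 * s - 2"
    "2 * s - 2 \<le> N - 2" using s by auto
  have wc: "w c = adjv (2 * s - 1)" "w (c + 1) = pth (2 * s - 1)" "w (c + 2) = pth (2 * s)" "w (c + 3) = adjv (2 * s - 2)"
    using A[of c "2 * s - 1"] P[of "c + 1" "2 * s - 1"] P[of "c + 2" "2 * s"] A[of "c + 3" "2 * s - 2"] c k s by simp_all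
  show ?thesis
    unfolding w_def[symmetric]
  proof (rule tel_quad_transformed[of w c "2 * s - 1"])
    fix j assume j: "1 \<le> j" "j \<le> N" "j < c \<or> c + 3 < j"
    have "w j \<noteq> pth k" if "k \<in> {1..N}" for k using P[OF j(1,2), of k] j(3) that by auto
    moreover have "w j \<noteq> adjv k" if "k \<in> {1..N - 2}" for k using A[OF j(1,2), of k] j(3) that s by auto
    ultimately show "w j \<notin> pth ` {1..N} \<and> w j \<notin> adjv ` {1..N - 2}" by blast
  next
    have e: "2 * s - 1 + 1 = 2 * s" "2 * s - 1 - 1 = 2 * s - 2" using s by auto
    show "w (c + 2) = pth (2 * s - 1 + 1)" "w (c + 3) = adjv (2 * s - 1 - 1)" unfolding e by (rule wc)+
  qed (use c s wc w_def path_in_strip in auto)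
qed

end

end

text \<open>Two Moebius shifts are the identity, so a path displaced forward is also one displaced
  backward by the complementary amount; displacements in one direction cover both.\<close>

lemma path_shift: "n > 0 \<Longrightarrow> path n (q + 2 * int n) k = path n q k"
  unfolding path_def using sv_shift[of n 2 "int ((k + 1) div 2)" "q - int (k div 2)"] by (simp add: algebra_simps)

context zigzag
begin

lemma monom_theta_pth:
  assumes x: "positive n x" and k: "k \<le> N"
  shows "monom_at n (theta pth N k) x = pr x (k + 1) / sqrt (pr x 1)"
proof -
  have "(\<Prod>j=1..k. x (pth j)) * pr x (k + 1) = pr x 1"
    using k
  proof (induction k)
    case (Suc k)
    then show ?case using pr_Suc[of "Suc k" x] by (simp add: mult_ac)
  qed simp
  then have "(\<Prod>j=1..k. x (pth j)) = sqrt (pr x 1) * sqrt (pr x 1) / pr x (k + 1)"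
    using pr_pos[OF x, of "k + 1"] pr_pos[OF x, of 1] by (simp add: eq_divide_eq)
  moreover have "monom_at n (theta pth N k) x = sqrt (pr x 1) / (\<Prod>j=1..k. x (pth j))"
    unfolding pr_def by (rule monom_at_theta[OF _ x k]) (auto intro: path_in_strip)
  moreover have "s / (s * s / p) = p / s" for s p :: real by simp
  ultimately show ?thesis by (simp only:)
qed

lemma sum_monom_theta_pth:
  assumes x: "positive n x" and m: "m \<le> N"
  shows "(\<Sum>k=m..N. monom_at n (theta pth N k) x) = et x m / sqrt (pr x 1)"
proof -
  have "(\<Sum>k=m..N. monom_at n (theta pth N k) x) = (\<Sum>k=m..N. pr x (k + 1)) / sqrt (pr x 1)"
    unfolding sum_divide_distrib by (intro sum.cong refl) (simp add: monom_theta_pth[OF x])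
  also have "(\<Sum>k=m..N. pr x (k + 1)) = et x m"
    unfolding et_eq by (rule sum.reindex_bij_witness[of _ "\<lambda>r. r - 1" "\<lambda>k. k + 1"]) auto
  finally show ?thesis .
qed

lemma monom_theta_pp:
  assumes x: "positive n x" and w: "\<And>j. 1 \<le> j \<Longrightarrow> j \<le> N \<Longrightarrow> w j \<in> strip n" and k: "k \<le> N"
  shows "monom_at n (theta w N k) x = sqrt (pp (\<lambda>j. x (w j)) N) / pp (\<lambda>j. x (w j)) k"
  unfolding pp_def using w by (intro monom_at_theta x k) auto

lemma ev_near_product:
  assumes x: "positive n x"
  defines "y \<equiv> \<lambda>j. x (path n (q - 2) j)"
  shows "ev n near_product x = sqrt (pp y N) / sqrt (pr x 1)
    * ((\<Sum>j<N - 2. et x (2 * ((j + 1) div 2) + 2) / pp y j) + 1 / pp y (N - 2))"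
proof -
  have Y: "monom_at n (theta (path n (q - 2)) N j) x = sqrt (pp y N) / pp y j" if "j \<le> N" for j
    unfolding y_def using that by (intro monom_theta_pp x path_in_strip) auto
  have A: "(\<Sum>k=2 * ((j + 1) div 2) + 2..N. monom_at n (theta pth N k) x)
      = et x (2 * ((j + 1) div 2) + 2) / sqrt (pr x 1)" if j: "j < N - 2" for j
  proof -
    have "2 * ((j + 1) div 2) + 2 \<le> N"
    proof -
      have "(j + 1) div 2 \<le> n - 2" using j by linarith
      then show ?thesis using n by simp
    qed
    then show ?thesis by (rule sum_monom_theta_pth[OF x])
  qed
  have last: "monom_at n (theta pth N N) x = 1 / sqrt (pr x 1)"
    unfolding monom_theta_pth[OF x order_refl] pr_last ..
  have N2: "N - 2 \<le> N" by simp
  have "ev n near_product x = (\<Sum>j<N - 2. sqrt (pp y N) / pp y j * (et x (2 * ((j + 1) div 2) + 2) / sqrt (pr x 1)))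
      + sqrt (pp y N) / pp y (N - 2) * (1 / sqrt (pr x 1))"
  proof -
    have "monom_at n (theta (path n (q - 2)) N j) x * (\<Sum>k=2 * ((j + 1) div 2) + 2..N. monom_at n (theta pth N k) x)
      = sqrt (pp y N) / pp y j * (et x (2 * ((j + 1) div 2) + 2) / sqrt (pr x 1))" if "j \<in> {..<N - 2}" for j
    proof -
      have "j < N - 2" "j \<le> N" using that by auto
      then show ?thesis by (simp only: Y A)
    qed
    then have "(\<Sum>j<N - 2. monom_at n (theta (path n (q - 2)) N j) x * (\<Sum>k=2 * ((j + 1) div 2) + 2..N. monom_at n (theta pth N k) x))
      = (\<Sum>j<N - 2. sqrt (pp y N) / pp y j * (et x (2 * ((j + 1) div 2) + 2) / sqrt (pr x 1)))"
      by (rule sum.cong[OF refl])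
    then show ?thesis
      unfolding near_product_def ev_add ev_sum ev_mult ev_single mult_1_left last Y[OF N2] by (simp only:)
  qed
  also have "\<dots> = sqrt (pp y N) / sqrt (pr x 1)
    * ((\<Sum>j<N - 2. et x (2 * ((j + 1) div 2) + 2) / pp y j) + 1 / pp y (N - 2))"
    unfolding distrib_left sum_distrib_left by (simp add: mult.commute)
  finally show ?thesis .
qed

text \<open>The prefix product of length \<open>j\<close>, for \<open>j \<le> N - 3\<close>, is
  multiplied by \<open>\<eta>_2 / \<eta>_m\<close> with \<open>m = 2 * ((j + 1) div 2) + 2\<close>.
  The resulting numerators \<open>\<eta>_m\<close> are the inner sums of
  \<open>near_product\<close>, and the factor \<open>\<eta>_2\<close> is compensated by the square
  root.\<close>

lemma tel_source_prev:
  assumes x: "positive n x" and bt: "braid_transformation n q x x'"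
  shows "tel N (\<lambda>j. x' (path n (q - 2) j)) = ev n near_product x"
proof -
  note B = braid_transformationD[OF bt]
  define y where "y = (\<lambda>j. x (path n (q - 2) j))"
  define y' where "y' = (\<lambda>j. x' (path n (q - 2) j))"
  have s: "1 \<le> (1::nat)" "1 \<le> n - 1" using n by auto
  have q1: "q - 2 * int 1 = q - 2" by simp
  note P = path_eq_pth[OF s, unfolded q1] and A = path_eq_adjv[OF s, unfolded q1]
  have e: "0 < et x k" if "k \<le> N" for k using et_pos[OF x that] .
  have y_pos: "0 < y j" if "1 \<le> j" "j \<le> N" for j
    using path_in_strip[OF that] x unfolding y_def positive_def by blast
  \<comment> \<open>The last position before the final block \<open>b_1\<close>, \<open>a_1\<close>,
    \<open>a_2\<close>, which needs separate treatment.\<close>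
  define L where "L = N - 3"
  have NL: "N = Suc (Suc (Suc L))" using n unfolding L_def by simp
  have L: "odd L" "3 \<le> L" using n unfolding L_def by auto
  have step_odd: "y' j = y j * et x (j + 1) / et x (j + 3)" if j: "odd j" "j \<le> L" for j
  proof -
    have "path n (q - 2) j = adjv (j + 1)" using A[of j "j + 1"] j NL by (auto elim: oddE)
    then show ?thesis unfolding y_def y'_def using B(4)[of "j + 1"] j NL by (simp add: eval_nat_numeral)
  qed
  have step_even: "y' j = y j" if j: "even j" "1 \<le> j" "j \<le> L" for j
  proof -
    have jN: "j \<le> N" using j NL by simp
    have "path n (q - 2) j \<noteq> pth k" if "k \<in> {1..N}" for k using P[OF j(2) jN, of k] j NL that by auto
    moreover have "path n (q - 2) j \<noteq> adjv k" if "k \<in> {1..N - 2}" for k using A[OF j(2) jN, of k] j NL that by auto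
    ultimately show ?thesis unfolding y_def y'_def using B(5)[OF path_in_strip[OF j(2) jN]] by blast
  qed
  have ppL: "pp y' j = pp y j * et x 2 / et x (2 * ((j + 1) div 2) + 2)" if "j \<le> L" for j
    using that
  proof (induction j)
    case 0
    have "2 * ((0 + 1) div 2) + 2 = (2::nat)" by simp
    moreover have "et x 2 \<noteq> 0" using e[of 2] NL by simp
    ultimately show ?case by (simp only: pp_0 mult_1 divide_self not_False_eq_True)
  next
    case (Suc j)
    show ?case
    proof (cases "even j")
      case True
      then have k: "2 * ((j + 1) div 2) + 2 = j + 2" "2 * ((Suc j + 1) div 2) + 2 = j + 4" by auto
      have IH: "pp y' j = pp y j * et x 2 / et x (j + 2)" using Suc k(1) by simp
      have "Suc j + 1 = j + 2" "Suc j + 3 = j + 4" by simp_all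
      then have so: "y' (Suc j) = y (Suc j) * et x (j + 2) / et x (j + 4)"
        using step_odd[of "Suc j"] True Suc.prems by (simp only: even_Suc) simp
      have "j + 2 \<le> N" using Suc.prems NL by simp
      then show ?thesis unfolding k(2) pp_Suc IH so using e[of "j + 2"] by simp
    next
      case False
      then have "2 * ((j + 1) div 2) + 2 = j + 3" "2 * ((Suc j + 1) div 2) + 2 = j + 3" by presburger+
      then show ?thesis using Suc step_even[of "Suc j"] False by simp
    qed
  qed
  have last: "2 * ((L + 1) div 2) + 2 = N" using L NL by presburger
  have ppL': "pp y' L = pp y L * et x 2" using ppL[of L] unfolding last et_last by simp
  have e123: "0 < et x 1" "0 < et x 2" "0 < et x 3" using e NL L by simp_all
  define b where "b = y (Suc L)"
  define u where "u = x (pth 1)"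
  define v where "v = x (pth 2)"
  have w: "path n (q - 2) (Suc L) = adjv 1" "path n (q - 2) (Suc (Suc L)) = pth 1"
      "path n (q - 2) (Suc (Suc (Suc L))) = pth 2"
    using A[of "Suc L" 1] P[of "Suc (Suc L)" 1] P[of "Suc (Suc (Suc L))" 2] NL L by auto
  have y3: "y (Suc L) = b" "y (Suc (Suc L)) = u" "y (Suc (Suc (Suc L))) = v"
    unfolding b_def u_def v_def y_def w by simp_all
  have y'3: "y' (Suc L) = b * et x 1 / et x 3" "y' (Suc (Suc L)) = et x 2 / pr x 2"
      "y' (Suc (Suc (Suc L))) = v * et x 3 / et x 1"
    using B(4)[of 1] B(1) B(2)[of 2] NL L
    unfolding b_def u_def v_def y_def y'_def w by (simp_all add: eval_nat_numeral)
  have pos: "0 < b" "0 < u" "0 < v" "0 < pp y L" "0 < pr x 3"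
    using y_pos NL L pr_pos[OF x, of 3] unfolding y3[symmetric] by (auto intro!: pp_pos)
  have T: "pr x 1 = u * pr x 2" and p2: "pr x 2 = v * pr x 3"
    using pr_Suc[of 1 x] pr_Suc[of 2 x] NL L unfolding u_def v_def by (simp_all add: eval_nat_numeral)
  have e1: "et x 1 = et x 2 + v * pr x 3" and e2: "et x 2 = et x 3 + pr x 3"
    using et_Suc[of 1 x] et_Suc[of 2 x] p2 NL L by (simp_all add: eval_nat_numeral)
  have N3: "pp y' N = pp y N / pr x 1 * (et x 2)\<^sup>2"
    unfolding NL pp_Suc ppL' y3 y'3 T using e123 pos p2 by (simp add: power2_eq_square field_simps)
  have S: "sqrt (pp y' N) = sqrt (pp y N) / sqrt (pr x 1) * et x 2"
    unfolding N3 using e123 by (simp add: real_sqrt_mult real_sqrt_divide)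
  \<comment> \<open>The final block collapses to one reciprocal, matching the isolated last monomial
    of \<open>near_product\<close>.\<close>
  have three: "1 / pp y' (Suc L) + 1 / pp y' (Suc (Suc L)) + 1 / pp y' (Suc (Suc (Suc L))) = 1 / pp y (Suc L) / et x 2"
  proof -
    have "1 / pp y' (Suc L) + 1 / pp y' (Suc (Suc L)) + 1 / pp y' (Suc (Suc (Suc L)))
        = 1 / (pp y L * b) / et x 2 * (et x 3 / et x 1 * (1 + pr x 2 / et x 2 * (1 + et x 1 / (v * et x 3))))"
      unfolding pp_Suc ppL' y'3 using e123 pos p2 by (simp add: distrib_left mult_ac)
    also have "et x 3 / et x 1 * (1 + pr x 2 / et x 2 * (1 + et x 1 / (v * et x 3))) = 1"
    proof -
      have "et x 2 * et x 3 + v * pr x 3 * et x 3 + pr x 3 * et x 1 = et x 1 * et x 2"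
        unfolding e1 by (simp add: e2 algebra_simps)
      then have "v * et x 3 * (et x 2 * et x 3 + v * pr x 3 * et x 3 + pr x 3 * et x 1) = v * et x 3 * (et x 1 * et x 2)"
        by simp
      then show ?thesis unfolding p2 using e123 pos by (simp add: field_simps)
    qed
    finally show ?thesis unfolding pp_Suc y3 by simp
  qed
  have "tel N y' = sqrt (pp y' N) * ((\<Sum>k\<le>L. 1 / pp y' k)
      + (1 / pp y' (Suc L) + 1 / pp y' (Suc (Suc L)) + 1 / pp y' (Suc (Suc (Suc L)))))"
    unfolding tel_pp NL by (simp add: add.assoc)
  also have "\<dots> = sqrt (pp y N) / sqrt (pr x 1) * (\<Sum>k\<le>L. et x (2 * ((k + 1) div 2) + 2) / pp y k)
      + sqrt (pp y N) / sqrt (pr x 1) * (1 / pp y (Suc L))"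
  proof -
    have "et x 2 * (\<Sum>k\<le>L. 1 / pp y' k) = (\<Sum>k\<le>L. et x (2 * ((k + 1) div 2) + 2) / pp y k)"
      unfolding sum_distrib_left using e123 by (intro sum.cong refl) (simp add: ppL)
    then show ?thesis unfolding S three distrib_left mult.assoc using e123 by simp
  qed
  also have "\<dots> = ev n near_product x"
  proof -
    have "N - 2 = Suc L" using NL by simp
    then show ?thesis
      unfolding ev_near_product[OF x] y_def[symmetric] lessThan_Suc_atMost
      by (simp only: lessThan_Suc_atMost distrib_left)
  qed
  finally show ?thesis unfolding y'_def .
qed

end

context zigzag
begin

lemma zigzag_next: "zigzag n (q + 2)"
  using n q by unfold_locales auto

lemma mirror_div: "k \<le> 2 * M \<Longrightarrow> (2 * M - k) div 2 = M - (k + 1) div (2::nat)"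
  by presburger

lemma sum_from_3: "3 \<le> (M::nat) \<Longrightarrow> (\<Sum>k\<le>M. f k) = f 0 + f 1 + f 2 + (\<Sum>k=3..M. (f k :: real))"
proof -
  assume "3 \<le> M"
  then have "{..M} = {0, 1, 2} \<union> {3..M}" by auto
  then have "(\<Sum>k\<le>M. f k) = (\<Sum>k\<in>{0, 1, 2}. f k) + (\<Sum>k=3..M. f k)"
    by (simp only:) (rule sum.union_disjoint, auto)
  then show ?thesis by simp
qed

text \<open>The element is written as \<open>P * G\<close> minus the product expanded in
  \<open>pb_near_mirror\<close>. The complementary sums then turn into values of
  \<open>\<eta>\<close>, and the isolated monomial of that expansion appears as the subtracted
  term.\<close>

lemma ev_next:
  assumes x: "positive n x"
  defines "y \<equiv> \<lambda>j. x (path n (q + 2) j)"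
  defines "P \<equiv> tele pth N" and "G \<equiv> tele (path n (q + 2)) N"
  shows "ev n (half * P * G + pb n P G) x = sqrt (pp y N) / sqrt (pr x 1)
    * (et x 0 * (1 + 1 / pp y 1 + 1 / pp y 2) - pr x 1 / pp y 2 + (\<Sum>k=3..N. et x (2 * (k div 2) - 1) / pp y k))"
proof -
  interpret nxt: zigzag n "q + 2" by (rule zigzag_next)
  define S' where "S' = sqrt (pp y N)"
  define R where "R = sqrt (pr x 1)"
  have q2: "q + 2 - 2 = q" by simp
  note M = nxt.pb_near_mirror(1)[unfolded q2, folded P_def G_def]
  have Y: "monom_at n (theta (path n (q + 2)) N j) x = S' / pp y j" if "j \<le> N" for j
    unfolding y_def S'_def using that by (intro monom_theta_pp x path_in_strip) auto
  have A0: "monom_at n (theta pth N 0) x = pr x 1 / R"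
    using monom_theta_pth[OF x, of 0] by (simp add: R_def)
  have A: "(\<Sum>k=m..N. monom_at n (theta pth N (N - k)) x) = (et x 0 - et x (N - m + 1)) / R"
    if m: "1 \<le> m" "m \<le> N" for m
  proof -
    have "(\<Sum>k=m..N. monom_at n (theta pth N (N - k)) x) = (\<Sum>k=0..N - m. monom_at n (theta pth N k) x)"
      by (rule sum.reindex_bij_witness[of _ "\<lambda>k. N - k" "\<lambda>k. N - k"]) (use m in auto)
    moreover have "(\<Sum>k=0..N. monom_at n (theta pth N k) x)
        = (\<Sum>k=0..N - m. monom_at n (theta pth N k) x) + (\<Sum>k=N - m + 1..N. monom_at n (theta pth N k) x)"
    proof -
      have "{0..N} = {0..N - m} \<union> {N - m + 1..N}" using m by auto
      then show ?thesis by (simp only:) (rule sum.union_disjoint, auto)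
    qed
    moreover have "N - m + 1 \<le> N" using m by simp
    ultimately show ?thesis
      using sum_monom_theta_pth[OF x, of 0] sum_monom_theta_pth[OF x, of "N - m + 1"]
      by (simp add: R_def diff_divide_distrib)
  qed
  have "ev n (half * P * G - pb n P G) x
      = (\<Sum>j<N - 2. S' / pp y (N - j) * ((et x 0 - et x (N - (2 * ((j + 1) div 2) + 2) + 1)) / R))
        + S' / pp y 2 * (pr x 1 / R)"
  proof -
    have "monom_at n (theta (path n (q + 2)) N (N - j)) x * (\<Sum>k=2 * ((j + 1) div 2) + 2..N. monom_at n (theta pth N (N - k)) x)
        = S' / pp y (N - j) * ((et x 0 - et x (N - (2 * ((j + 1) div 2) + 2) + 1)) / R)" if j: "j \<in> {..<N - 2}" for j
    proof -
      have "(j + 1) div 2 \<le> n - 2" using j by auto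
      then have "1 \<le> 2 * ((j + 1) div 2) + 2" "2 * ((j + 1) div 2) + 2 \<le> N" "N - j \<le> N" using n by auto
      then show ?thesis by (simp only: Y A)
    qed
    then have *: "(\<Sum>j<N - 2. monom_at n (theta (path n (q + 2)) N (N - j)) x * (\<Sum>k=2 * ((j + 1) div 2) + 2..N. monom_at n (theta pth N (N - k)) x))
        = (\<Sum>j<N - 2. S' / pp y (N - j) * ((et x 0 - et x (N - (2 * ((j + 1) div 2) + 2) + 1)) / R))"
      by (rule sum.cong[OF refl])
    have "2 \<le> N" using n by auto
    note Y2 = Y[OF this]
    show ?thesis
      unfolding M ev_add ev_sum ev_mult ev_single mult_1_left A0 Y2 * ..
  qed
  also have "(\<Sum>j<N - 2. S' / pp y (N - j) * ((et x 0 - et x (N - (2 * ((j + 1) div 2) + 2) + 1)) / R))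
      = (\<Sum>k=3..N. S' / pp y k * ((et x 0 - et x (2 * (k div 2) - 1)) / R))"
  proof (rule sum.reindex_bij_witness[of _ "\<lambda>k. N - k" "\<lambda>j. N - j"])
    fix j assume j: "j \<in> {..<N - 2}"
    have "(2 * (n - 1) - j) div 2 = n - 1 - (j + 1) div 2" using j by (intro mirror_div) auto
    moreover have "(j + 1) div 2 + 1 \<le> n - 1" using j n by auto
    then obtain d where d: "n - 1 = (j + 1) div 2 + 1 + d" using le_Suc_ex by blast
    moreover have "N = 2 * (n - 1)" by simp
    moreover have "n - 1 - (j + 1) div 2 = 1 + d" using d by linarith
    ultimately have "N - (2 * ((j + 1) div 2) + 2) + 1 = 2 * ((N - j) div 2) - 1"
      by (simp only: \<open>N = 2 * (n - 1)\<close>) simp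
    then show "S' / pp y (N - j) * ((et x 0 - et x (2 * ((N - j) div 2) - 1)) / R)
        = S' / pp y (N - j) * ((et x 0 - et x (N - (2 * ((j + 1) div 2) + 2) + 1)) / R)" by simp
  qed auto
  finally have minus: "ev n (half * P * G - pb n P G) x = (\<Sum>k=3..N. S' / pp y k * ((et x 0 - et x (2 * (k div 2) - 1)) / R))
        + S' / pp y 2 * (pr x 1 / R)" .
  have evG: "ev n G x = (\<Sum>k\<le>N. S' / pp y k)"
    unfolding G_def tele_def ev_sum ev_single mult_1_left by (intro sum.cong refl) (simp add: Y)
  have evP: "ev n P x = et x 0 / R"
    unfolding P_def R_def tel_pth[OF x, symmetric] by (rule ev_tele[OF _ x]) (auto intro: path_in_strip)
  have "P * G = half * P * G + half * P * G" using laurent.half_mult[of "P * G"] by (simp only: mult.assoc)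
  then have "half * P * G + pb n P G = P * G - (half * P * G - pb n P G)" by (simp add: algebra_simps)
  then have "ev n (half * P * G + pb n P G) x = et x 0 / R * (\<Sum>k\<le>N. S' / pp y k)
      - ((\<Sum>k=3..N. S' / pp y k * ((et x 0 - et x (2 * (k div 2) - 1)) / R)) + S' / pp y 2 * (pr x 1 / R))"
    using minus by (simp only: ev_diff ev_mult evP evG)
  also have "(\<Sum>k=3..N. S' / pp y k * ((et x 0 - et x (2 * (k div 2) - 1)) / R))
      = et x 0 / R * (\<Sum>k=3..N. S' / pp y k) - S' / R * (\<Sum>k=3..N. et x (2 * (k div 2) - 1) / pp y k)"
    unfolding sum_distrib_left sum_subtractf[symmetric] by (intro sum.cong refl) (simp add: diff_divide_distrib right_diff_distrib mult_ac)
  also have "(\<Sum>k\<le>N. S' / pp y k) = S' / pp y 0 + S' / pp y 1 + S' / pp y 2 + (\<Sum>k=3..N. S' / pp y k)"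
    using n by (intro sum_from_3) auto
  finally show ?thesis
    unfolding S'_def[symmetric] R_def[symmetric] by (simp add: algebra_simps)
qed

text \<open>This path starts with \<open>a_(N-1)\<close>, \<open>a_N\<close>,
  \<open>b_(N-2)\<close>. From length 3 on the prefix products acquire the factor
  \<open>p_1 / (\<eta>_(N-1) \<eta>_m)\<close> with \<open>m = 2 * (k div 2) - 1\<close>, which
  reproduces the sum in \<open>ev_next\<close>; the first three terms are compared directly.\<close>

lemma tel_source_next:
  assumes x: "positive n x" and bt: "braid_transformation n q x x'"
  shows "tel N (\<lambda>j. x' (path n (q + 2) j))
    = ev n (half * tele pth N * tele (path n (q + 2)) N + pb n (tele pth N) (tele (path n (q + 2)) N)) x"
proof -
  note B = braid_transformationD[OF bt]
  define y where "y = (\<lambda>j. x (path n (q + 2) j))"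
  define y' where "y' = (\<lambda>j. x' (path n (q + 2) j))"
  have s: "1 \<le> n - 1" "n - 1 \<le> n - 1" using n by auto
  \<comment> \<open>Up to the period \<open>2n\<close> the following path is the one displaced by
    \<open>s = n - 1\<close>, so the intersection lemmas apply to it.\<close>
  have "q - 2 * int (n - 1) + 2 * int n = q + 2" using n by (simp add: of_nat_diff)
  then have sh: "path n (q - 2 * int (n - 1)) k = path n (q + 2) k" for k
    using path_shift[of n "q - 2 * int (n - 1)" k] n by simp
  have nn: "N - 2 * (n - 1) = 0" "2 * (n - 1) = N" "\<not> n - 1 \<le> n - 2" "2 \<le> n - 1" "n - 1 \<noteq> 1" using n by auto
  have P: "path n (q + 2) i = pth k \<longleftrightarrow> (i = 1 \<and> k = N - 1) \<or> (i = 2 \<and> k = N)"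
    if "1 \<le> i" "i \<le> N" "1 \<le> k" "k \<le> N" for i k
    using path_eq_pth[OF s that] unfolding sh nn by (simp only: add_0 diff_self_eq_0)
  have A: "path n (q + 2) i = adjv j \<longleftrightarrow> (i = 3 \<and> j = N - 2) \<or> (even i \<and> i = j + 3)"
    if "1 \<le> i" "i \<le> N" "1 \<le> j" "j \<le> N - 2" for i j
    using path_eq_adjv[OF s that] nn unfolding sh nn by simp
  have e: "0 < et x k" if "k \<le> N" for k using et_pos[OF x that] .
  have y_pos: "0 < y j" if "1 \<le> j" "j \<le> N" for j
    using path_in_strip[OF that] x unfolding y_def positive_def by blast
  have N5: "6 \<le> N" using n by auto
  have w: "path n (q + 2) 1 = pth (N - 1)" "path n (q + 2) 2 = pth N" "path n (q + 2) 3 = adjv (N - 2)"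
    using P[of 1 "N - 1"] P[of 2 N] A[of 3 "N - 2"] N5 by auto
  define u where "u = x (pth (N - 1))"
  define v where "v = x (pth N)"
  define b where "b = x (adjv (N - 2))"
  define T where "T = pr x 1"
  have y3: "y 1 = u" "y 2 = v" "y 3 = b" unfolding y_def w u_def v_def b_def by simp_all
  have NN: "N - 1 + 1 = N" "N - 1 - 1 = N - 2" "N - 2 + 2 = N" "N - 2 + 1 = N - 1" using N5 by auto
  have y'3: "y' 1 = u / et x (N - 2)" "y' 2 = T * v / (et x 1 * et x (N - 1))" "y' 3 = b * et x (N - 2)"
    using B(2)[of "N - 1"] B(3) B(4)[of "N - 2"] N5
    unfolding y'_def w u_def v_def b_def T_def NN et_last by simp_all
  have eN1: "et x (N - 1) = 1 + v"
    using et_Suc[of "N - 1" x] et_last[of x] pr_Suc[of N x] pr_last[of x] N5 unfolding NN v_def by simp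
  have prN: "pr x N = v" using pr_Suc[of N x] pr_last[of x] by (simp add: v_def)
  have prN1: "pr x (N - 1) = u * v" using pr_Suc[of "N - 1" x] prN N5 NN(1) by (simp only: u_def Suc_eq_plus1)
  have eN2: "et x (N - 2) = 1 + v + u * v"
    using et_Suc[of "N - 2" x] prN1 eN1 N5 unfolding NN by simp
  have pos: "0 < u" "0 < v" "0 < b" "0 < T" "0 < et x 1" "0 < et x (N - 1)" "0 < et x (N - 2)"
    using y_pos[of 1] y_pos[of 2] y_pos[of 3] y3 N5 e[of 1] e[of "N - 1"] e[of "N - 2"] pr_pos[OF x, of 1]
    by (auto simp: T_def)
  have pp': "pp y' k = pp y k * T / (et x (N - 1) * et x (2 * (k div 2) - 1))" if k: "3 \<le> k" "k \<le> N" for k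
    using k
  proof (induction k rule: dec_induct)
    case base
    have "pp y' 3 = y' 1 * y' 2 * y' 3" "pp y 3 = y 1 * y 2 * y 3" by (simp_all add: eval_nat_numeral)
    moreover have "2 * (3 div 2) - 1 = (1::nat)" by simp
    ultimately show ?case using pos unfolding y3 y'3 by (simp add: mult_ac)
  next
    case (step k)
    have k: "1 \<le> Suc k" "Suc k \<le> N" "3 \<le> k" using step by auto
    show ?case
    proof (cases "even k")
      case True
      then have h: "2 * (Suc k div 2) - 1 = 2 * (k div 2) - 1" by simp
      have "path n (q + 2) (Suc k) \<noteq> pth j" if "j \<in> {1..N}" for j using P[OF k(1,2), of j] k(3) that by auto
      moreover have "path n (q + 2) (Suc k) \<noteq> adjv j" if "j \<in> {1..N - 2}" for j
        using A[OF k(1,2), of j] True k(3) that by auto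
      ultimately have "y' (Suc k) = y (Suc k)"
        unfolding y_def y'_def using B(5)[OF path_in_strip[OF k(1,2)]] by blast
      then show ?thesis unfolding h pp_Suc using step by simp
    next
      case False
      have j: "1 \<le> k - 2" "k - 2 \<le> N - 2" "Suc k = k - 2 + 3" "k - 2 + 2 = k" using k by auto
      obtain m where m: "k = 2 * m + 1" using False by (auto elim: oddE)
      have h: "2 * (Suc k div 2) - 1 = k" "2 * (k div 2) - 1 = k - 2" unfolding m by auto
      have "even (Suc k)" using False by simp
      then have "path n (q + 2) (Suc k) = adjv (k - 2)" using A[OF k(1,2) j(1,2)] j(3) by blast
      then have "y' (Suc k) = y (Suc k) * et x (k - 2) / et x k"
        unfolding y_def y'_def using B(4)[OF j(1,2)] unfolding j(4) by simp
      moreover have "0 < et x (k - 2)" using k by (intro e) auto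
      ultimately show ?thesis unfolding h pp_Suc using step.IH step.prems unfolding h by simp
    qed
  qed
  have "2 * (N div 2) - 1 = N - 1" by simp
  then have "pp y' N = pp y N * T / (et x (N - 1) * et x (N - 1))" using pp'[of N] N5 by simp
  then have S: "sqrt (pp y' N) = sqrt (pp y N) * sqrt T / et x (N - 1)"
    using pos by (simp add: real_sqrt_mult real_sqrt_divide)
  have T2: "T = sqrt T * sqrt T" using pos by simp
  have sum3: "(\<Sum>k=3..N. 1 / pp y' k) = et x (N - 1) / T * (\<Sum>k=3..N. et x (2 * (k div 2) - 1) / pp y k)"
    unfolding sum_distrib_left by (intro sum.cong refl) (simp add: pp')
  have first: "T / et x (N - 1) * (1 + 1 / pp y' 1 + 1 / pp y' 2)
      = et x 0 * (1 + 1 / pp y 1 + 1 / pp y 2) - T / pp y 2"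
  proof -
    have e0: "et x 0 = T + et x 1" using et_Suc[of 0 x] by (simp add: T_def)
    define c where "c = 1 + v"
    have c: "0 < c" using pos by (simp add: c_def)
    have "T / c * (1 + (c + u * v) / u + (c + u * v) * et x 1 * c / (u * (T * v)))
        = T / c * (1 + v) + T / u + et x 1 * c / (u * v) + et x 1"
      using pos c by (simp add: field_simps)
    also have "T / c * (1 + v) = T" using c by (simp add: c_def)
    also have "T + T / u + et x 1 * c / (u * v) + et x 1 = (T + et x 1) * (1 + 1 / u + 1 / (u * v)) - T / (u * v)"
      unfolding c_def using pos by (simp add: field_simps)
    finally have "T / (1 + v) * (1 + (1 + v + u * v) / u + (1 + v + u * v) * et x 1 * (1 + v) / (u * (T * v)))
        = (T + et x 1) * (1 + 1 / u + 1 / (u * v)) - T / (u * v)"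
      by (simp only: c_def)
    moreover have "pp y' 1 = u / (1 + v + u * v)" "pp y' 2 = u / (1 + v + u * v) * (T * v / (et x 1 * (1 + v)))"
      "pp y 1 = u" "pp y 2 = u * v"
      using y3 y'3 eN1 eN2 by (simp_all add: eval_nat_numeral)
    ultimately show ?thesis unfolding e0 eN1 by (simp add: mult.assoc)
  qed
  have "tel N y' = sqrt (pp y' N) * (1 + 1 / pp y' 1 + 1 / pp y' 2 + (\<Sum>k=3..N. 1 / pp y' k))"
    unfolding tel_pp using sum_from_3[of N "\<lambda>k. 1 / pp y' k"] N5 by simp
  also have "\<dots> = sqrt (pp y N) / sqrt T * (T / et x (N - 1) * (1 + 1 / pp y' 1 + 1 / pp y' 2) +
      (\<Sum>k=3..N. et x (2 * (k div 2) - 1) / pp y k))"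
  proof -
    have "sqrt (pp y N) * sqrt T / et x (N - 1) = sqrt (pp y N) / sqrt T * (T / et x (N - 1))"
    proof -
      have "s * r / e = s / r * (r * r / e)" if "r \<noteq> 0" for s r e :: real using that by simp
      from this[of "sqrt T"] show ?thesis using pos T2 by simp
    qed
    then show ?thesis unfolding S sum3 using pos by (simp add: distrib_left mult.assoc)
  qed
  finally show ?thesis
    unfolding ev_next[OF x] y_def[symmetric] y'_def[symmetric] T_def[symmetric] first[symmetric] .
qed

end

section \<open>Invariance of the elementary target sums\<close>

lemma sv_cross_target:
  assumes n: "n > 0" and d: "0 < d" "d < int n - 1"
    and I: "0 \<le> I'" "I' < int n" and K: "0 \<le> K'" "K' < int n"
  shows "sv n I (q - 2 * d + I') = sv n K (q - K') \<longleftrightarrow>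
    (2 * d = I' + K' \<and> K = I) \<or> (2 * d = I' + K' + int n \<and> K = int n - I)
    \<or> (2 * d + int n = I' + K' \<and> K = int n - I)"
proof
  assume "sv n I (q - 2 * d + I') = sv n K (q - K')"
  then obtain t where t: "q - K' = q - 2 * d + I' + t * int n" "K = (if even t then I else int n - I)"
    using sv_eq_iff[OF n] by blast
  then have e: "t * int n = 2 * d - I' - K'" by linarith
  have "t * int n < 2 * int n" "(-2) * int n < t * int n" unfolding e using d I K by linarith+
  then have "t < 2" "-2 < t" using n by (simp_all only: mult_less_cancel_right)
  then consider "t = -1" | "t = 0" | "t = 1" by linarith
  then show "(2 * d = I' + K' \<and> K = I) \<or> (2 * d = I' + K' + int n \<and> K = int n - I)
    \<or> (2 * d + int n = I' + K' \<and> K = int n - I)"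
    by cases (use t e in auto)
next
  assume "(2 * d = I' + K' \<and> K = I) \<or> (2 * d = I' + K' + int n \<and> K = int n - I)
    \<or> (2 * d + int n = I' + K' \<and> K = int n - I)"
  then show "sv n I (q - 2 * d + I') = sv n K (q - K')"
  proof (elim disjE conjE)
    assume "2 * d = I' + K' + int n" "K = int n - I"
    then show ?thesis unfolding sv_eq_iff[OF n] by (intro exI[of _ 1]) auto
  next
    assume "2 * d + int n = I' + K'" "K = int n - I"
    then show ?thesis unfolding sv_eq_iff[OF n] by (intro exI[of _ "-1"]) auto
  qed (auto simp: sv_eq_iff[OF n] intro!: exI[of _ 0])
qed

lemma path_target_odd: "path_target n q (2 * m + 1) = sv n (int m + 1) (q + int m)"
  by (simp add: path_target_def add.commute)

lemma path_target_even: "path_target n q (2 * m) = sv n (int m) (q + int m)"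
  by (simp add: path_target_def)

lemma path_target_shift: "n > 0 \<Longrightarrow> path_target n (q + 2 * int n) k = path_target n q k"
  unfolding path_target_def using sv_shift[of n 2 "int ((k + 1) div 2)" "q + int (k div 2)"]
  by (simp add: algebra_simps)

lemma nat_parity_cases:
  obtains m :: nat where "j = 2 * m" | m where "j = 2 * m + 1"
  by (meson evenE oddE)

context zigzag
begin

text \<open>A target path descends in the opposite direction along the strip, so it crosses the
  source path once, in two consecutive vertices; the solutions with a Moebius shift violate the
  bounds on \<open>d\<close> and on the positions.\<close>

lemma target_eq_pth:
  assumes d: "1 \<le> d" "d \<le> n - 2" and j: "1 \<le> j" "j \<le> N" and k: "1 \<le> k" "k \<le> N"
  shows "path_target n (q - 2 * int d) j = pth k \<longleftrightarrow> (j = 2 * d \<and> k = 2 * d) \<or> (j = 2 * d + 1 \<and> k = 2 * d + 1)"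
proof -
  have n0: "n > 0" using n by simp
  define e where "e = n - d - 2"
  have e: "n = d + e + 2" using d n unfolding e_def by simp
  have d': "0 < int d" "int d < int n - 1" using d by auto
  have jk: "j \<le> 2 * (d + e) + 2" "k \<le> 2 * (d + e) + 2" using j k e by auto
  show ?thesis
  proof (cases j rule: nat_parity_cases; cases k rule: nat_parity_cases)
    fix a b assume J: "j = 2 * a" and K: "k = 2 * b"
    have a: "0 \<le> int a" "int a < int n" and b: "0 \<le> int b" "int b < int n" using J K jk e k d by auto
    note f = d(1) jk[unfolded J K] j(1)[unfolded J] k(1)[unfolded K]
    show ?thesis unfolding J K path_target_even path_even sv_cross_target[OF n0 d' a b] unfolding e using f
      by (intro iffI; elim disjE conjE; simp; presburger?)
  next
    fix a b assume J: "j = 2 * a" and K: "k = 2 * b + 1"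
    have a: "0 \<le> int a" "int a < int n" and b: "0 \<le> int b" "int b < int n" using J K jk e k d by auto
    note f = d(1) jk[unfolded J K] j(1)[unfolded J] k(1)[unfolded K]
    show ?thesis unfolding J K path_target_even path_odd sv_cross_target[OF n0 d' a b] unfolding e using f
      by (intro iffI; elim disjE conjE; simp; presburger?)
  next
    fix a b assume J: "j = 2 * a + 1" and K: "k = 2 * b"
    have a: "0 \<le> int a" "int a < int n" and b: "0 \<le> int b" "int b < int n" using J K jk e k d by auto
    note f = d(1) jk[unfolded J K] j(1)[unfolded J] k(1)[unfolded K]
    show ?thesis unfolding J K path_target_odd path_even sv_cross_target[OF n0 d' a b] unfolding e using f
      by (intro iffI; elim disjE conjE; simp; presburger?)
  next
    fix a b assume J: "j = 2 * a + 1" and K: "k = 2 * b + 1"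
    have a: "0 \<le> int a" "int a < int n" and b: "0 \<le> int b" "int b < int n" using J K jk e k d by auto
    note f = d(1) jk[unfolded J K] j(1)[unfolded J] k(1)[unfolded K]
    show ?thesis unfolding J K path_target_odd path_odd sv_cross_target[OF n0 d' a b] unfolding e using f
      by (intro iffI; elim disjE conjE; simp; presburger?)
  qed
qed

lemma target_eq_adjv:
  assumes d: "1 \<le> d" "d \<le> n - 2" and j: "1 \<le> j" "j \<le> N" and k: "1 \<le> k" "k \<le> N - 2"
  shows "path_target n (q - 2 * int d) j = adjv k \<longleftrightarrow> (j + 1 = 2 * d \<and> k = 2 * d) \<or> (j = 2 * d + 2 \<and> k + 1 = 2 * d)"
proof -
  have n0: "n > 0" using n by simp
  define e where "e = n - d - 2"
  have e: "n = d + e + 2" using d n unfolding e_def by simp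
  have d': "0 < int d" "int d < int n - 1" using d by auto
  have jk: "j \<le> 2 * (d + e) + 2" "k \<le> 2 * (d + e)" using j k e by auto
  have adj_even': "adjv (2 * b) = sv n (int b) (q - (int b + 1))" for b
    unfolding adj_even by (simp add: algebra_simps)
  show ?thesis
  proof (cases j rule: nat_parity_cases; cases k rule: nat_parity_cases)
    fix a b assume J: "j = 2 * a" and K: "k = 2 * b"
    have a: "0 \<le> int a" "int a < int n" and b: "0 \<le> int b + 1" "int b + 1 < int n" using J K jk e k d by auto
    note f = d(1) jk[unfolded J K] j(1)[unfolded J] k(1)[unfolded K]
    show ?thesis unfolding J K path_target_even adj_even' sv_cross_target[OF n0 d' a b] unfolding e using f
      by (intro iffI; elim disjE conjE; simp; presburger?)
  next
    fix a b assume J: "j = 2 * a" and K: "k = 2 * b + 1"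
    have a: "0 \<le> int a" "int a < int n" and b: "0 \<le> int b" "int b < int n" using J K jk e k d by auto
    note f = d(1) jk[unfolded J K] j(1)[unfolded J] k(1)[unfolded K]
    show ?thesis unfolding J K path_target_even adj_odd sv_cross_target[OF n0 d' a b] unfolding e using f
      by (intro iffI; elim disjE conjE; simp; presburger?)
  next
    fix a b assume J: "j = 2 * a + 1" and K: "k = 2 * b"
    have a: "0 \<le> int a" "int a < int n" and b: "0 \<le> int b + 1" "int b + 1 < int n" using J K jk e k d by auto
    note f = d(1) jk[unfolded J K] j(1)[unfolded J] k(1)[unfolded K]
    show ?thesis unfolding J K path_target_odd adj_even' sv_cross_target[OF n0 d' a b] unfolding e using f
      by (intro iffI; elim disjE conjE; simp; presburger?)
  next
    fix a b assume J: "j = 2 * a + 1" and K: "k = 2 * b + 1"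
    have a: "0 \<le> int a" "int a < int n" and b: "0 \<le> int b" "int b < int n" using J K jk e k d by auto
    note f = d(1) jk[unfolded J K] j(1)[unfolded J] k(1)[unfolded K]
    show ?thesis unfolding J K path_target_odd adj_odd sv_cross_target[OF n0 d' a b] unfolding e using f
      by (intro iffI; elim disjE conjE; simp; presburger?)
  qed
qed

lemma tel_target_far:
  assumes x: "positive n x" and bt: "braid_transformation n q x x'"
    and d: "1 \<le> d" "d \<le> n - 2"
  shows "tel N (\<lambda>j. x' (path_target n (q - 2 * int d) j)) = tel N (\<lambda>j. x (path_target n (q - 2 * int d) j))"
proof -
  define w where "w = path_target n (q - 2 * int d)"
  define c where "c = 2 * d - 1"
  note P = target_eq_pth[OF d, folded w_def] and A = target_eq_adjv[OF d, folded w_def]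
  have c: "1 \<le> c" "c + 3 \<le> N" "c + 1 = 2 * d" "c + 2 = 2 * d + 1" "c + 3 = 2 * d + 2" using d by (auto simp: c_def)
  have w: "w j \<in> strip n" if "1 \<le> j" "j \<le> N" for j
    unfolding w_def using that by (rule path_target_in_strip)
  show ?thesis
    unfolding w_def[symmetric]
  proof (rule tel_quad_transformed[OF x bt w c(1,2), where k = "2 * d"])
    show "2 \<le> 2 * d" "2 * d + 1 < N" using d by auto
    show "w c = adjv (2 * d)" using A[of c "2 * d"] c d by auto
    show "w (c + 1) = pth (2 * d)" using P[of "2 * d" "2 * d"] c d by auto
    show "w (c + 2) = pth (2 * d + 1)" using P[of "2 * d + 1" "2 * d + 1"] c d by auto
    show "w (c + 3) = adjv (2 * d - 1)"
    proof -
      have "1 \<le> 2 * d - 1" "2 * d - 1 \<le> N - 2" "2 * d - 1 + 1 = 2 * d" "1 \<le> 2 * d + 2" "2 * d + 2 \<le> N"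
        using d by auto
      then show ?thesis unfolding c(5) using A[of "2 * d + 2" "2 * d - 1"] by blast
    qed
    fix j assume j: "1 \<le> j" "j \<le> N" "j < c \<or> c + 3 < j"
    have "w j \<noteq> pth k" if "k \<in> {1..N}" for k using P[OF j(1,2), of k] j(3) c that by auto
    moreover have "w j \<noteq> adjv k" if "k \<in> {1..N - 2}" for k using A[OF j(1,2), of k] j(3) c that by auto
    ultimately show "w j \<notin> pth ` {1..N} \<and> w j \<notin> adjv ` {1..N - 2}" by blast
  qed auto
qed

end

lemma sqrt_mult_square: "0 \<le> c \<Longrightarrow> sqrt (a * c * c) = sqrt a * c"
  by (metis abs_of_nonneg mult.assoc real_sqrt_mult real_sqrt_mult_self)

context zigzag
begin

text \<open>The contribution of two consecutive vertices \<open>b\<^sub>k\<close>, \<open>a\<^sub>k\<close> of a target path.\<close>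

lemma pair_step:
  fixes a e0 e1 e2 Q s :: real
  assumes "0 < a" "0 < e1" "0 < Q" "e0 = e1 + a * p" "e1 = e2 + p"
  shows "s * (e2 / (e1 * Q)) + s * (e0 / (e1 * (Q * a))) = s * (1 / Q + 1 / (Q * a))"
proof -
  have "e2 * a + e0 = e1 * (a + 1)" using assms(4,5) by (simp add: algebra_simps)
  then have "(e2 * a + e0) / (e1 * (Q * a)) = e1 * (a + 1) / (e1 * (Q * a))" by simp
  then have "e2 / (e1 * Q) + e0 / (e1 * (Q * a)) = 1 / Q + 1 / (Q * a)"
    using assms(1-3) by (simp add: add_divide_distrib)
  then show ?thesis by (simp only: distrib_left[symmetric])
qed

text \<open>The Moebius rule turns positions read forward on this target path into positions read
  backward on the source path: after \<open>a_1\<close>, \<open>a_N\<close> it alternates between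
  \<open>b_(2s)\<close> and \<open>a_(2s)\<close> with \<open>s\<close> decreasing to 1.\<close>

lemma target_same_even:
  assumes "m + s = n"
  shows "path_target n q (2 * m) = pth (2 * s)"
proof -
  have "int n = int m + int s" using assms by simp
  then have e: "q - int s + int n = q + int m" "int n - (int m) = int s" by simp_all
  have "sv n (int m) (q - int s + int n) = sv n (int n - (int m)) (q - int s)"
    using n by (intro sv_moebius) simp
  then show ?thesis unfolding path_target_even path_even e .
qed

lemma target_same_odd:
  assumes "m + s + 1 = n"
  shows "path_target n q (2 * m + 1) = adjv (2 * s)"
proof -
  have "int n = int m + int s + 1" using assms by simp
  then have e: "q - int s - 1 + int n = q + int m" "int n - (int m + 1) = int s" by simp_all
  have "sv n (int m + 1) (q - int s - 1 + int n) = sv n (int n - (int m + 1)) (q - int s - 1)"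
    using n by (intro sv_moebius) simp
  then show ?thesis unfolding path_target_odd adj_even e .
qed

text \<open>The next target path starts at \<open>a_(N-1)\<close>, alternates between
  \<open>b_(2s+1)\<close> and \<open>a_(2s+1)\<close> with \<open>s\<close> decreasing to 0, and
  ends at \<open>a_N\<close>.\<close>

lemma target_next_even:
  assumes "m + s + 2 = n"
  shows "path_target n (q + 2) (2 * m) = adjv (2 * s + 1)"
proof -
  have "int n = int m + int s + 2" using assms by simp
  then have e: "q - int s + int n = q + 2 + int m" "int n - (int m) = int s + 2" by simp_all
  have "sv n (int m) (q - int s + int n) = sv n (int n - (int m)) (q - int s)"
    using n by (intro sv_moebius) simp
  then show ?thesis unfolding path_target_even adj_odd e .
qed

lemma target_next_odd:
  assumes "m + s + 2 = n"
  shows "path_target n (q + 2) (2 * m + 1) = pth (2 * s + 1)"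
proof -
  have "int n = int m + int s + 2" using assms by simp
  then have e: "q - int s + int n = q + 2 + int m" "int n - (int m + 1) = int s + 1" by simp_all
  have "sv n (int m + 1) (q - int s + int n) = sv n (int n - (int m + 1)) (q - int s)"
    using n by (intro sv_moebius) simp
  then show ?thesis unfolding path_target_odd path_odd e .
qed

lemma target_next_last: "path_target n (q + 2) N = pth N"
proof -
  have N': "N = 2 * (n - 1)" by simp
  have m: "int (n - 1) = int n - 1" using n by (simp add: of_nat_diff)
  have "sv n (int n - 1) (q + 1 + int n) = sv n 1 (q + 1)"
    using sv_moebius[of n "int n - 1" "q + 1"] n by simp
  moreover have "sv n 1 (q + 1 - int n + int n) = sv n (int n - 1) (q + 1 - int n)"
    using n by (intro sv_moebius) simp
  ultimately show ?thesis
    unfolding N' path_target_even path_even m by (simp add: algebra_simps)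
qed

context
  fixes x x' :: state
  assumes x: "positive n x" and bt: "braid_transformation n q x x'"
begin

lemmas bt_pth1 = braid_transformationD(1)[OF bt]
lemmas bt_mid = braid_transformationD(2)[OF bt]
lemmas bt_last = braid_transformationD(3)[OF bt]
lemmas bt_adj = braid_transformationD(4)[OF bt]

lemma path_edge_values:
  shows "et x N = 1" "et x (N - 1) = 1 + x (pth N)" "et x (N - 2) = 1 + x (pth N) + x (pth (N - 1)) * x (pth N)"
    "pr x 1 = x (pth 1) * pr x 2" "et x 1 = et x 2 + pr x 2"
proof -
  have NN: "N - 1 + 1 = N" "N - 2 + 1 = N - 1" "1 \<le> N" "N - 1 \<le> N" "N - 2 \<le> N" "2 \<le> N" using n by auto
  have pN: "pr x N = x (pth N)" unfolding pr_def by simp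
  have "pr x (N - 1) = x (pth (N - 1)) * pr x (Suc (N - 1))" using NN by (intro pr_Suc) auto
  then have pN1: "pr x (N - 1) = x (pth (N - 1)) * x (pth N)" using NN(1) pN by simp
  show "et x N = 1" by (rule et_last)
  show e1: "et x (N - 1) = 1 + x (pth N)"
    using et_Suc[of "N - 1" x] pN et_last NN by simp
  show "et x (N - 2) = 1 + x (pth N) + x (pth (N - 1)) * x (pth N)"
    using et_Suc[of "N - 2" x] pN1 e1 NN by simp
  show "pr x 1 = x (pth 1) * pr x 2" using pr_Suc[of 1 x] NN by (simp add: numeral_2_eq_2)
  show "et x 1 = et x 2 + pr x 2" using et_Suc[of 1 x] NN by (simp add: numeral_2_eq_2)
qed

text \<open>By induction over the blocks \<open>b_k, a_k\<close> all partial sums of reciprocals are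
  multiplied by \<open>\<eta>_1 / \<eta>_2\<close>, while the full product is multiplied by the
  square of the inverse; the square root restores the balance.\<close>

lemma tel_target_same: "tel N (\<lambda>j. x' (path_target n q j)) = tel N (\<lambda>j. x (path_target n q j))"
proof -
  define y where "y = (\<lambda>j. x (path_target n q j))"
  define y' where "y' = (\<lambda>j. x' (path_target n q j))"
  have e: "0 < et x k" if "k \<le> N" for k using et_pos[OF x that] .
  have y_pos: "0 < y j" if "1 \<le> j" "j \<le> N" for j
    using path_target_in_strip[OF that] x unfolding y_def positive_def by blast
  have N5: "6 \<le> N" using n by auto
  define e1 where "e1 = et x 1"
  define e2 where "e2 = et x 2"
  define u where "u = x (pth 1)"
  define v where "v = x (pth N)"
  define p where "p = pr x 2"
  have pos: "0 < e1" "0 < e2" "0 < u" "0 < v" "0 < p"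
    using e[of 1] e[of 2] N5 pth_pos[OF x, of 1] pth_pos[OF x, of N] pr_pos[OF x, of 2]
    by (auto simp: e1_def e2_def u_def v_def p_def)
  have w1: "path_target n q 1 = pth 1" "path_target n q 2 = pth N"
  proof -
    have "2 * (n - 1) = N" "2 * 1 = (2::nat)" "1 + (n - 1) = n" using n by auto
    then show "path_target n q 2 = pth N" using target_same_even[of 1 "n - 1"] by (simp only:)
  qed (simp add: path_target_def path_def)
  have y12: "y 1 = u" "y 2 = v" unfolding y_def w1 u_def v_def by simp_all
  have T: "pr x 1 = u * p" and e12: "e1 = e2 + p" and eN: "et x N = 1" "et x (N - 1) = 1 + v"
    using path_edge_values unfolding u_def p_def e1_def e2_def v_def by simp_all
  have y'12: "y' 1 = e2 / p" "y' 2 = u * p * v / (e1 * (1 + v))"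
    unfolding y'_def w1 bt_pth1 bt_last T eN by (simp_all add: e1_def e2_def p_def v_def)
  \<comment> \<open>The prefix product carries the additional quotient
    \<open>\<eta>_(2s) / \<eta>_(2s-1)\<close>; at the end, where \<open>s = 1\<close>, it becomes a
    second factor \<open>\<eta>_2 / \<eta>_1\<close>.\<close>
  have main: "pp y' (2 * m) = pp y (2 * m) * (e2 / e1) * (et x (2 * s) / et x (2 * s - 1))
      \<and> (\<Sum>j\<le>2 * m. 1 / pp y' j) = e1 / e2 * (\<Sum>j\<le>2 * m. 1 / pp y j)"
    if "1 \<le> m" "m + s = n" "1 \<le> s" for m s
    using that
  proof (induction m arbitrary: s rule: dec_induct)
    case base
    then have s: "2 * s = N" "2 * s - 1 = N - 1" by auto
    have c: "0 < 1 + v" using pos by simp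
    have 1: "pp y' 2 = u * v * (e2 / e1) * (1 / (1 + v))" "pp y 2 = u * v"
      "pp y' 1 = e2 / p" "pp y 1 = u"
      using y12 y'12 pos by (simp_all add: eval_nat_numeral)
    have "1 + 1 / (e2 / p) + 1 / (u * v * (e2 / e1) * (1 / (1 + v))) = e1 / e2 * (1 + 1 / u + 1 / (u * v))"
    proof -
      have "1 + 1 / (e2 / p) = e1 / e2" using pos e12 by (simp add: field_simps)
      moreover have "1 / (u * v * (e2 / e1) * (1 / (1 + v))) = e1 / e2 * ((1 + v) / (u * v))"
        by simp
      moreover have "(1 + v) / (u * v) = 1 / u + 1 / (u * v)" using pos by (simp add: field_simps)
      ultimately show ?thesis by (simp add: distrib_left)
    qed
    moreover have "(\<Sum>j\<le>2 * 1. 1 / pp z j) = 1 + 1 / pp z 1 + 1 / pp z 2" for z :: "nat \<Rightarrow> real"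
      by (simp add: eval_nat_numeral)
    ultimately show ?case unfolding s eN using 1 by (simp add: One_nat_def[symmetric] del: One_nat_def)
  next
    case (step m)
    define r where "r = s"
    have r: "m + r + 1 = n" "1 \<le> r" using step.prems r_def by auto
    have k: "1 \<le> 2 * r" "2 * r \<le> N - 2" "2 \<le> 2 * r" "2 * r < N" using r step.hyps by auto
    define Q where "Q = pp y (2 * m + 1)"
    define a where "a = x (pth (2 * r))"
    have w: "path_target n q (2 * m + 1) = adjv (2 * r)" "path_target n q (2 * m + 2) = pth (2 * r)"
      using target_same_odd[of m r] target_same_even[of "m + 1" r] r by simp_all
    have IH: "pp y' (2 * m) = pp y (2 * m) * (e2 / e1) * (et x (2 * r + 2) / et x (2 * r + 1))"
        "(\<Sum>j\<le>2 * m. 1 / pp y' j) = e1 / e2 * (\<Sum>j\<le>2 * m. 1 / pp y j)"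
      using step.IH[of "r + 1"] r by simp_all
    have ek: "0 < et x (2 * r + 2)" "0 < et x (2 * r + 1)" "0 < et x (2 * r)" "0 < et x (2 * r - 1)"
      using k by (auto intro!: e)
    have y'1: "y' (2 * m + 1) = y (2 * m + 1) * et x (2 * r) / et x (2 * r + 2)"
      unfolding y_def y'_def w using bt_adj[OF k(1,2)] .
    have y2: "y (2 * m + 2) = a" unfolding y_def w a_def ..
    have y'2: "y' (2 * m + 2) = a * et x (2 * r + 1) / et x (2 * r - 1)"
      unfolding y'_def w a_def using bt_mid[OF k(3,4)] .
    have a: "0 < a" "0 < Q"
    proof -
      show "0 < a" using y_pos[of "2 * m + 2"] r y2 by simp
      show "0 < Q" unfolding Q_def by (rule pp_pos, rule y_pos) (use r in auto)
    qed
    have A: "pp y' (2 * m + 1) = Q * (e2 / e1) * (et x (2 * r) / et x (2 * r + 1))"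
      using IH(1) y'1 ek unfolding Q_def by simp
    have B: "pp y' (2 * m + 2) = Q * a * (e2 / e1) * (et x (2 * r) / et x (2 * r - 1))"
    proof -
      have "pp y' (2 * m + 2) = pp y' (2 * m + 1) * y' (2 * m + 2)" by simp
      then show ?thesis unfolding A y'2 using ek by simp
    qed
    have C: "pp y (2 * m + 2) = Q * a"
    proof -
      have "pp y (2 * m + 2) = pp y (2 * m + 1) * y (2 * m + 2)" by simp
      then show ?thesis unfolding y2 Q_def .
    qed
    have "1 / pp y' (2 * m + 1) + 1 / pp y' (2 * m + 2)
        = e1 / e2 * (et x (2 * r + 1) / (et x (2 * r) * Q)) + e1 / e2 * (et x (2 * r - 1) / (et x (2 * r) * (Q * a)))"
      unfolding A B by (simp add: mult_ac)
    also have "\<dots> = e1 / e2 * (1 / Q + 1 / (Q * a))"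
    proof (rule pair_step[of _ _ _ _ "pr x (2 * r + 1)"])
      show "et x (2 * r - 1) = et x (2 * r) + a * pr x (2 * r + 1)"
        using et_Suc[of "2 * r - 1" x] pr_Suc[of "2 * r" x] k unfolding a_def by simp
      show "et x (2 * r) = et x (2 * r + 1) + pr x (2 * r + 1)"
        using et_Suc[of "2 * r" x] k by simp
    qed (use a ek in auto)
    finally have D: "1 / pp y' (2 * m + 1) + 1 / pp y' (2 * m + 2) = e1 / e2 * (1 / Q + 1 / (Q * a))" .
    have sp: "(\<Sum>j\<le>2 * Suc m. 1 / pp z j) = (\<Sum>j\<le>2 * m. 1 / pp z j) + (1 / pp z (2 * m + 1) + 1 / pp z (2 * m + 2))"
      for z :: "nat \<Rightarrow> real" by (simp add: add.assoc)
    have E: "(\<Sum>j\<le>2 * Suc m. 1 / pp y' j) = e1 / e2 * (\<Sum>j\<le>2 * Suc m. 1 / pp y j)"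
      unfolding sp D IH(2) C Q_def[symmetric] by (simp only: distrib_left)
    have m2: "2 * Suc m = 2 * m + 2" by simp
    show ?case using E B C unfolding m2 r_def by simp
  qed
  have M: "2 * (n - 1) = N" "1 \<le> n - 1" "n - 1 + 1 = n" "2 - 1 = (1::nat)" "2 * 1 = (2::nat)" using n by auto
  have "pp y' N = pp y N * (e2 / e1) * (e2 / e1)" "(\<Sum>j\<le>N. 1 / pp y' j) = e1 / e2 * (\<Sum>j\<le>N. 1 / pp y j)"
    using main[OF M(2,3) order_refl] unfolding M(1,5) unfolding M(4) e1_def e2_def by blast+
  then have "tel N y' = tel N y"
    unfolding tel_pp using pos by (simp only: sqrt_mult_square divide_nonneg_pos less_imp_le) simp
  then show ?thesis unfolding y_def y'_def .
qed

text \<open>The same induction with common factor \<open>E = \<eta>_(N-1)\<close>, followed by the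
  closing block \<open>b_1, a_1, a_N\<close>, whose three reciprocals are multiplied by
  \<open>E\<close> as a group.\<close>

lemma tel_target_next: "tel N (\<lambda>j. x' (path_target n (q + 2) j)) = tel N (\<lambda>j. x (path_target n (q + 2) j))"
proof -
  define y where "y = (\<lambda>j. x (path_target n (q + 2) j))"
  define y' where "y' = (\<lambda>j. x' (path_target n (q + 2) j))"
  have e: "0 < et x k" if "k \<le> N" for k using et_pos[OF x that] .
  have y_pos: "0 < y j" if "1 \<le> j" "j \<le> N" for j
    using path_target_in_strip[OF that] x unfolding y_def positive_def by blast
  define E where "E = et x (N - 1)"
  define v where "v = x (pth N)"
  have E: "0 < E" "E = 1 + v" using e[of "N - 1"] path_edge_values(2) by (simp_all add: E_def v_def)
  have v: "0 < v" unfolding v_def using pth_pos[OF x, of N] n by auto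
  have main: "pp y' (2 * m + 1) = pp y (2 * m + 1) * (1 / E) * (et x (2 * s + 1) / et x (2 * s))
      \<and> (\<Sum>j\<le>2 * m + 1. 1 / pp y' j) = E * (\<Sum>j\<le>2 * m + 1. 1 / pp y j)"
    if "m + s + 2 = n" "1 \<le> s" for m s
    using that
  proof (induction m arbitrary: s)
    case 0
    then have s: "2 * s = N - 2" "2 * s + 1 = N - 1" "2 * s + 2 = N" by auto
    define a where "a = x (pth (N - 1))"
    have k: "2 \<le> N - 1" "N - 1 < N" "N - 1 + 1 = N" "N - 1 - 1 = N - 2" using n by auto
    have a: "0 < a" unfolding a_def using n by (intro pth_pos[OF x]) auto
    have w: "path_target n (q + 2) 1 = pth (N - 1)"
      using target_next_odd[OF "0.prems"(1)] s(2) by (simp only: mult_0_right add_0)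
    have y1: "y 1 = a" "y' 1 = a / et x (N - 2)"
      using bt_mid[OF k(1,2)] path_edge_values(1) unfolding y_def y'_def w a_def k(3,4) by simp_all
    have eN2: "0 < et x (N - 2)" by (intro e) simp
    have "et x (N - 2) = E + a * v" using path_edge_values(3) E by (simp add: a_def v_def)
    then have "1 + et x (N - 2) / a = E * (1 + 1 / a)" using a E by (simp add: field_simps)
    moreover have "pp y' 1 = a / et x (N - 2)" "pp y 1 = a" using y1 by simp_all
    ultimately show ?case
      unfolding s(2) unfolding s(1) E_def[symmetric] using E eN2 by simp
  next
    case (Suc m)
    have r: "m + (s + 1) + 2 = n" "1 \<le> s" using Suc.prems by auto
    have k: "1 \<le> 2 * s + 1" "2 * s + 1 \<le> N - 2" "2 \<le> 2 * s + 1" "2 * s + 1 < N" using r by auto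
    define Q where "Q = pp y (2 * m + 2)"
    define a where "a = x (pth (2 * s + 1))"
    have w: "path_target n (q + 2) (2 * m + 2) = adjv (2 * s + 1)" "path_target n (q + 2) (2 * m + 3) = pth (2 * s + 1)"
      using target_next_even[of "Suc m" s] target_next_odd[of "Suc m" s] Suc.prems by (simp_all add: eval_nat_numeral)
    have IH: "pp y' (2 * m + 1) = pp y (2 * m + 1) * (1 / E) * (et x (2 * s + 3) / et x (2 * s + 2))"
        "(\<Sum>j\<le>2 * m + 1. 1 / pp y' j) = E * (\<Sum>j\<le>2 * m + 1. 1 / pp y j)"
    proof -
      have i: "2 * (s + 1) + 1 = 2 * s + 3" "2 * (s + 1) = 2 * s + 2" by simp_all
      have "1 \<le> s + 1" by simp
      from Suc.IH[OF r(1) this]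
      show "pp y' (2 * m + 1) = pp y (2 * m + 1) * (1 / E) * (et x (2 * s + 3) / et x (2 * s + 2))"
        "(\<Sum>j\<le>2 * m + 1. 1 / pp y' j) = E * (\<Sum>j\<le>2 * m + 1. 1 / pp y j)"
        unfolding i(1) unfolding i(2) by blast+
    qed
    have ek: "0 < et x (2 * s + 3)" "0 < et x (2 * s + 2)" "0 < et x (2 * s + 1)" "0 < et x (2 * s)"
    proof -
      have "2 * s + 3 \<le> N" "2 * s + 2 \<le> N" "2 * s + 1 \<le> N" "2 * s \<le> N" using r by auto
      from this[THEN e] show "0 < et x (2 * s + 3)" "0 < et x (2 * s + 2)" "0 < et x (2 * s + 1)" "0 < et x (2 * s)" .
    qed
    have y'1: "y' (2 * m + 2) = y (2 * m + 2) * et x (2 * s + 1) / et x (2 * s + 3)"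
    proof -
      have "2 * s + 1 + 2 = 2 * s + 3" by simp
      then show ?thesis unfolding y_def y'_def w using bt_adj[OF k(1,2)] by (simp only:)
    qed
    have y2: "y (2 * m + 3) = a" unfolding y_def w a_def ..
    have y'2: "y' (2 * m + 3) = a * et x (2 * s + 2) / et x (2 * s)"
    proof -
      have "2 * s + 1 + 1 = 2 * s + 2" "2 * s + 1 - 1 = 2 * s" by simp_all
      then show ?thesis unfolding y'_def w a_def using bt_mid[OF k(3,4)] by (simp only:)
    qed
    have a: "0 < a" "0 < Q"
    proof -
      show "0 < a" using y_pos[of "2 * m + 3"] r y2 by simp
      show "0 < Q" unfolding Q_def by (rule pp_pos, rule y_pos) (use r in auto)
    qed
    have A: "pp y' (2 * m + 2) = Q * (1 / E) * (et x (2 * s + 1) / et x (2 * s + 2))"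
    proof -
      have "pp z (2 * m + 2) = pp z (2 * m + 1) * z (2 * m + 2)" for z :: "nat \<Rightarrow> real" by simp
      then show ?thesis unfolding Q_def using IH(1) y'1 ek by simp
    qed
    have p3: "pp z (2 * m + 3) = pp z (2 * m + 2) * z (2 * m + 3)" for z :: "nat \<Rightarrow> real"
      by (simp add: eval_nat_numeral)
    have B: "pp y' (2 * m + 3) = Q * a * (1 / E) * (et x (2 * s + 1) / et x (2 * s))"
      unfolding p3 A y'2 using ek by simp
    have C: "pp y (2 * m + 3) = Q * a"
      unfolding p3 y2 Q_def ..
    have "1 / pp y' (2 * m + 2) + 1 / pp y' (2 * m + 3)
        = E * (et x (2 * s + 2) / (et x (2 * s + 1) * Q)) + E * (et x (2 * s) / (et x (2 * s + 1) * (Q * a)))"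
      unfolding A B by (simp add: mult_ac)
    also have "\<dots> = E * (1 / Q + 1 / (Q * a))"
    proof (rule pair_step[of _ _ _ _ "pr x (2 * s + 2)"])
      show "et x (2 * s) = et x (2 * s + 1) + a * pr x (2 * s + 2)"
        using et_Suc[of "2 * s" x] pr_Suc[of "2 * s + 1" x] k unfolding a_def by simp
      show "et x (2 * s + 1) = et x (2 * s + 2) + pr x (2 * s + 2)"
        using et_Suc[of "2 * s + 1" x] k by simp
    qed (use a ek in auto)
    finally have D: "1 / pp y' (2 * m + 2) + 1 / pp y' (2 * m + 3) = E * (1 / Q + 1 / (Q * a))" .
    have sp: "(\<Sum>j\<le>2 * m + 3. 1 / pp z j) = (\<Sum>j\<le>2 * m + 1. 1 / pp z j) + (1 / pp z (2 * m + 2) + 1 / pp z (2 * m + 3))"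
      for z :: "nat \<Rightarrow> real" by (simp add: eval_nat_numeral add.assoc)
    have F: "(\<Sum>j\<le>2 * m + 3. 1 / pp y' j) = E * (\<Sum>j\<le>2 * m + 3. 1 / pp y j)"
      unfolding sp D IH(2) C Q_def[symmetric] by (simp only: distrib_left)
    have m3: "2 * Suc m + 1 = 2 * m + 3" by simp
    show ?case unfolding m3 using F B C by simp
  qed
  define L where "L = N - 3"
  have NL: "N = Suc (Suc (Suc L))" using n unfolding L_def by simp
  define e1 where "e1 = et x 1"
  define e2 where "e2 = et x 2"
  define e3 where "e3 = et x 3"
  define u where "u = x (pth 1)"
  define p where "p = pr x 2"
  define Q where "Q = pp y (Suc L)"
  have pos: "0 < e1" "0 < e2" "0 < e3" "0 < u" "0 < p"
    using e[of 1] e[of 2] e[of 3] n pth_pos[OF x, of 1] pr_pos[OF x, of 2]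
    by (auto simp: e1_def e2_def e3_def u_def p_def)
  have e12: "e1 = e2 + p" and T: "pr x 1 = u * p"
    using path_edge_values by (simp_all add: e1_def e2_def p_def u_def)
  have ppL: "pp y' L = pp y L * (1 / E) * (e3 / e2)" and sumL: "(\<Sum>j\<le>L. 1 / pp y' j) = E * (\<Sum>j\<le>L. 1 / pp y j)"
  proof -
    have "2 * (n - 3) + 1 = L" "2 * 1 + 1 = (3::nat)" "2 * 1 = (2::nat)" "n - 3 + 1 + 2 = n" using n by (auto simp: L_def)
    then show "pp y' L = pp y L * (1 / E) * (e3 / e2)" "(\<Sum>j\<le>L. 1 / pp y' j) = E * (\<Sum>j\<le>L. 1 / pp y j)"
      using main[of "n - 3" 1] unfolding e2_def e3_def by (simp_all only:)
  qed
  have w: "path_target n (q + 2) (Suc L) = adjv 1" "path_target n (q + 2) (Suc (Suc L)) = pth 1"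
    "path_target n (q + 2) (Suc (Suc (Suc L))) = pth N"
  proof -
    have "2 * (n - 2) = Suc L" "2 * 0 + 1 = (1::nat)" "2 * (n - 2) + 1 = Suc (Suc L)" "n - 2 + 0 + 2 = n" using n by (auto simp: L_def)
    then show "path_target n (q + 2) (Suc L) = adjv 1" "path_target n (q + 2) (Suc (Suc L)) = pth 1"
      using target_next_even[of "n - 2" 0] target_next_odd[of "n - 2" 0] by (simp_all only:)
    show "path_target n (q + 2) (Suc (Suc (Suc L))) = pth N"
      using target_next_last unfolding NL[symmetric] .
  qed
  have y3: "y (Suc (Suc L)) = u" "y (Suc (Suc (Suc L))) = v"
    unfolding y_def w u_def v_def by simp_all
  have y'1: "y' (Suc L) = y (Suc L) * e1 / e3"
  proof -
    have "1 \<le> N - 2" "1 + 2 = (3::nat)" using n by auto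
    then show ?thesis using bt_adj[of 1] unfolding y_def y'_def w e1_def e3_def by (simp add: numeral_3_eq_3)
  qed
  have y'23: "y' (Suc (Suc L)) = e2 / p" "y' (Suc (Suc (Suc L))) = u * p * v / (e1 * E)"
    unfolding y'_def w bt_pth1 bt_last T by (simp_all add: e1_def e2_def p_def v_def E_def)
  have Q: "0 < Q" unfolding Q_def by (rule pp_pos, rule y_pos) (use NL in auto)
  have A: "pp y' (Suc L) = Q * (1 / E) * (e1 / e2)"
    unfolding Q_def pp_Suc ppL y'1 using pos by simp
  have B: "pp y' (Suc (Suc L)) = Q * (1 / E) * (e1 / p)"
    unfolding pp_Suc[of _ "Suc L"] A y'23 using pos by simp
  have C: "pp y' (Suc (Suc (Suc L))) = Q * u * v * (1 / E) * (1 / E)"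
    unfolding pp_Suc[of _ "Suc (Suc L)"] B y'23 using pos by simp
  have D: "pp y (Suc (Suc L)) = Q * u" "pp y (Suc (Suc (Suc L))) = Q * u * v"
    unfolding pp_Suc[of _ "Suc (Suc L)"] pp_Suc[of _ "Suc L"] y3 Q_def by simp_all
  have three: "1 / pp y' (Suc L) + 1 / pp y' (Suc (Suc L)) + 1 / pp y' (Suc (Suc (Suc L)))
      = E * (1 / pp y (Suc L) + 1 / pp y (Suc (Suc L)) + 1 / pp y (Suc (Suc (Suc L))))"
  proof -
    have "1 / pp y' (Suc L) + 1 / pp y' (Suc (Suc L)) = E / Q * ((e2 + p) / e1)"
      unfolding A B by (simp add: distrib_left add_divide_distrib)
    also have "\<dots> = E * (1 / Q)" using pos e12 by simp
    finally have 1: "1 / pp y' (Suc L) + 1 / pp y' (Suc (Suc L)) = E * (1 / Q)" .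
    have "1 / pp y' (Suc (Suc (Suc L))) = E * (E / (Q * u * v))" unfolding C by simp
    also have "E / (Q * u * v) = 1 / (Q * u) + 1 / (Q * u * v)"
      unfolding E(2) using v by (simp add: add_divide_distrib)
    finally have 2: "1 / pp y' (Suc (Suc (Suc L))) = E * (1 / (Q * u) + 1 / (Q * u * v))" .
    show ?thesis unfolding 1 2 D Q_def[symmetric] by (simp add: distrib_left)
  qed
  have sp: "(\<Sum>j\<le>N. 1 / pp z j) = (\<Sum>j\<le>L. 1 / pp z j) + (1 / pp z (Suc L) + 1 / pp z (Suc (Suc L)) + 1 / pp z (Suc (Suc (Suc L))))"
    for z :: "nat \<Rightarrow> real" unfolding NL by (simp add: add.assoc)
  have "(\<Sum>j\<le>N. 1 / pp y' j) = E * (\<Sum>j\<le>N. 1 / pp y j)"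
    unfolding sp three sumL by (simp only: distrib_left)
  moreover have "pp y' N = pp y N * (1 / E) * (1 / E)" unfolding NL C D by simp
  ultimately have "tel N y' = tel N y"
    unfolding tel_pp using E by (simp only: sqrt_mult_square divide_nonneg_pos less_imp_le zero_le_one) simp
  then show ?thesis unfolding y_def y'_def .
qed

end

end

section \<open>All entries of both matrices under the transformation\<close>

lemma elem_target_transformed:
  assumes n: "n > 3" and i: "1 \<le> i" "i \<le> n - 1" and l: "1 \<le> l" "l < n" and c: "odd c"
    and x: "positive n x" and bt: "braid_transformation n (2 * int i + c) x x'"
  shows "elem_target n c l x' = elem_target n c l x"
proof -
  interpret zigzag n "2 * int i + c" using n c by unfold_locales auto
  have "tel N (\<lambda>j. x' (path_target n (2 * int l + c) j)) = tel N (\<lambda>j. x (path_target n (2 * int l + c) j))"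
  proof -
    consider "l = i" | "l < i" | "l = i + 1" | "i + 1 < l" by linarith
    then show ?thesis
    proof cases
      case 1
      then show ?thesis using tel_target_same[OF x bt] by simp
    next
      case 2
      have d: "1 \<le> i - l" "i - l \<le> n - 2" using 2 i l by auto
      have "2 * int i + c - 2 * int (i - l) = 2 * int l + c" using 2 by (simp add: of_nat_diff)
      from tel_target_far[OF x bt d, unfolded this] show ?thesis .
    next
      case 3
      then have "2 * int i + c + 2 = 2 * int l + c" by simp
      from tel_target_next[OF x bt, unfolded this] show ?thesis .
    next
      case 4
      \<comment> \<open>The period \<open>2n\<close> turns a target path after the neighbouring one
        into a path at distance \<open>d\<close> before the reference path.\<close>
      define d where "d = n - (l - i)"
      have d: "1 \<le> d" "d \<le> n - 2" using 4 i l unfolding d_def by auto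
      have e: "2 * int i + c - 2 * int d + 2 * int n = 2 * int l + c" using 4 i l unfolding d_def by (simp add: of_nat_diff)
      have "path_target n (2 * int l + c) j = path_target n (2 * int i + c - 2 * int d) j" for j
        using path_target_shift[of n "2 * int i + c - 2 * int d" j, unfolded e] n by simp
      then show ?thesis using tel_target_far[OF x bt d] by simp
    qed
  qed
  then show ?thesis using n by (simp add: elem_target_eq)
qed

lemma source_tele_transformed:
  assumes n: "n > 3" and i: "1 \<le> i" "i \<le> n - 1" and l: "1 \<le> l" "l < n" and c: "odd c"
    and x: "positive n x"
  shows "ev n (source_tele n c l) (phi n (2 * int i + c) x)
    = ev n (nelson_regge.braided (pb n) half (source_tele n c) i l (l + 1)) x"
proof -
  interpret zigzag n "2 * int i + c" using n c by unfold_locales auto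
  interpret nr: nelson_regge "pb n" half "source_tele n c" n by (rule nelson_regge_source[OF n c])
  define x' where "x' = phi n (2 * int i + c) x"
  have bt: "braid_transformation n (2 * int i + c) x x'"
    unfolding x'_def by (rule braid_transformation_phi)
  have x': "positive n x'" by (rule braid_transformation_positive[OF bt x])
  have ev_source: "ev n (source_tele n c l) y = tel N (\<lambda>j. y (path n (2 * int l + c) j))" if "positive n y" for l y
    unfolding source_tele_def by (rule ev_tele[OF _ that]) (auto intro: path_in_strip)
  \<comment> \<open>Converts the braid formula \<open>P G - G_(i-1,i+1)\<close> into the form
    evaluated by \<open>pb_near\<close>.\<close>
  have double: "a * b - (half * a * b + pb n a b) = half * a * b - pb n a b" for a b
    using laurent.half_mult[of "a * b"] by (simp add: algebra_simps)
  have elem: "nr.F k (k + 1) = source_tele n c k" for k using nr.F_elementary[of k] by simp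
  have next_elem: "nr.F k (k + 2) = half * source_tele n c k * source_tele n c (k + 1)
      + pb n (source_tele n c k) (source_tele n c (k + 1))" for k
    using nr.F_last[of k "k + 1"] elem[of k] by simp
  consider "l = i" | "l = i + 1" | "l + 1 = i" | "l + 1 < i" | "i + 1 < l" by linarith
  then have "ev n (source_tele n c l) x' = ev n (nr.braided i l (l + 1)) x"
  proof cases
    case 1
    have "nr.braided i l (l + 1) = source_tele n c l" unfolding nr.braided_def 1 by simp
    then show ?thesis unfolding ev_source[OF x'] using tel_pth_transformed[OF x bt] ev_source[OF x, of l] 1 by simp
  next
    case 2
    have e: "2 * int l + c = 2 * int i + c + 2" "2 * int (i + 1) + c = 2 * int i + c + 2" using 2 by simp_all
    have b: "nr.braided i l (l + 1) = nr.F i (i + 2)" unfolding nr.braided_def 2 by simp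
    show ?thesis
      unfolding ev_source[OF x'] unfolding b next_elem source_tele_def e by (rule tel_source_next[OF x bt])
  next
    case 3
    have e: "2 * int l + c = 2 * int i + c - 2" using 3 by simp
    have "nr.braided i l (l + 1) = nr.F l (l + 1) * source_tele n c (l + 1) - nr.F l (l + 2)"
      unfolding nr.braided_def 3[symmetric] by simp
    also have "\<dots> = half * source_tele n c l * source_tele n c i - pb n (source_tele n c l) (source_tele n c i)"
      unfolding elem next_elem unfolding 3 double ..
    also have "\<dots> = near_product"
      using pb_near(1) unfolding source_tele_def e .
    finally show ?thesis
      unfolding ev_source[OF x'] e using tel_source_prev[OF x bt] by simp
  next
    case 4
    have b: "nr.braided i l (l + 1) = source_tele n c l" unfolding nr.braided_def using 4 elem by simp
    have s: "2 \<le> i - l" "i - l \<le> n - 2" using 4 i l by auto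
    have e: "2 * int i + c - 2 * int (i - l) = 2 * int l + c" using 4 by (simp add: of_nat_diff)
    show ?thesis
      unfolding b ev_source[OF x'] ev_source[OF x] using tel_source_far[OF x bt s] unfolding e .
  next
    case 5
    define s where "s = n - (l - i)"
    have s: "2 \<le> s" "s \<le> n - 2" using 5 i l unfolding s_def by auto
    have e: "2 * int i + c - 2 * int s + 2 * int n = 2 * int l + c" using 5 i l unfolding s_def by (simp add: of_nat_diff)
    have e': "path n (2 * int l + c) j = path n (2 * int i + c - 2 * int s) j" for j
      using path_shift[of n "2 * int i + c - 2 * int s" j, unfolded e] n by simp
    have b: "nr.braided i l (l + 1) = source_tele n c l" unfolding nr.braided_def using 5 elem by simp
    show ?thesis
      unfolding b ev_source[OF x'] ev_source[OF x] e' by (rule tel_source_far[OF x bt s])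
  qed
  then show ?thesis by (simp only: x'_def)
qed

lemma (in zigzag) braid_transformation_unique:
  assumes "braid_transformation n q x x'" "braid_transformation n q x x''" "v \<in> strip n"
  shows "x' v = x'' v"
  using assms(3)
proof (cases rule: vertex_cases)
  case 5
  then show ?thesis using braid_transformationD(5)[OF assms(1,3)] braid_transformationD(5)[OF assms(2,3)] by simp
qed (use braid_transformationD(1-4)[OF assms(1)] braid_transformationD(1-4)[OF assms(2)] in simp_all)

text \<open>Evaluation reads only strip variables, and on these the transformation is
  single-valued.\<close>

lemma (in zigzag) ev_phi:
  assumes "braid_transformation n q x x'"
  shows "ev n p x' = ev n p (phi n q x)"
  by (rule ev_cong) (rule braid_transformation_unique[OF assms braid_transformation_phi])

text \<open>An application of \<open>braided_entries\<close>. The relation \<open>R\<close>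
  quantifies over all positive states because the bracket differentiates: equality at the single
  state \<open>x\<close> would not pass to brackets.\<close>

lemma source_transformed:
  assumes n: "n > 3" and i: "1 \<le> i" "i \<le> n - 1" and c: "odd c"
    and gen: "generated n 1 (elem_source n c) k l f" and kl: "1 \<le> k" "l \<le> n"
    and x: "positive n x" and bt: "braid_transformation n (2 * int i + c) x x'"
  shows "f x' = ev n (nelson_regge.braided (pb n) half (source_tele n c) i k l) x"
proof -
  interpret zigzag n "2 * int i + c" using n c by unfold_locales auto
  interpret nr: nelson_regge "pb n" half "source_tele n c" n by (rule nelson_regge_source[OF n c])
  define R where "R p p' \<longleftrightarrow> (\<forall>y. positive n y \<longrightarrow> ev n p (phi n (2 * int i + c) y) = ev n p' y)" for p p'
  have "k < l" using generated_source[OF n c gen kl x] by simp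
  have "R (nr.F k l) (nr.braided i k l)"
  proof (rule nr.braided_entries)
    show "R (half * a * b + pb n a b) (half * a' * b' + pb n a' b')" if "R a a'" "R b b'" for a a' b b'
      using that poisson_phi[of _ a a' b b'] unfolding R_def by (auto simp: ev_add ev_mult)
    show "R (source_tele n c l) (nr.braided i l (l + 1))" if "1 \<le> l" "l < n" for l
      unfolding R_def using source_tele_transformed[OF n i that c] by blast
  qed (use i kl n \<open>k < l\<close> in auto)
  then have "ev n (nr.F k l) (phi n (2 * int i + c) x) = ev n (nr.braided i k l) x"
    using x by (simp add: R_def)
  moreover have "f x' = ev n (nr.F k l) x'"
    using generated_source[OF n c gen kl braid_transformation_positive[OF bt x]] by simp
  ultimately show ?thesis using ev_phi[OF bt] by simp
qed

text \<open>A Laurent representative is carried along with its invariance under \<open>phi\<close>.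
  Since \<open>phi\<close> is a Poisson map, invariance passes to brackets for every value of
  \<open>\<sigma>\<close>.\<close>

lemma generated_target:
  assumes n: "n > 3" and i: "1 \<le> i" "i \<le> n - 1" and c: "odd c"
    and gen: "generated n \<sigma> (elem_target n c) k l f" and kl: "1 \<le> k" "l \<le> n"
  shows "\<exists>p. \<forall>y. positive n y \<longrightarrow> f y = ev n p y \<and> ev n p (phi n (2 * int i + c) y) = ev n p y"
  using gen kl
proof (induction)
  case (elementary l)
  interpret zigzag n "2 * int i + c" using n c by unfold_locales auto
  have n0: "n > 0" using n by simp
  have e: "elem_target n c l y = ev n (tele (path_target n (2 * int l + c)) N) y" if "positive n y" for y
    using n unfolding elem_target_eq[OF n0]
    by (subst ev_tele[OF _ that]) (auto intro: path_target_in_strip)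
  have "elem_target n c l (phi n (2 * int i + c) y) = elem_target n c l y" if "positive n y" for y
    using elementary by (intro elem_target_transformed[OF n i _ _ c that braid_transformation_phi]) auto
  then show ?case
    using e braid_transformation_positive[OF braid_transformation_phi] by metis
next
  case (bracket k m l f g)
  interpret zigzag n "2 * int i + c" using n c by unfold_locales auto
  have "1 \<le> m" "m \<le> n" using bracket.hyps bracket.prems by linarith+
  then obtain p r where p: "\<And>y. positive n y \<Longrightarrow> f y = ev n p y"
      "\<And>y. positive n y \<Longrightarrow> ev n p (phi n (2 * int i + c) y) = ev n p y"
    and r: "\<And>y. positive n y \<Longrightarrow> g y = ev n r y"
      "\<And>y. positive n y \<Longrightarrow> ev n r (phi n (2 * int i + c) y) = ev n r y"
    using bracket.IH bracket.prems by metis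
  have "1 / 2 * f y * g y + \<sigma> * poisson n f g y = ev n (half * p * r + Poly_Mapping.single 0 \<sigma> * pb n p r) y
      \<and> ev n (half * p * r + Poly_Mapping.single 0 \<sigma> * pb n p r) (phi n (2 * int i + c) y)
        = ev n (half * p * r + Poly_Mapping.single 0 \<sigma> * pb n p r) y" if "positive n y" for y
    using poisson_eq_ev[OF that p(1) r(1)] poisson_phi[OF that p(2) r(2)] p[OF that] r[OF that]
    by (simp add: ev_add ev_mult ev_single)
  then show ?case by blast
qed

section \<open>Conjugation by the braid matrix, and the conclusion\<close>

lemma sum_two:
  fixes f :: "nat \<Rightarrow> real"
  assumes "a < n" "b < n" "a \<noteq> b" "\<And>k. k < n \<Longrightarrow> k \<noteq> a \<Longrightarrow> k \<noteq> b \<Longrightarrow> f k = 0"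
  shows "(\<Sum>k = 0..<n. f k) = f a + f b"
proof -
  have "(\<Sum>k = 0..<n. f k) = (\<Sum>k\<in>{a, b}. f k)"
    using assms by (intro sum.mono_neutral_right) auto
  then show ?thesis using assms by simp
qed

lemma sum_braid_row:
  fixes f :: "nat \<Rightarrow> real"
  assumes i: "Suc I < n" and r: "r < n"
  shows "(\<Sum>k = 0..<n. braid_matrix n (Suc I) g $$ (r, k) * f k)
    = (if r = I then g * f I + f (Suc I) else if r = Suc I then - f I else f r)"
proof -
  define s where "s = (if r = I then Suc I else if r = Suc I then I else if I = 0 then 1 else 0)"
  consider "r = I" | "r = Suc I" | "r \<noteq> I" "r \<noteq> Suc I" by blast
  then show ?thesis
  proof cases
    case 3
    have "(\<Sum>k = 0..<n. braid_matrix n (Suc I) g $$ (r, k) * f k) = (\<Sum>k = 0..<n. if k = r then f k else 0)"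
      using 3 r by (intro sum.cong) (auto simp: braid_matrix_def)
    then show ?thesis using 3 r by simp
  qed (use i r in \<open>subst sum_two[of I n "Suc I"]; simp add: braid_matrix_def\<close>)+
qed

text \<open>\<open>rw\<close> is the row operation effected by the braid matrix; conjugation
  performs it once on the row index and once on the column index.\<close>

lemma braid_conjugate_entry:
  fixes g :: real
  assumes A: "A \<in> carrier_mat n n" and i: "Suc I < n" and rs: "r < n" "s < n"
  defines "rw \<equiv> \<lambda>f r. (if r = I then g * f I + f (Suc I) else if r = Suc I then - f I else f r :: real)"
  shows "(braid_matrix n (Suc I) g * A * transpose_mat (braid_matrix n (Suc I) g)) $$ (r, s)
    = rw (\<lambda>b. rw (\<lambda>a. A $$ (a, b)) r) s"
proof -
  define B where "B = braid_matrix n (Suc I) g"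
  have B: "B \<in> carrier_mat n n" by (simp add: B_def braid_matrix_def)
  have rw_cong: "rw f t = rw f' t" if "\<And>k. k < n \<Longrightarrow> f k = f' k" "t < n" for f f' t
    using that i by (simp add: rw_def)
  have BA: "(B * A) $$ (r, b) = rw (\<lambda>a. A $$ (a, b)) r" if "b < n" for b
  proof -
    have "(B * A) $$ (r, b) = (\<Sum>k = 0..<n. B $$ (r, k) * A $$ (k, b))"
      using A B rs that by (simp add: scalar_prod_def)
    then show ?thesis unfolding B_def rw_def using sum_braid_row[OF i rs(1), of g "\<lambda>k. A $$ (k, b)"] by simp
  qed
  have "(M * transpose_mat B) $$ (r, s) = (\<Sum>k = 0..<n. B $$ (s, k) * M $$ (r, k))"
    if "M \<in> carrier_mat n n" for M
    using that B rs by (simp add: scalar_prod_def mult.commute)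
  then have "(B * A * transpose_mat B) $$ (r, s) = (\<Sum>k = 0..<n. B $$ (s, k) * (B * A) $$ (r, k))"
    using A B by (meson mult_carrier_mat)
  also have "\<dots> = rw (\<lambda>k. (B * A) $$ (r, k)) s"
    unfolding B_def rw_def by (rule sum_braid_row[OF i rs(2)])
  also have "\<dots> = rw (\<lambda>b. rw (\<lambda>a. A $$ (a, b)) r) s"
    using rs i by (intro rw_cong) (simp_all add: BA)
  finally show ?thesis by (simp only: B_def)
qed

theorem lemma8p3:
  fixes n i :: nat and c :: int and \<sigma> :: real
    and G Gt :: "nat \<Rightarrow> nat \<Rightarrow> state \<Rightarrow> real"
    and x x' :: state
  assumes "n > 3"
    and "1 \<le> i" and "i \<le> n - 1"
    and "odd c"
    and source: "\<And>k l. 1 \<le> k \<Longrightarrow> k < l \<Longrightarrow> l \<le> n \<Longrightarrow>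
      generated n 1 (elem_source n c) k l (G k l)"
    and "\<sigma> = 1 \<or> \<sigma> = -1"
    and target: "\<And>k l. 1 \<le> k \<Longrightarrow> k < l \<Longrightarrow> l \<le> n \<Longrightarrow>
      generated n \<sigma> (elem_target n c) k l (Gt k l)"
    and "\<forall>v\<in>quiver_vertices n. 0 < x v"
    and "braid_transformation n (2 * int i + c) x x'"
  shows "unipotent_form n G x' =
      braid_matrix n i (G i (i + 1) x) * unipotent_form n G x
        * transpose_mat (braid_matrix n i (G i (i + 1) x)) \<and>
    unipotent_form n Gt x' = unipotent_form n Gt x"
proof -
  note n = assms(1) and i = assms(2,3) and c = assms(4) and bt = assms(9)
  have x: "positive n x" using assms(8) by (simp add: positive_def quiver_vertices_eq)
  interpret zigzag n "2 * int i + c" using n c by unfold_locales auto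
  interpret nr: nelson_regge "pb n" half "source_tele n c" n by (rule nelson_regge_source[OF n c])
  have x': "positive n x'" by (rule braid_transformation_positive[OF bt x])
  obtain I where I: "i = Suc I" using i by (cases i) auto
  have In: "Suc I < n" using i n unfolding I by auto
  define a where "a k l = G (Suc k) (Suc l) x" for k l
  define g where "g = a I (Suc I)"
  have F: "ev n (nr.F k l) x = G k l x" if "1 \<le> k" "k < l" "l \<le> n" for k l
    using generated_source[OF n c source[OF that] that(1,3) x] by simp
  have G': "G k l x' = ev n (nr.braided i k l) x" if "1 \<le> k" "k < l" "l \<le> n" for k l
    by (rule source_transformed[OF n i c source[OF that] that(1,3) x bt])
  have gi: "ev n (source_tele n c i) x = g"
    using F[of i "i + 1"] nr.F_elementary[of i] In unfolding I g_def a_def by simp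
  \<comment> \<open>The formulas of \<open>braided\<close> in zero-based indices, ready for
    comparison with matrix entries.\<close>
  have a': "G (Suc k) (Suc l) x' =
      (if k = I then if l = Suc I then g else g * a I l - a (Suc I) l
       else if k = Suc I then a I l
       else if l = I then a k I * g - a k (Suc I)
       else if l = Suc I then a k I else a k l)" if "k < l" "l < n" for k l
    using that In gi
    by (subst G') (auto simp: nr.braided_def I ev_diff ev_mult F a_def)
  have "unipotent_form n G x' = braid_matrix n i g * unipotent_form n G x * transpose_mat (braid_matrix n i g)"
  proof (rule eq_matI)
    fix r s assume "r < dim_row (braid_matrix n i g * unipotent_form n G x * transpose_mat (braid_matrix n i g))"
      "s < dim_col (braid_matrix n i g * unipotent_form n G x * transpose_mat (braid_matrix n i g))"
    then have rs: "r < n" "s < n" by (simp_all add: braid_matrix_def)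
    have A: "unipotent_form n G x \<in> carrier_mat n n" by (simp add: unipotent_form_def)
    have u: "unipotent_form n G x $$ (k, l) = (if k = l then 1 else if k < l then (-1) ^ (k + l) * a k l else 0)"
      if "k < n" "l < n" for k l using that by (simp add: unipotent_form_def a_def)
    have u': "unipotent_form n G x' $$ (r, s) = (if r = s then 1 else if r < s then (-1) ^ (r + s) * G (Suc r) (Suc s) x' else 0)"
      using rs by (simp add: unipotent_form_def)
    have p: "(-1) ^ (k + k) = (1 :: real)" for k :: nat by (simp flip: mult_2)
    show "unipotent_form n G x' $$ (r, s)
        = (braid_matrix n i g * unipotent_form n G x * transpose_mat (braid_matrix n i g)) $$ (r, s)"
    proof -
      have gI: "a I (Suc I) = g" by (simp add: g_def)
      have pos: "k < I \<or> k = I \<or> k = Suc I \<or> Suc I < k" for k by linarith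
      have "I < n" using In by simp
      show ?thesis
        unfolding I braid_conjugate_entry[OF A In rs] u'
        using pos[of r] pos[of s]
        \<comment> \<open>Sixteen positions of \<open>(r, s)\<close> relative to \<open>I\<close>.
          The alternating signs turn the row operations into the formulas of \<open>a'\<close>; at
          \<open>r = s = I\<close> the terms in \<open>g\<close> cancel because the superdiagonal
          entry is \<open>- g\<close>.\<close>
        by (elim disjE) (use rs In \<open>I < n\<close> in \<open>force simp: u p gI a' algebra_simps\<close>)+
    qed
  qed (simp_all add: unipotent_form_def braid_matrix_def)
  moreover have "G i (i + 1) x = g" by (simp add: g_def a_def I)
  moreover have "unipotent_form n Gt x' = unipotent_form n Gt x"
  proof -
    have "Gt k l x' = Gt k l x" if kl: "1 \<le> k" "k < l" "l \<le> n" for k l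
    proof -
      obtain p where p: "\<And>y. positive n y \<Longrightarrow> Gt k l y = ev n p y"
        "\<And>y. positive n y \<Longrightarrow> ev n p (phi n (2 * int i + c) y) = ev n p y"
        using generated_target[OF n i c target[OF kl] kl(1,3)] by blast
      show ?thesis using p(1)[OF x'] p(1)[OF x] p(2)[OF x] ev_phi[OF bt, of p] by simp
    qed
    then show ?thesis unfolding unipotent_form_def by (intro cong_mat) auto
  qed
  ultimately show ?thesis by simp
qed

end
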